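(* Let $T$ be a decomposable tournament on a set $V$ with $|V|\geq 9$. If there is no interval $X$ of $T$ such that $T[X]$ is indecomposable and $|V\setminus X|\leq 2$, then $T$ is $\{-3\}$-reconstructible.
   Context: All tournaments are finite: a tournament $T=(V,A)$ consists of a finite vertex set $V$ and a set $A$ of ordered pairs of distinct vertices such that for all $x\neq y$ in $V$, exactly one of $(x,y),(y,x)$ is in $A$; $x$ dominates $y$ if $(x,y)\in A$. For $X\subseteq V$, $T[X]$ is the induced subtournament. A subset $I\subseteq V$ is an interval of $T$ if every $x\in V\setminus I$ either dominates all elements of $I$ or is dominated by all elements of $I$. The sets $\emptyset$, $V$, $\{x\}$ ($x\in V$) are the trivial intervals. $T$ is indecomposable if all its intervals are trivial, decomposable otherwise. Two tournaments $T,T'$ on the same vertex set $V$ are $\{-3\}$-hypomorphic if $T[V\setminus X]$ and $T'[V\setminus X]$ are isomorphic for every $X\subseteq V$ with $|X|=3$. $T$ is $\{-3\}$-reconstructible if every tournament $\{-3\}$-hypomorphic to $T$ is isomorphic to $T$. *)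

theory Defs
  imports "Graph_Theory.Pair_Digraph" "Graph_Theory.Digraph_Isomorphism"
begin

text \<open>
  Tournaments are arc sets of ordered pairs, hence \<^typ>\<open>'a pair_pre_digraph\<close>. The notions
  below are stated for arbitrary digraphs, so that they apply both to a tournament (through
  \<^const>\<open>with_proj\<close>) and to its induced subdigraphs \<^term>\<open>with_proj T \<restriction> X\<close>.
\<close>

locale tournament = pair_digraph +
  assumes exactly_one_arc:
    "\<lbrakk>x \<in> pverts G; y \<in> pverts G; x \<noteq> y\<rbrakk> \<Longrightarrow> (x, y) \<in> parcs G \<longleftrightarrow> (y, x) \<notin> parcs G"

definition interval :: "('a, 'b) pre_digraph \<Rightarrow> 'a set \<Rightarrow> bool" where
  "interval G I \<longleftrightarrow> I \<subseteq> verts G \<and>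
     (\<forall>x \<in> verts G - I. (\<forall>y \<in> I. x \<rightarrow>\<^bsub>G\<^esub> y) \<or> (\<forall>y \<in> I. y \<rightarrow>\<^bsub>G\<^esub> x))"

definition trivial_interval :: "('a, 'b) pre_digraph \<Rightarrow> 'a set \<Rightarrow> bool" where
  "trivial_interval G I \<longleftrightarrow> I = {} \<or> I = verts G \<or> (\<exists>x \<in> verts G. I = {x})"

definition indecomposable :: "('a, 'b) pre_digraph \<Rightarrow> bool" where
  "indecomposable G \<longleftrightarrow> (\<forall>I. interval G I \<longrightarrow> trivial_interval G I)"

abbreviation decomposable :: "('a, 'b) pre_digraph \<Rightarrow> bool" where
  "decomposable G \<equiv> \<not> indecomposable G"

definition minus3_hypomorphic :: "'a pair_pre_digraph \<Rightarrow> 'a pair_pre_digraph \<Rightarrow> bool" where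
  "minus3_hypomorphic T T' \<longleftrightarrow> pverts T = pverts T' \<and>
     (\<forall>X \<subseteq> pverts T. card X = 3 \<longrightarrow>
        digraph_iso (with_proj T \<restriction> (pverts T - X)) (with_proj T' \<restriction> (pverts T - X)))"

definition minus3_reconstructible :: "'a pair_pre_digraph \<Rightarrow> bool" where
  "minus3_reconstructible T \<longleftrightarrow>
     (\<forall>T'. tournament T' \<and> minus3_hypomorphic T T' \<longrightarrow>
        digraph_iso (with_proj T') (with_proj T))"

text \<open>
  On digraphs whose arcs are pairs, \<^const>\<open>digraph_iso\<close> (which also carries a map on arcs) is
  the existence of an arc-preserving and arc-reflecting bijection between the vertex sets.
\<close>

lemma digraph_iso_with_proj_iff:
  assumes "pair_wf_digraph G" "pair_wf_digraph H"
  shows "digraph_iso (with_proj G) (with_proj H) \<longleftrightarrow>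
    (\<exists>f. bij_betw f (pverts G) (pverts H) \<and>
      (\<forall>x \<in> pverts G. \<forall>y \<in> pverts G. (x, y) \<in> parcs G \<longleftrightarrow> (f x, f y) \<in> parcs H))"
proof
  assume "digraph_iso (with_proj G) (with_proj H)"
  then obtain h where h: "pre_digraph.digraph_isomorphism (with_proj G) h"
    and H: "with_proj H = app_iso h (with_proj G)"
    by (auto simp: digraph_iso_def)
  let ?f = "iso_verts h"
  from H have pv: "pverts H = ?f ` pverts G" and pa: "parcs H = iso_arcs h ` parcs G"
    and t: "iso_tail h = fst" and d: "iso_head h = snd"
    by (auto simp: app_iso_def with_proj_def)
  from h have inj: "inj_on ?f (pverts G)"
    and ends: "\<forall>a \<in> parcs G. ?f (fst a) = fst (iso_arcs h a) \<and> ?f (snd a) = snd (iso_arcs h a)"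
    by (auto simp: pre_digraph.digraph_isomorphism_def t d)
  from ends have "\<forall>a \<in> parcs G. iso_arcs h a = map_prod ?f ?f a"
    by (auto simp: prod_eq_iff)
  with pa have pa': "parcs H = map_prod ?f ?f ` parcs G" by auto
  have "(x, y) \<in> parcs G" if "x \<in> pverts G" "y \<in> pverts G" "(?f x, ?f y) \<in> parcs H" for x y
  proof -
    from that(3) obtain u v where uv: "(u, v) \<in> parcs G" "?f x = ?f u" "?f y = ?f v"
      by (auto simp: pa')
    then have "u \<in> pverts G" "v \<in> pverts G"
      using pair_wf_digraph.wellformed'[OF assms(1)] by blast+
    with uv that inj show ?thesis by (auto dest: inj_onD)
  qed
  moreover have "(?f x, ?f y) \<in> parcs H" if "(x, y) \<in> parcs G" for x y
    unfolding pa' using that by (rule map_prod_imageI)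
  ultimately have "\<forall>x \<in> pverts G. \<forall>y \<in> pverts G. (x, y) \<in> parcs G \<longleftrightarrow> (?f x, ?f y) \<in> parcs H"
    by blast
  with inj pv show "\<exists>f. bij_betw f (pverts G) (pverts H) \<and>
      (\<forall>x \<in> pverts G. \<forall>y \<in> pverts G. (x, y) \<in> parcs G \<longleftrightarrow> (f x, f y) \<in> parcs H)"
    by (auto simp: bij_betw_def intro!: exI[of _ ?f])
next
  assume "\<exists>f. bij_betw f (pverts G) (pverts H) \<and>
      (\<forall>x \<in> pverts G. \<forall>y \<in> pverts G. (x, y) \<in> parcs G \<longleftrightarrow> (f x, f y) \<in> parcs H)"
  then obtain f where f: "inj_on f (pverts G)" "f ` pverts G = pverts H"
    and arc: "\<And>x y. \<lbrakk>x \<in> pverts G; y \<in> pverts G\<rbrakk> \<Longrightarrow> (x, y) \<in> parcs G \<longleftrightarrow> (f x, f y) \<in> parcs H"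
    by (auto simp: bij_betw_def)
  interpret G: pair_wf_digraph G by fact
  interpret H: pair_wf_digraph H by fact
  let ?h = "\<lparr>iso_verts = f, iso_arcs = map_prod f f, iso_head = snd, iso_tail = fst\<rparr>"
  have sub: "parcs G \<subseteq> pverts G \<times> pverts G" by (auto dest: G.wellformed')
  have "inj_on (map_prod f f) (parcs G)"
    using map_prod_inj_on[OF f(1) f(1)] sub by (rule inj_on_subset)
  then have "pre_digraph.digraph_isomorphism (with_proj G) ?h"
    using f G.wf_digraph by (auto simp: pre_digraph.digraph_isomorphism_def)
  moreover have "parcs H = map_prod f f ` parcs G"
  proof (intro equalityI subsetI)
    fix e assume e: "e \<in> parcs H"
    obtain a b where ab: "e = (a, b)" by (cases e)
    with e have "a \<in> f ` pverts G" "b \<in> f ` pverts G" using f(2) H.wellformed' by auto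
    then obtain x y where "x \<in> pverts G" "y \<in> pverts G" "a = f x" "b = f y" by auto
    with arc e ab show "e \<in> map_prod f f ` parcs G" by force
  next
    fix e assume "e \<in> map_prod f f ` parcs G"
    then show "e \<in> parcs H" using arc sub by auto
  qed
  then have "with_proj H = app_iso ?h (with_proj G)"
    using f(2) by (simp add: app_iso_def with_proj_def)
  ultimately show "digraph_iso (with_proj G) (with_proj H)"
    unfolding digraph_iso_def by blast
qed

lemma with_proj_induce_subgraph:
  "with_proj T \<restriction> X = with_proj \<lparr>pverts = X, parcs = parcs T \<inter> X \<times> X\<rparr>"
  by (auto simp: induce_subgraph_def with_proj_def)

end

theory Submission
  imports Defs
begin

text \<open>
  Let \<open>T'\<close> be hypomorphic to \<open>T\<close>. By Kelly's lemma with three prescribed vertices both have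
  the same 3-cycles, and no arc between a common interval containing a 3-cycle and its complement
  is reversed. Consider the components of the graph of reversed arcs: they are common intervals,
  and a component \<open>B\<close> that is not a chain is strong, so that by the theorem on tournaments with
  the same 3-cycles the unreversed arcs do not connect it; hence \<open>T'[B]\<close> is, up to permuting
  chains, the dual of \<open>T[B]\<close>. It remains to prove \<open>T[B] \<cong> T'[B]\<close>. If at least three vertices lie
  outside \<open>B\<close>, count the copies of \<open>T[B]\<close> through a 3-cycle of \<open>B\<close>: every such copy is \<open>B\<close> itself.
  Otherwise \<open>T[B]\<close> is decomposable, hence has two twin vertices; counting 5-vertex copies around
  these shows that \<open>T[B]\<close> contains no diamond (a vertex dominating, or dominated by, a 3-cycle).
  Then \<open>T[B]\<close> is a blow-up by chains of a rotational tournament on \<open>\<int>/L\<close>, described by a cyclic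
  sequence of sizes which is a palindrome iff \<open>T[B]\<close> is self-dual. All subtournaments of \<open>T[B]\<close>
  with \<open>n - 3 \<ge> 6\<close> vertices are self-dual, and a cyclic sequence with sum at least 7 is a palindrome
  as soon as all its one-element deletions are.
\<close>

section \<open>Tournaments and isomorphisms\<close>

text \<open>Deleting three vertices allows copies of size at most n - 3 to be counted through at
  most three prescribed vertices: enough for a 3-cycle, or for two twins and one more vertex. A
  block missing at most two vertices is too large to be counted as a whole. All that is known there
  is that its subtournaments on n - 3 vertices are isomorphic to their duals, and self-duality must
  be lifted from them to the block; the structure of diamond-free tournaments is what makes this
  possible. The hypothesis on intervals enters exactly here: a large block is an interval of T, so
  it is decomposable and yields twins. The five-vertex copies are diamonds with one vertex replaced
  by the twins. Uniformity fixes the place of the twins in each copy, while reversing the block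
  exchanges their in- and out-neighbours, so the counts cannot balance. The constant 9 reflects the
  cyclic sequence (1, 2, 3) of sum 6. It is no palindrome, but each deletion leaves a palindrome or
  a chain. Hence the lift has to start at n - 3 \<ge> 6, so that each of its steps has at least 7
  vertices.\<close>

definition tour :: "'a set \<Rightarrow> ('a \<Rightarrow> 'a \<Rightarrow> bool) \<Rightarrow> bool" where
  "tour V E \<longleftrightarrow> finite V \<and> (\<forall>x\<in>V. \<not> E x x) \<and> (\<forall>x\<in>V. \<forall>y\<in>V. x \<noteq> y \<longrightarrow> E x y \<noteq> E y x)"

definition tour_iso :: "'a set \<Rightarrow> ('a \<Rightarrow> 'a \<Rightarrow> bool) \<Rightarrow> 'b set \<Rightarrow> ('b \<Rightarrow> 'b \<Rightarrow> bool) \<Rightarrow> bool" where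
  "tour_iso V E W F \<longleftrightarrow> (\<exists>f. bij_betw f V W \<and> (\<forall>x\<in>V. \<forall>y\<in>V. E x y = F (f x) (f y)))"

abbreviation dual_arcs :: "('a \<Rightarrow> 'a \<Rightarrow> bool) \<Rightarrow> 'a \<Rightarrow> 'a \<Rightarrow> bool" ("_\<^sup>d" [1000] 1000) where
  "E\<^sup>d \<equiv> conversep E"

definition cyc :: "('a \<Rightarrow> 'a \<Rightarrow> bool) \<Rightarrow> 'a \<Rightarrow> 'a \<Rightarrow> 'a \<Rightarrow> bool" where
  "cyc E a b c \<longleftrightarrow> E a b \<and> E b c \<and> E c a"

definition cycle_free :: "'a set \<Rightarrow> ('a \<Rightarrow> 'a \<Rightarrow> bool) \<Rightarrow> bool" where
  "cycle_free V E \<longleftrightarrow> (\<forall>a\<in>V. \<forall>b\<in>V. \<forall>c\<in>V. \<not> cyc E a b c)"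

lemma tour_isoI:
  assumes "bij_betw f V W" "\<And>x y. x \<in> V \<Longrightarrow> y \<in> V \<Longrightarrow> E x y = F (f x) (f y)"
  shows "tour_iso V E W F"
  unfolding tour_iso_def by (rule exI[of _ f]) (simp add: assms)

lemma tour_isoE:
  assumes "tour_iso V E W F"
  obtains f where "bij_betw f V W" "\<forall>x\<in>V. \<forall>y\<in>V. E x y = F (f x) (f y)"
  using assms unfolding tour_iso_def by (elim exE conjE)

lemma tour_subset: "tour V E \<Longrightarrow> W \<subseteq> V \<Longrightarrow> tour W E"
  unfolding tour_def by (meson finite_subset subsetD)

lemma tour_finite: "tour V E \<Longrightarrow> finite V"
  by (simp add: tour_def)

lemma tour_irrefl: "tour V E \<Longrightarrow> x \<in> V \<Longrightarrow> \<not> E x x"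
  by (simp add: tour_def)

lemma tour_flip: "tour V E \<Longrightarrow> x \<in> V \<Longrightarrow> y \<in> V \<Longrightarrow> x \<noteq> y \<Longrightarrow> E y x \<longleftrightarrow> \<not> E x y"
  unfolding tour_def by metis

lemma tour_asym: "tour V E \<Longrightarrow> x \<in> V \<Longrightarrow> y \<in> V \<Longrightarrow> E x y \<Longrightarrow> \<not> E y x"
  unfolding tour_def by metis

lemma tour_dual: "tour V E\<^sup>d \<longleftrightarrow> tour V E"
  unfolding tour_def by auto

lemma cyc_dual: "cyc E\<^sup>d a b c \<longleftrightarrow> cyc E a c b"
  unfolding cyc_def by auto

lemma cyc_rot: "cyc E a b c \<Longrightarrow> cyc E b c a"
  unfolding cyc_def by auto

lemma cycle_free_dual: "cycle_free V E\<^sup>d \<longleftrightarrow> cycle_free V E"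
  unfolding cycle_free_def cyc_dual by blast

lemma cycle_free_subset: "cycle_free V E \<Longrightarrow> W \<subseteq> V \<Longrightarrow> cycle_free W E"
  unfolding cycle_free_def by blast

lemma tour_iso_refl: "tour_iso V E V E"
  by (rule tour_isoI[of id]) simp_all

lemma tour_iso_sym:
  assumes "tour_iso V E W F" shows "tour_iso W F V E"
proof -
  from assms obtain f where f: "bij_betw f V W"
    and E: "\<forall>x\<in>V. \<forall>y\<in>V. E x y = F (f x) (f y)" by (rule tour_isoE)
  let ?g = "inv_into V f"
  have g: "bij_betw ?g W V" using f by (rule bij_betw_inv_into)
  show ?thesis
  proof (rule tour_isoI[OF g])
    fix x y assume xy: "x \<in> W" "y \<in> W"
    then have "?g x \<in> V" "?g y \<in> V" using bij_betw_apply[OF g] by simp_all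
    then show "F x y = E (?g x) (?g y)"
      using E xy bij_betw_inv_into_right[OF f] by simp
  qed
qed

lemma tour_iso_trans:
  assumes "tour_iso V E W F" "tour_iso W F U G" shows "tour_iso V E U G"
proof -
  from assms(1) obtain f where f: "bij_betw f V W"
    and E: "\<forall>x\<in>V. \<forall>y\<in>V. E x y = F (f x) (f y)" by (rule tour_isoE)
  from assms(2) obtain g where g: "bij_betw g W U"
    and F: "\<forall>x\<in>W. \<forall>y\<in>W. F x y = G (g x) (g y)" by (rule tour_isoE)
  show ?thesis
  proof (rule tour_isoI[OF bij_betw_trans[OF f g]])
    fix x y assume xy: "x \<in> V" "y \<in> V"
    then have "f x \<in> W" "f y \<in> W" using bij_betw_apply[OF f] by simp_all
    then show "E x y = G ((g \<circ> f) x) ((g \<circ> f) y)" using E F xy by simp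
  qed
qed

lemma tour_iso_dual: "tour_iso V E W F \<Longrightarrow> tour_iso V E\<^sup>d W F\<^sup>d"
  by (erule tour_isoE, rule tour_isoI) auto

lemma tour_iso_dual_iff: "tour_iso V E\<^sup>d W F\<^sup>d \<longleftrightarrow> tour_iso V E W F"
  using tour_iso_dual[of V E W F] tour_iso_dual[of V "E\<^sup>d" W "F\<^sup>d"] by auto

lemma tour_iso_card: "tour_iso V E W F \<Longrightarrow> card V = card W"
  by (erule tour_isoE) (rule bij_betw_same_card)

lemma cycle_free_trans:
  assumes "tour V E" "cycle_free V E" "x \<in> V" "y \<in> V" "z \<in> V" "E x y" "E y z"
  shows "E x z"
proof -
  have "x \<noteq> z" using assms tour_asym[of V E x y] by blast
  moreover have "\<not> E z x" using assms unfolding cycle_free_def cyc_def by blast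
  ultimately show ?thesis using tour_flip[of V E z x] assms by blast
qed

text \<open>Without 3-cycles domination is transitive, so in-degrees increase strictly along arcs
  and run through 0, ..., n - 1. The ranks serve to compare chains and, later, to order a switched
  tournament.\<close>

lemma cycle_free_rank:
  assumes "tour V E" "cycle_free V E"
  shows "bij_betw (\<lambda>x. card {y\<in>V. E y x}) V {..<card V}"
    and "\<And>x y. x \<in> V \<Longrightarrow> y \<in> V \<Longrightarrow> E x y \<longleftrightarrow> card {z\<in>V. E z x} < card {z\<in>V. E z y}"
proof -
  let ?r = "\<lambda>x. card {y\<in>V. E y x}"
  have fin: "finite V" using assms(1) by (rule tour_finite)
  have less: "?r x < ?r y" if "x \<in> V" "y \<in> V" "E x y" for x y
  proof (rule psubset_card_mono)
    show "finite {z\<in>V. E z y}" using fin by simp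
    have "x \<notin> {z\<in>V. E z x}" using assms(1) that(1) by (simp add: tour_irrefl)
    moreover have "{z\<in>V. E z x} \<subseteq> {z\<in>V. E z y}"
      using cycle_free_trans[OF assms] that by blast
    ultimately show "{z\<in>V. E z x} \<subset> {z\<in>V. E z y}" using that by blast
  qed
  show iff: "E x y \<longleftrightarrow> ?r x < ?r y" if "x \<in> V" "y \<in> V" for x y
    using less[of x y] less[of y x] that tour_flip[OF assms(1) that] by fastforce
  have inj: "inj_on ?r V"
  proof (rule inj_onI)
    fix x y assume "x \<in> V" "y \<in> V" "?r x = ?r y"
    then show "x = y" using iff[of x y] iff[of y x] tour_flip[OF assms(1), of x y] by auto
  qed
  have "?r x < card V" if "x \<in> V" for x
  proof (rule psubset_card_mono[OF fin])
    have "x \<notin> {y\<in>V. E y x}" using assms(1) that by (simp add: tour_irrefl)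
    with that show "{y\<in>V. E y x} \<subset> V" by blast
  qed
  then have "?r ` V \<subseteq> {..<card V}" by auto
  then have "?r ` V = {..<card V}"
    using card_image[OF inj] by (intro card_subset_eq) auto
  with inj show "bij_betw ?r V {..<card V}" by (simp add: bij_betw_def)
qed

lemma chain_iso_less:
  assumes "tour V E" "cycle_free V E"
  shows "tour_iso V E {..<card V} (<)"
  using cycle_free_rank[OF assms] by (rule tour_isoI)

lemma chain_iso:
  assumes "tour V E" "cycle_free V E" "tour W F" "cycle_free W F" "card V = card W"
  shows "tour_iso V E W F"
proof -
  have "tour_iso W F {..<card V} (<)" using chain_iso_less[OF assms(3,4)] assms(5) by simp
  then show ?thesis by (rule tour_iso_trans[OF chain_iso_less[OF assms(1,2)] tour_iso_sym])
qed

text \<open>By \<open>cross\<close>, arcs between two classes depend on the colours alone, so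
  arbitrarily chosen isomorphisms of the classes fit together. The classes will be chains of a
  block, fibres of a model, and components of reversed arcs.\<close>

lemma tour_iso_glue:
  assumes cls: "c ` V = d ` W"
    and fib: "\<And>k. k \<in> c ` V \<Longrightarrow> tour_iso {v\<in>V. c v = k} E {w\<in>W. d w = k} F"
    and cross: "\<And>v v' w w'. \<lbrakk>v \<in> V; v' \<in> V; w \<in> W; w' \<in> W; c v \<noteq> c v'; d w = c v; d w' = c v'\<rbrakk>
      \<Longrightarrow> E v v' = F w w'"
  shows "tour_iso V E W F"
proof -
  let ?P = "\<lambda>k f. bij_betw f {v\<in>V. c v = k} {w\<in>W. d w = k} \<and>
      (\<forall>x\<in>{v\<in>V. c v = k}. \<forall>y\<in>{v\<in>V. c v = k}. E x y = F (f x) (f y))"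
  define g where "g k = (SOME f. ?P k f)" for k
  have g': "?P k (g k)" if "k \<in> c ` V" for k
    unfolding g_def by (rule someI_ex[OF fib[OF that, unfolded tour_iso_def]])
  have g: "bij_betw (g k) {v\<in>V. c v = k} {w\<in>W. d w = k}" if "k \<in> c ` V" for k
    using g'[OF that] by (rule conjunct1)
  have gE: "E x y = F (g (c x) x) (g (c x) y)" if "x \<in> V" "y \<in> V" "c y = c x" for x y
  proof -
    have "x \<in> {v\<in>V. c v = c x}" "y \<in> {v\<in>V. c v = c x}" using that by simp_all
    then show ?thesis by (rule bspec[OF bspec[OF conjunct2[OF g'[OF imageI[OF that(1)]]]]])
  qed
  define f where "f v = g (c v) v" for v
  have fW: "f v \<in> W" "d (f v) = c v" if "v \<in> V" for v
  proof -
    have "g (c v) v \<in> {w\<in>W. d w = c v}"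
      by (rule bij_betw_apply[OF g[OF imageI[OF that]]]) (simp add: that)
    then show "f v \<in> W" "d (f v) = c v" by (simp_all add: f_def)
  qed
  have "inj_on f V"
  proof (rule inj_onI)
    fix x y assume xy: "x \<in> V" "y \<in> V" "f x = f y"
    have c: "c y = c x" using fW(2)[OF xy(1)] fW(2)[OF xy(2)] xy(3) by simp
    moreover have "inj_on (g (c x)) {v\<in>V. c v = c x}"
      by (rule bij_betw_imp_inj_on[OF g[OF imageI[OF xy(1)]]])
    moreover have "g (c x) x = g (c x) y" using xy(3) c by (simp add: f_def)
    ultimately show "x = y" using xy(1,2) by (simp add: inj_on_def)
  qed
  moreover have "f ` V = W"
  proof (intro equalityI subsetI)
    fix w assume w: "w \<in> W"
    then have k: "d w \<in> c ` V" using cls by auto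
    then have "w \<in> g (d w) ` {v\<in>V. c v = d w}"
      using bij_betw_imp_surj_on[OF g[OF k]] w by blast
    then obtain x where "x \<in> V" "c x = d w" "w = g (d w) x" by blast
    then show "w \<in> f ` V" unfolding f_def by (auto intro!: image_eqI[of _ _ x])
  next
    fix w assume "w \<in> f ` V"
    then show "w \<in> W" by (auto intro: fW(1))
  qed
  ultimately have "bij_betw f V W" by (simp add: bij_betw_def)
  then show ?thesis
  proof (rule tour_isoI)
    fix x y assume xy: "x \<in> V" "y \<in> V"
    show "E x y = F (f x) (f y)"
    proof (cases "c x = c y")
      case True
      with gE[OF xy] show ?thesis by (simp add: f_def)
    next
      case False
      then show ?thesis by (intro cross xy fW)
    qed
  qed
qed

section \<open>Counting copies\<close>

definition hypomorphic3 :: "'a set \<Rightarrow> ('a \<Rightarrow> 'a \<Rightarrow> bool) \<Rightarrow> ('a \<Rightarrow> 'a \<Rightarrow> bool) \<Rightarrow> bool" where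
  "hypomorphic3 V E E' \<longleftrightarrow> (\<forall>J\<subseteq>V. card J + 3 = card V \<longrightarrow> tour_iso J E J E')"

text \<open>Kelly's double counting: summing over \<open>J - {v}\<close> for all \<open>v\<close> in
  \<open>J\<close> counts each \<open>p\<close>-set exactly \<open>card J - p\<close> times, a
  nonzero factor.\<close>

lemma sum_subsets_larger:
  fixes f :: "'a set \<Rightarrow> int"
  assumes "finite V" "p \<le> m"
    and base: "\<And>J. J \<subseteq> V \<Longrightarrow> card J = m \<Longrightarrow> (\<Sum>K | K \<subseteq> J \<and> card K = p. f K) = 0"
  shows "J \<subseteq> V \<Longrightarrow> card J = m + d \<Longrightarrow> (\<Sum>K | K \<subseteq> J \<and> card K = p. f K) = 0"
proof (induction d arbitrary: J)
  case 0
  then show ?case by (simp add: base)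
next
  case (Suc d)
  have fin: "finite J" using Suc.prems(1) assms(1) finite_subset by blast
  let ?B = "{K. K \<subseteq> J \<and> card K = p}"
  have finB: "finite ?B" using fin by simp
  have "(\<Sum>K\<in>{K. K \<in> ?B \<and> v \<notin> K}. f K) = 0" if "v \<in> J" for v
  proof -
    have "card (J - {v}) = m + d" using that fin Suc.prems(2) by simp
    then have "(\<Sum>K | K \<subseteq> J - {v} \<and> card K = p. f K) = 0"
      using Suc.prems(1) by (intro Suc.IH) auto
    moreover have "{K. K \<subseteq> J - {v} \<and> card K = p} = {K. K \<in> ?B \<and> v \<notin> K}" by blast
    ultimately show ?thesis by simp
  qed
  then have "0 = (\<Sum>v\<in>J. \<Sum>K\<in>{K. K \<in> ?B \<and> v \<notin> K}. f K)" by simp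
  also have "\<dots> = (\<Sum>K\<in>?B. \<Sum>v\<in>{v. v \<in> J \<and> v \<notin> K}. f K)"
    by (rule sum.swap_restrict[OF fin finB])
  also have "\<dots> = (\<Sum>K\<in>?B. int (m + Suc d - p) * f K)"
  proof (rule sum.cong)
    fix K assume K: "K \<in> ?B"
    have "{v. v \<in> J \<and> v \<notin> K} = J - K" by blast
    moreover have "card (J - K) = m + Suc d - p"
      using K Suc.prems(2) card_Diff_subset[of K J] finite_subset[OF _ fin, of K] by simp
    ultimately show "(\<Sum>v\<in>{v. v \<in> J \<and> v \<notin> K}. f K) = int (m + Suc d - p) * f K" by simp
  qed simp
  also have "\<dots> = int (m + Suc d - p) * (\<Sum>K\<in>?B. f K)" by (simp add: sum_distrib_left)
  finally have "int (m + Suc d - p) * (\<Sum>K\<in>?B. f K) = 0" by (rule sym)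
  moreover have "int (m + Suc d - p) \<noteq> 0" using assms(2) by simp
  ultimately show ?case by (simp only: mult_eq_0_iff simp_thms)
qed

text \<open>Sets containing \<open>S\<close> either contain \<open>v\<close> as well or lie in
  \<open>J - {v}\<close>. Each prescribed vertex thus uses up one vertex of \<open>J\<close>, whence
  the margin \<open>m + card S \<le> card J\<close>; for \<open>m = n - 3\<close> it leaves room for
  three.\<close>

lemma sum_supersets_zero:
  fixes f :: "'a set \<Rightarrow> int"
  assumes "finite V" "p \<le> m"
    and base: "\<And>J. J \<subseteq> V \<Longrightarrow> card J = m \<Longrightarrow> (\<Sum>K | K \<subseteq> J \<and> card K = p. f K) = 0"
    and "finite S"
  shows "S \<subseteq> J \<Longrightarrow> J \<subseteq> V \<Longrightarrow> m + card S \<le> card J \<Longrightarrow>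
    (\<Sum>K | S \<subseteq> K \<and> K \<subseteq> J \<and> card K = p. f K) = 0"
  using \<open>finite S\<close>
proof (induction S arbitrary: J rule: finite_induct)
  case empty
  then have "card J = m + (card J - m)" by simp
  then show ?case using sum_subsets_larger[OF assms(1-3) empty.prems(2)] by simp
next
  case (insert v S)
  have fin: "finite J" using insert.prems(2) assms(1) finite_subset by blast
  have "card (J - {v}) = card J - 1" using insert.prems(1) by simp
  then have less: "m + card S \<le> card (J - {v})"
    using insert.prems(3) insert.hyps by simp
  have *: "{K. S \<subseteq> K \<and> K \<subseteq> J \<and> card K = p} =
      {K. insert v S \<subseteq> K \<and> K \<subseteq> J \<and> card K = p} \<union> {K. S \<subseteq> K \<and> K \<subseteq> J - {v} \<and> card K = p}"
    using insert.hyps(2) by auto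
  have "(\<Sum>K | S \<subseteq> K \<and> K \<subseteq> J \<and> card K = p. f K) =
      (\<Sum>K | insert v S \<subseteq> K \<and> K \<subseteq> J \<and> card K = p. f K) +
      (\<Sum>K | S \<subseteq> K \<and> K \<subseteq> J - {v} \<and> card K = p. f K)"
    unfolding * by (rule sum.union_disjoint) (use fin in \<open>auto intro: finite_subset[of _ "Pow J"]\<close>)
  moreover have "(\<Sum>K | S \<subseteq> K \<and> K \<subseteq> J \<and> card K = p. f K) = 0"
    using insert.prems insert.hyps by (intro insert.IH) auto
  moreover have "(\<Sum>K | S \<subseteq> K \<and> K \<subseteq> J - {v} \<and> card K = p. f K) = 0"
    using insert.prems insert.hyps less by (intro insert.IH) auto
  ultimately show ?case by simp
qed

lemma card_copies_iso:
  assumes "tour_iso J E J E'"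
  shows "card {K. K \<subseteq> J \<and> tour_iso K E H F} = card {K. K \<subseteq> J \<and> tour_iso K E' H F}"
proof -
  from assms obtain g where g: "bij_betw g J J" and gE: "\<forall>x\<in>J. \<forall>y\<in>J. E x y = E' (g x) (g y)"
    by (rule tour_isoE)
  have iso: "tour_iso K E (g ` K) E'" if "K \<subseteq> J" for K
  proof (rule tour_isoI)
    show "bij_betw g K (g ` K)" using bij_betw_subset[OF g that refl] .
    show "E x y = E' (g x) (g y)" if "x \<in> K" "y \<in> K" for x y
      using gE that \<open>K \<subseteq> J\<close> by blast
  qed
  have "bij_betw (image g) {K. K \<subseteq> J \<and> tour_iso K E H F} {K. K \<subseteq> J \<and> tour_iso K E' H F}"
  proof (rule bij_betw_imageI)
    show "inj_on ((`) g) {K. K \<subseteq> J \<and> tour_iso K E H F}"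
      using bij_betw_imp_inj_on[OF g] by (intro inj_onI) (simp add: inj_on_image_eq_iff)
    show "(`) g ` {K. K \<subseteq> J \<and> tour_iso K E H F} = {K. K \<subseteq> J \<and> tour_iso K E' H F}"
    proof (intro equalityI subsetI)
      fix L assume "L \<in> (`) g ` {K. K \<subseteq> J \<and> tour_iso K E H F}"
      then obtain K where K: "K \<subseteq> J" "tour_iso K E H F" "L = g ` K" by auto
      have "L \<subseteq> J" using K(1,3) bij_betw_imp_surj_on[OF g] by blast
      moreover have "tour_iso L E' H F" unfolding K(3)
        by (rule tour_iso_trans[OF tour_iso_sym[OF iso[OF K(1)]] K(2)])
      ultimately show "L \<in> {K. K \<subseteq> J \<and> tour_iso K E' H F}" by simp
    next
      fix L assume L: "L \<in> {K. K \<subseteq> J \<and> tour_iso K E' H F}"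
      define K where "K = {x\<in>J. g x \<in> L}"
      have K: "K \<subseteq> J" "g ` K = L"
        using L bij_betw_imp_surj_on[OF g] unfolding K_def by auto
      have "tour_iso K E H F"
        using tour_iso_trans[OF iso[OF K(1)], of H F] L unfolding K(2) by simp
      with K(1) have "K \<in> {K. K \<subseteq> J \<and> tour_iso K E H F}" by simp
      then show "L \<in> (`) g ` {K. K \<subseteq> J \<and> tour_iso K E H F}"
        unfolding K(2)[symmetric] by (rule imageI)
    qed
  qed
  then show ?thesis by (rule bij_betw_same_card)
qed

text \<open>Kelly's lemma with up to three prescribed vertices.\<close>

lemma hypomorphic3_count:
  assumes fin: "finite V" and hyp: "hypomorphic3 V E E'"
    and S: "S \<subseteq> V" "card S \<le> 3" and p: "card H + 3 \<le> card V"
  shows "card {K. S \<subseteq> K \<and> K \<subseteq> V \<and> tour_iso K E H F} = card {K. S \<subseteq> K \<and> K \<subseteq> V \<and> tour_iso K E' H F}"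
proof -
  \<comment> \<open>A signed difference of indicators: a vanishing sum says that both tournaments
    have equally many copies among the sets summed over.\<close>
  define f where "f K = of_bool (tour_iso K E H F) - (of_bool (tour_iso K E' H F) :: int)" for K
  let ?p = "card H"
  have *: "(\<Sum>K\<in>A. f K) = int (card {K\<in>A. tour_iso K E H F}) - int (card {K\<in>A. tour_iso K E' H F})"
    if "finite A" for A
    using that by (simp add: f_def sum_subtractf Int_def)
  have sub: "{K\<in>{K. P K \<and> card K = ?p}. tour_iso K G H F} = {K. P K \<and> tour_iso K G H F}" for P G
    using tour_iso_card by blast
  have "(\<Sum>K | S \<subseteq> K \<and> K \<subseteq> V \<and> card K = ?p. f K) = 0"
  proof (rule sum_supersets_zero[OF fin, of _ "card V - 3"])
    show "?p \<le> card V - 3" "card V - 3 + card S \<le> card V" using S p by simp_all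
    show "finite S" using S fin finite_subset by blast
    fix J assume J: "J \<subseteq> V" "card J = card V - 3"
    then have "tour_iso J E J E'" using hyp p unfolding hypomorphic3_def by simp
    then have "card {K. K \<subseteq> J \<and> tour_iso K E H F} = card {K. K \<subseteq> J \<and> tour_iso K E' H F}"
      by (rule card_copies_iso)
    moreover have "finite {K. K \<subseteq> J \<and> card K = ?p}"
      using finite_subset[OF J(1) fin] by simp
    ultimately show "(\<Sum>K | K \<subseteq> J \<and> card K = ?p. f K) = 0"
      using *[of "{K. K \<subseteq> J \<and> card K = ?p}"] unfolding sub by simp
  qed (use S in auto)
  moreover have "finite {K. S \<subseteq> K \<and> K \<subseteq> V \<and> card K = ?p}"
    using fin by (auto intro: finite_subset[of _ "Pow V"])
  moreover have "{K\<in>{K. S \<subseteq> K \<and> K \<subseteq> V \<and> card K = ?p}. tour_iso K G H F} =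
      {K. S \<subseteq> K \<and> K \<subseteq> V \<and> tour_iso K G H F}" for G
    using tour_iso_card by blast
  ultimately show ?thesis
    using *[of "{K. S \<subseteq> K \<and> K \<subseteq> V \<and> card K = ?p}"] by (simp only:)
qed

lemma hypomorphic3_copy:
  assumes "finite V" "hypomorphic3 V E E'" "S \<subseteq> K" "K \<subseteq> V" "card S \<le> 3" "card K + 3 \<le> card V"
  shows "\<exists>L. S \<subseteq> L \<and> L \<subseteq> V \<and> tour_iso L E' K E"
proof -
  let ?A = "\<lambda>G. {L. S \<subseteq> L \<and> L \<subseteq> V \<and> tour_iso L G K E}"
  have fin: "finite (?A G)" for G
    by (rule finite_subset[of _ "Pow V"]) (use assms(1) in auto)
  have "K \<in> ?A E" using assms(3,4) tour_iso_refl by blast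
  then have "card (?A E) > 0" using fin[of E] by (auto simp: card_gt_0_iff)
  moreover have "card (?A E) = card (?A E')"
    using assms(3,4) by (intro hypomorphic3_count[OF assms(1,2) _ assms(5,6)]) blast
  ultimately have "?A E' \<noteq> {}" by (metis card.empty less_irrefl)
  then show ?thesis by blast
qed

section \<open>Tournaments with the same 3-cycles\<close>

abbreviation uniform :: "('a \<Rightarrow> 'a \<Rightarrow> bool) \<Rightarrow> 'a \<Rightarrow> 'a set \<Rightarrow> bool" where
  "uniform E x I \<equiv> (\<forall>y\<in>I. E x y) \<or> (\<forall>y\<in>I. E y x)"

definition ivl :: "'a set \<Rightarrow> ('a \<Rightarrow> 'a \<Rightarrow> bool) \<Rightarrow> 'a set \<Rightarrow> bool" where
  "ivl V E I \<longleftrightarrow> I \<subseteq> V \<and> (\<forall>x\<in>V - I. uniform E x I)"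

definition same_cycles :: "'a set \<Rightarrow> ('a \<Rightarrow> 'a \<Rightarrow> bool) \<Rightarrow> ('a \<Rightarrow> 'a \<Rightarrow> bool) \<Rightarrow> bool" where
  "same_cycles V E F \<longleftrightarrow>
     (\<forall>a\<in>V. \<forall>b\<in>V. \<forall>c\<in>V. (cyc E a b c \<or> cyc E a c b) = (cyc F a b c \<or> cyc F a c b))"

text \<open>The graph of reversed arcs. With the dual of \<open>F\<close> in place of
  \<open>F\<close> it becomes its complement off the diagonal, so one notion covers reversed and
  kept arcs.\<close>

definition diff :: "('a \<Rightarrow> 'a \<Rightarrow> bool) \<Rightarrow> ('a \<Rightarrow> 'a \<Rightarrow> bool) \<Rightarrow> 'a \<Rightarrow> 'a \<Rightarrow> bool" where
  "diff E F a b \<longleftrightarrow> E a b \<noteq> F a b"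

text \<open>Connectedness as the absence of a cut: for the arc relation of a tournament this is strong
  connectedness.\<close>

definition conn :: "('a \<Rightarrow> 'a \<Rightarrow> bool) \<Rightarrow> 'a set \<Rightarrow> bool" where
  "conn R B \<longleftrightarrow> (\<forall>D. D \<subset> B \<and> D \<noteq> {} \<longrightarrow> (\<exists>a\<in>D. \<exists>b\<in>B - D. R a b))"

definition component :: "('a \<Rightarrow> 'a \<Rightarrow> bool) \<Rightarrow> 'a set \<Rightarrow> 'a \<Rightarrow> 'a set" where
  "component R B u = {w. (u, w) \<in> {(a, b). a \<in> B \<and> b \<in> B \<and> R a b}\<^sup>*}"

lemma connD: "conn R B \<Longrightarrow> D \<subseteq> B \<Longrightarrow> D \<noteq> B \<Longrightarrow> D \<noteq> {} \<Longrightarrow> \<exists>a\<in>D. \<exists>b\<in>B - D. R a b"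
  unfolding conn_def by (simp add: psubset_eq)

lemma connI:
  assumes "\<And>D. D \<subset> B \<Longrightarrow> D \<noteq> {} \<Longrightarrow> \<exists>a\<in>D. \<exists>b\<in>B - D. R a b"
  shows "conn R B"
  unfolding conn_def using assms by simp

lemma same_cycles_subset: "same_cycles V E F \<Longrightarrow> W \<subseteq> V \<Longrightarrow> same_cycles W E F"
  unfolding same_cycles_def by (simp add: subset_iff)

lemma same_cycles_dual: "same_cycles V E F\<^sup>d \<longleftrightarrow> same_cycles V E F"
  unfolding same_cycles_def cyc_dual by auto

lemma same_cycles_sym: "same_cycles V E F \<Longrightarrow> same_cycles V F E"
  unfolding same_cycles_def by simp

lemma diff_sym:
  assumes "tour V E" "tour V F" "a \<in> V" "b \<in> V" "diff E F a b" shows "diff E F b a"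
proof -
  have "a \<noteq> b" using assms tour_irrefl[of V E] tour_irrefl[of V F] unfolding diff_def by auto
  then show ?thesis
    using assms tour_flip[of V E a b] tour_flip[of V F a b] unfolding diff_def by simp
qed

lemma diff_dual:
  assumes "tour V E" "tour V F" "a \<in> V" "b \<in> V" "a \<noteq> b"
  shows "diff E F\<^sup>d a b \<longleftrightarrow> \<not> diff E F a b"
  using assms tour_flip[of V F a b] unfolding diff_def by simp

text \<open>If \<open>x\<close> split \<open>C\<close>, some reversed arc would join
  \<open>a\<close> and \<open>b\<close> with \<open>x\<close> dominating \<open>a\<close> and
  \<open>b\<close> dominating \<open>x\<close>. The arcs at \<open>x\<close> being kept,
  \<open>x, a, b\<close> would be a 3-cycle in exactly one of the two tournaments.\<close>

lemma conn_uniform: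
  assumes "tour V E" "tour V F" "same_cycles V E F" "C \<subseteq> V" "conn (diff E F) C"
    and x: "x \<in> V" "x \<notin> C" and nd: "\<And>c. c \<in> C \<Longrightarrow> \<not> diff E F x c"
  shows "uniform E x C"
proof (rule ccontr)
  assume neg: "\<not> ?thesis"
  define D where "D = {y\<in>C. E x y}"
  have flip: "E y x \<longleftrightarrow> \<not> E x y" "F y x \<longleftrightarrow> \<not> F x y" if "y \<in> C" for y
    using tour_flip[OF assms(1) x(1), of y] tour_flip[OF assms(2) x(1), of y] that x assms(4)
    by blast+
  have "D \<subseteq> C" "D \<noteq> C" "D \<noteq> {}" using neg flip unfolding D_def by blast+
  then obtain a b where ab: "a \<in> D" "b \<in> C - D" "diff E F a b" using connD[OF assms(5)] by blast
  then have in_V: "a \<in> V" "b \<in> V" "a \<in> C" "b \<in> C" using assms(4) unfolding D_def by auto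
  have E: "E x a" "\<not> E x b" "E b x" "\<not> E a x"
    using ab flip in_V unfolding D_def by auto
  have F: "F x a" "\<not> F x b" "F b x" "\<not> F a x"
    using E nd[of a] nd[of b] flip in_V unfolding diff_def by auto
  have "a \<noteq> b" using ab by blast
  then have "E a b \<noteq> E b a" "F a b \<noteq> F b a"
    using tour_flip[OF assms(1)] tour_flip[OF assms(2)] in_V by blast+
  moreover have "(cyc E x a b \<or> cyc E x b a) = (cyc F x a b \<or> cyc F x b a)"
    using assms(3) in_V x(1) unfolding same_cycles_def by blast
  ultimately show False using E F ab(3) unfolding cyc_def diff_def by blast
qed

section \<open>Connected components and strong subsets\<close>

lemma component_self: "u \<in> component R B u"
  unfolding component_def by simp

lemma component_subset:
  assumes "u \<in> B" shows "component R B u \<subseteq> B"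
proof
  fix w assume "w \<in> component R B u"
  then have "(u, w) \<in> {(a, b). a \<in> B \<and> b \<in> B \<and> R a b}\<^sup>*" unfolding component_def by simp
  then show "w \<in> B" by (induction rule: rtrancl_induct) (use assms in auto)
qed

lemma component_closed:
  assumes "u \<in> B" "a \<in> component R B u" "b \<in> B" "R a b" shows "b \<in> component R B u"
proof -
  have "a \<in> B" using component_subset[OF assms(1)] assms(2) by blast
  then have "(a, b) \<in> {(a, b). a \<in> B \<and> b \<in> B \<and> R a b}" using assms(3,4) by simp
  then show ?thesis using assms(2) unfolding component_def by (simp add: rtrancl.rtrancl_into_rtrancl)
qed

lemma component_least:
  assumes "u \<in> D" "\<And>a b. a \<in> D \<Longrightarrow> a \<in> B \<Longrightarrow> b \<in> B \<Longrightarrow> R a b \<Longrightarrow> b \<in> D"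
  shows "component R B u \<subseteq> D"
proof
  fix w assume "w \<in> component R B u"
  then have "(u, w) \<in> {(a, b). a \<in> B \<and> b \<in> B \<and> R a b}\<^sup>*" unfolding component_def by simp
  then show "w \<in> D" by (induction rule: rtrancl_induct) (use assms in auto)
qed

lemma component_eq:
  assumes sym: "\<And>a b. a \<in> B \<Longrightarrow> b \<in> B \<Longrightarrow> R a b \<Longrightarrow> R b a" and "u \<in> B" "w \<in> component R B u"
  shows "component R B w = component R B u"
proof
  show "component R B w \<subseteq> component R B u"
    by (rule component_least[OF assms(3)]) (rule component_closed[OF assms(2)])
  have w: "w \<in> B" using component_subset[OF assms(2)] assms(3) by blast
  have "u \<in> component R B w"
  proof (rule ccontr)
    assume u: "u \<notin> component R B w"
    have "component R B u \<subseteq> - component R B w"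
    proof (rule component_least)
      show "u \<in> - component R B w" using u by simp
      fix a b assume ab: "a \<in> - component R B w" "a \<in> B" "b \<in> B" "R a b"
      show "b \<in> - component R B w"
      proof
        assume b: "b \<in> component R B w"
        have "a \<in> component R B w"
          by (rule component_closed[OF w b ab(2) sym[OF ab(2-4)]])
        then show False using ab(1) by simp
      qed
    qed
    then have "w \<in> - component R B w" using assms(3) by (rule subsetD)
    then show False using component_self[of w R B] by simp
  qed
  then show "component R B u \<subseteq> component R B w"
    by (rule component_least) (rule component_closed[OF w])
qed

lemma conn_component:
  assumes sym: "\<And>a b. a \<in> B \<Longrightarrow> b \<in> B \<Longrightarrow> R a b \<Longrightarrow> R b a" and u: "u \<in> B"
  shows "conn R (component R B u)"
proof (rule connI)
  let ?C = "component R B u"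
  fix D assume D: "D \<subset> ?C" "D \<noteq> {}"
  from D obtain w where w: "w \<in> D" by blast
  have eq: "component R B w = ?C" by (rule component_eq[OF sym u]) (use w D in auto)
  show "\<exists>a\<in>D. \<exists>b\<in>?C - D. R a b"
  proof (rule ccontr)
    assume neg: "\<not> ?thesis"
    have "component R B w \<subseteq> D"
    proof (rule component_least[OF w])
      fix a b assume ab: "a \<in> D" "a \<in> B" "b \<in> B" "R a b"
      then have "b \<in> ?C" using component_closed[OF u] D by blast
      then show "b \<in> D" using neg ab by blast
    qed
    then show False using D eq by blast
  qed
qed

lemma conn_dual: "conn R B \<Longrightarrow> D \<subseteq> B \<Longrightarrow> D \<noteq> B \<Longrightarrow> D \<noteq> {} \<Longrightarrow> \<exists>a\<in>D. \<exists>b\<in>B - D. R b a"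
  using connD[of R B "B - D"] by blast

text \<open>In a chain the vertex of largest rank dominates nothing and so forms a cut.\<close>

lemma conn_has_cycle:
  assumes "tour V E" "conn E V" "card V \<ge> 2"
  shows "\<not> cycle_free V E"
proof
  assume cf: "cycle_free V E"
  let ?r = "\<lambda>x. card {y\<in>V. E y x}"
  have b: "bij_betw ?r V {..<card V}" by (rule cycle_free_rank[OF assms(1) cf])
  have "card V - 1 \<in> ?r ` V" using bij_betw_imp_surj_on[OF b] assms(3) by auto
  then obtain v where v: "v \<in> V" "?r v = card V - 1" by force
  have "{v} \<noteq> V" using assms(3) by auto
  then obtain w where w: "w \<in> V" "E v w" using connD[OF assms(2), of "{v}"] v(1) by auto
  have "?r v < ?r w" using cycle_free_rank(2)[OF assms(1) cf v(1) w(1)] w(2) by simp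
  moreover have "?r w < card V" using bij_betw_apply[OF b w(1)] by simp
  ultimately show False using v(2) by simp
qed

lemma conn_triangle: "cyc E a b c \<Longrightarrow> conn E {a, b, c}"
proof (rule connI)
  fix D assume cyc: "cyc E a b c" and D: "D \<subset> {a, b, c}" "D \<noteq> {}"
  then have arcs: "E a b" "E b c" "E c a" by (auto simp: cyc_def)
  show "\<exists>x\<in>D. \<exists>y\<in>{a, b, c} - D. E x y"
  proof (rule ccontr)
    assume neg: "\<not> ?thesis"
    have "a \<in> D \<Longrightarrow> b \<in> D" "b \<in> D \<Longrightarrow> c \<in> D" "c \<in> D \<Longrightarrow> a \<in> D" using neg arcs by blast+
    then show False using D by blast
  qed
qed

lemma conn_insert:
  assumes C: "conn E C" and yz: "y \<in> C" "z \<in> C" "E x y" "E z x"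
  shows "conn E (insert x C)"
proof (rule connI)
  fix D assume D: "D \<subset> insert x C" "D \<noteq> {}"
  show "\<exists>a\<in>D. \<exists>b\<in>insert x C - D. E a b"
  proof (cases "D \<inter> C = {} \<or> C \<subseteq> D")
    case True
    then show ?thesis using D yz by blast
  next
    case False
    then obtain a b where "a \<in> D \<inter> C" "b \<in> C - D \<inter> C" "E a b"
      using connD[OF C, of "D \<inter> C"] by blast
    then show ?thesis by blast
  qed
qed

text \<open>A strong tournament on at least four vertices has a vertex whose deletion leaves it strong:
  if a largest proper strong subset \<open>C\<close> missed two vertices, one could exchange a vertex of \<open>C\<close>
  for an arc \<open>b \<rightarrow> a\<close> with \<open>C \<rightarrow> b\<close> and \<open>a \<rightarrow> C\<close>.\<close>

lemma conn_delete_vertex: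
  assumes tour: "tour B E" and conn: "conn E B" and card: "card B \<ge> 4"
  shows "\<exists>v\<in>B. conn E (B - {v})"
proof -
  have fin: "finite B" using tour by (rule tour_finite)
  obtain a b c where abc: "a \<in> B" "b \<in> B" "c \<in> B" "cyc E a b c"
    using conn_has_cycle[OF tour conn] card unfolding cycle_free_def by auto
  then have "a \<noteq> b" "b \<noteq> c" "c \<noteq> a" using tour_irrefl[OF tour] by (auto simp: cyc_def)
  then have card3: "card {a, b, c} = 3" by simp
  define P where "P C \<longleftrightarrow> C \<subset> B \<and> conn E C \<and> card C \<ge> 3" for C
  have "{a, b, c} \<subset> B" using abc card card3 by (intro psubsetI) auto
  then have "P {a, b, c}" unfolding P_def using conn_triangle[OF abc(4)] card3 by simp
  moreover have "\<forall>C. P C \<longrightarrow> card C < card B"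
    unfolding P_def using fin by (simp add: psubset_card_mono)
  ultimately obtain C where C: "P C" and max: "\<And>C'. P C' \<Longrightarrow> card C' \<le> card C"
    using ex_has_greatest_nat[of P "{a, b, c}" card "card B"] by (metis less_imp_le)
  have CB: "C \<subset> B" and Cconn: "conn E C" and C3: "card C \<ge> 3" using C unfolding P_def by auto
  have finC: "finite C" using CB fin finite_subset by blast
  show ?thesis
  proof (cases "card (B - C) = 1")
    case True
    then obtain v where "B - C = {v}" by (rule card_1_singletonE)
    then have "v \<in> B" "C = B - {v}" using CB by auto
    then show ?thesis using Cconn by blast
  next
    case False
    moreover have "card (B - C) \<noteq> 0" using CB fin by auto
    ultimately have "card (B - C) \<ge> 2" by simp
    then have less: "card C + 2 \<le> card B" using card_Diff_subset[OF finC] CB by auto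
    have uni: "uniform E x C" if x: "x \<in> B - C" for x
    proof (rule ccontr)
      assume "\<not> ?thesis"
      then obtain y z where yz: "y \<in> C" "\<not> E x y" "z \<in> C" "\<not> E z x" by blast
      then have "E y x" "E x z" using tour_flip[OF tour] x CB by blast+
      then have "conn E (insert x C)" using conn_insert[OF Cconn] yz by blast
      moreover have "card (insert x C) = card C + 1" using finC x by simp
      moreover have "insert x C \<subset> B" using x CB less finC \<open>card (insert x C) = card C + 1\<close> by auto
      ultimately have "P (insert x C)" unfolding P_def using C3 by simp
      then show False using max \<open>card (insert x C) = card C + 1\<close> by fastforce
    qed
    obtain c where c: "c \<in> C" using C3 by fastforce
    define In where "In = {x\<in>B - C. \<forall>c\<in>C. E x c}"
    have out: "E c x" if "x \<in> B - C" "x \<notin> In" "c \<in> C" for x c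
      using uni[OF that(1)] that unfolding In_def by blast
    have "In \<noteq> {}"
    proof
      assume "In = {}"
      then obtain x y where "x \<in> B - C" "y \<in> B - (B - C)" "E x y"
        using connD[OF conn, of "B - C"] CB c by blast
      then show False using out[of x y] tour_asym[OF tour, of x y] CB \<open>In = {}\<close> by blast
    qed
    then obtain b' a' where ba: "b' \<in> B - In" "a' \<in> B - (B - In)" "E b' a'"
      using connD[OF conn, of "B - In"] CB c unfolding In_def by blast
    have a': "a' \<in> In" "a' \<in> B - C" using ba unfolding In_def by auto
    have b': "b' \<in> B - C" "b' \<notin> In"
      using ba tour_asym[OF tour ba(1)[THEN DiffD1], of a'] a' unfolding In_def by blast+
    have "card (C - {c}) \<noteq> 0" using C3 c finC by simp
    then obtain d where d: "d \<in> C - {c}" by (metis card.empty ex_in_conv)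
    \<comment> \<open>\<open>C - {c}\<close> is nonempty because of \<open>d\<close>, and
      \<open>a'\<close> dominates it, it dominates \<open>b'\<close>, and \<open>b'\<close>
      dominates \<open>a'\<close>; so \<open>C'\<close> is strong. One vertex is lost and two are
      gained, against the maximality of \<open>C\<close>.\<close>
    define C' where "C' = insert a' (insert b' (C - {c}))"
    have arcs: "E a' x" "E x b'" if "x \<in> C" for x
      using out[OF b' that] a' that unfolding In_def by auto
    have "conn E C'"
    proof (rule connI)
      fix D assume D: "D \<subset> C'" "D \<noteq> {}"
      show "\<exists>x\<in>D. \<exists>y\<in>C' - D. E x y"
      proof (rule ccontr)
        assume "\<not> ?thesis"
        then have cl: "\<And>x y. x \<in> D \<Longrightarrow> y \<in> C' \<Longrightarrow> E x y \<Longrightarrow> y \<in> D" by blast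
        have 1: "x \<in> D \<Longrightarrow> x \<in> C - {c} \<Longrightarrow> b' \<in> D" for x using cl[of x b'] arcs C'_def by blast
        have 2: "b' \<in> D \<Longrightarrow> a' \<in> D" using cl[of b' a'] ba(3) C'_def by blast
        have 3: "a' \<in> D \<Longrightarrow> x \<in> C - {c} \<Longrightarrow> x \<in> D" for x using cl[of a' x] arcs C'_def by blast
        have "a' \<in> D" using D 1 2 unfolding C'_def by blast
        moreover from this have "b' \<in> D" using 1[OF 3[OF _ d] d] by blast
        ultimately show False using D 3 unfolding C'_def by blast
      qed
    qed
    have "a' \<noteq> b'" using a' b' by blast
    then have cardC': "card C' = card C + 1"
      unfolding C'_def using a' b' c finC C3 by simp
    moreover have "C' \<subset> B"
    proof (rule psubsetI)
      show "C' \<subseteq> B" unfolding C'_def using a' b' CB by blast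
      show "C' \<noteq> B" using cardC' less by auto
    qed
    ultimately have "P C'" unfolding P_def using \<open>conn E C'\<close> C3 by simp
    then show ?thesis using max cardC' by fastforce
  qed
qed

text \<open>Suppose reversed arcs fall apart on \<open>B - {v}\<close>. Each component is seen
  uniformly by the rest of \<open>B - {v}\<close> and, by \<open>bad\<close>, is joined to
  \<open>v\<close> by a reversed arc; \<open>good\<close> gives a kept arc between \<open>v\<close>
  and some \<open>c\<close>. Triangles through \<open>v\<close> and \<open>c\<close> then show that
  all vertices outside the component of \<open>c\<close> relate to it as \<open>v\<close> relates to
  \<open>c\<close>, a cut of the strong tournament \<open>B - {v}\<close>.\<close>

lemma conn_diff_step:
  assumes tB: "tour B E" and tF: "tour B F" and same: "same_cycles B E F" and v: "v \<in> B"
    and strong: "conn E (B - {v})" and not: "\<not> conn (diff E F) (B - {v})"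
    and bad: "conn (diff E F) B" and good: "conn (diff E F\<^sup>d) B"
  shows False
proof -
  let ?B = "B - {v}" and ?R = "diff E F"
  let ?C = "component ?R ?B"
  have sym: "?R a b \<Longrightarrow> ?R b a" if "a \<in> B" "b \<in> B" for a b
    using diff_sym[OF tB tF that] .
  have tB': "tour ?B E" "tour ?B F" "same_cycles ?B E F"
    using tour_subset[OF tB, of ?B] tour_subset[OF tF, of ?B] same_cycles_subset[OF same, of ?B] by auto
  have Cconn: "conn ?R (?C u)" if "u \<in> ?B" for u
    by (rule conn_component[OF _ that]) (use sym in blast)
  have Csub: "?C u \<subseteq> ?B" "?C u \<noteq> ?B" "u \<in> ?C u" if "u \<in> ?B" for u
    using component_subset[OF that, of ?R] Cconn[OF that] not component_self[of u ?R ?B] by auto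
  have Ceq: "?C w = ?C u" if "u \<in> ?B" "w \<in> ?C u" for u w
    by (rule component_eq[OF _ that]) (use sym in blast)
  have Cnd: "\<not> ?R a b" if "u \<in> ?B" "a \<in> ?C u" "b \<in> ?B" "b \<notin> ?C u" for u a b
    using component_closed[OF that(1,2,3)] that(4) by blast
  have Cuni: "uniform E x (?C u)" if "u \<in> ?B" "x \<in> ?B" "x \<notin> ?C u" for u x
  proof (rule conn_uniform[OF tB' Csub(1)[OF that(1)] Cconn[OF that(1)] that(2,3)])
    fix c assume c: "c \<in> ?C u"
    then show "\<not> ?R x c"
      using Cnd[OF that(1) c that(2,3)] sym[of x c] that Csub(1)[OF that(1)] by blast
  qed
  have bad_nbr: "\<exists>b\<in>?C u. ?R v b" if u: "u \<in> ?B" for u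
  proof -
    obtain a b where ab: "a \<in> ?C u" "b \<in> B - ?C u" "?R a b"
      using connD[OF bad, of "?C u"] Csub[OF u] v by auto
    then have "b = v" using Cnd[OF u ab(1), of b] by blast
    then show ?thesis using ab sym[of a v] Csub(1)[OF u] v by blast
  qed
  have "?B \<noteq> {}" using not by (auto simp: conn_def)
  then obtain c where c: "c \<in> ?B" "\<not> ?R v c"
    using connD[OF good, of "{v}"] v diff_dual[OF tB tF v] by blast
  let ?I = "?C c"
  \<comment> \<open>In the triangle \<open>v, c, b'\<close> only the arc between \<open>v\<close>
    and \<open>b'\<close> is reversed. Its being a 3-cycle or not is preserved only if
    \<open>v\<close> and \<open>b'\<close> relate to \<open>c\<close> in the same way.\<close>
  have key: "E v c \<longleftrightarrow> E b c" if b: "b \<in> ?B" "b \<notin> ?I" for b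
  proof -
    obtain b' where b': "b' \<in> ?C b" "?R v b'" using bad_nbr[OF b(1)] by blast
    have b'B: "b' \<in> ?B" using b' Csub(1)[OF b(1)] by blast
    have nI: "b' \<notin> ?I"
      using Ceq[OF c(1), of b'] Ceq[OF b(1) b'(1)] Csub(3)[OF b(1)] b(2) by blast
    have nd: "\<not> ?R c b'" using Cnd[OF c(1) Csub(3)[OF c(1)] b'B nI] .
    have cb: "c \<noteq> b'" using nI Csub(3)[OF c(1)] by blast
    have "(cyc E v c b' \<or> cyc E v b' c) = (cyc F v c b' \<or> cyc F v b' c)"
      using same c(1) b'B v unfolding same_cycles_def by blast
    then have "E v c \<longleftrightarrow> E b' c"
      using b'(2) nd c cb b'B v tour_flip[OF tB, of v c] tour_flip[OF tF, of v c]
        tour_flip[OF tB, of v b'] tour_flip[OF tF, of v b'] tour_flip[OF tB, of c b'] tour_flip[OF tF, of c b']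
      unfolding cyc_def diff_def by (metis Diff_iff singletonI)
    moreover have "c \<notin> ?C b" using Ceq[OF b(1), of c] Csub(3)[OF b(1)] b(2) by blast
    then have "uniform E c (?C b)" using Cuni[OF b(1) c(1)] by blast
    then have "E b' c \<longleftrightarrow> E b c"
      using b'(1) Csub(3)[OF b(1)] tour_asym[OF tB] c(1) b'B b(1) by blast
    ultimately show ?thesis by blast
  qed
  have I: "?I \<subseteq> ?B" "?I \<noteq> ?B" "?I \<noteq> {}" "c \<in> ?I" using Csub[OF c(1)] by auto
  have all: "E v c \<longleftrightarrow> E b i" if b: "b \<in> ?B" "b \<notin> ?I" and i: "i \<in> ?I" for b i
  proof -
    have "E b c \<longleftrightarrow> E b i"
      using Cuni[OF c(1) b] i I tour_asym[OF tB] b by blast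
    then show ?thesis using key[OF b] by blast
  qed
  show False
  proof (cases "E v c")
    case True
    then obtain i b where "i \<in> ?I" "b \<in> ?B - ?I" "E i b" using connD[OF strong I(1-3)] by blast
    then show False using all[of b i] True tour_asym[OF tB, of i b] I(1) by blast
  next
    case False
    then obtain i b where "i \<in> ?I" "b \<in> ?B - ?I" "E b i" using conn_dual[OF strong I(1-3)] by blast
    then show False using all[of b i] False by blast
  qed
qed

text \<open>The core of the theorem of Boussairi, Ille, Lopez and Thomasse: an indecomposable tournament
  is determined up to duality by its 3-cycles.\<close>

theorem not_both_connected:
  assumes "tour B E" "tour B F" "same_cycles B E F" "conn E B" "card B \<ge> 2"
    "conn (diff E F) B" "conn (diff E F\<^sup>d) B"
  shows False
  using assms
proof (induction "card B" arbitrary: B rule: less_induct)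
  case less
  note tE = less.prems(1) and tF = less.prems(2) and same = less.prems(3)
  have fin: "finite B" using tE by (rule tour_finite)
  obtain a b c where abc: "a \<in> B" "b \<in> B" "c \<in> B" "cyc E a b c"
    using conn_has_cycle[OF tE less.prems(4,5)] unfolding cycle_free_def by auto
  then have dist: "a \<noteq> b" "b \<noteq> c" "c \<noteq> a" using tour_irrefl[OF tE] by (auto simp: cyc_def)
  then have "card {a, b, c} = 3" by simp
  then have ge3: "card B \<ge> 3" using card_mono[OF fin, of "{a, b, c}"] abc by simp
  show False
  proof (cases "card B = 3")
    case True
    then have B: "B = {a, b, c}"
      using card_subset_eq[OF fin, of "{a, b, c}"] abc \<open>card {a, b, c} = 3\<close> by simp
    \<comment> \<open>A 3-cycle is either kept or reversed as a whole, so one of the two graphs has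
      no edge at \<open>a\<close>.\<close>
    have "cyc F a b c \<or> cyc F a c b"
      using same abc unfolding same_cycles_def by blast
    then show False
    proof
      assume "cyc F a b c"
      then have "\<not> diff E F a b" "\<not> diff E F a c"
        using abc(4) tour_asym[OF tE abc(3,1)] tour_asym[OF tF abc(3,1)] unfolding cyc_def diff_def by blast+
      then show False using connD[OF less.prems(6), of "{a}"] B dist by auto
    next
      assume "cyc F a c b"
      then have "\<not> diff E F\<^sup>d a b" "\<not> diff E F\<^sup>d a c"
        using abc(4) tour_asym[OF tE abc(3,1)] tour_asym[OF tF abc(1,3)] unfolding cyc_def diff_def by blast+
      then show False using connD[OF less.prems(7), of "{a}"] B dist by auto
    qed
  next
    case False
    then have "card B \<ge> 4" using ge3 by simp
    then obtain v where v: "v \<in> B" "conn E (B - {v})"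
      using conn_delete_vertex[OF tE less.prems(4)] by blast
    have sub: "tour (B - {v}) E" "tour (B - {v}) F" "same_cycles (B - {v}) E F"
      using tour_subset[OF tE, of "B - {v}"] tour_subset[OF tF, of "B - {v}"]
        same_cycles_subset[OF same, of "B - {v}"] by auto
    have "card (B - {v}) < card B" "card (B - {v}) \<ge> 2" using v(1) fin \<open>card B \<ge> 4\<close> by auto
    \<comment> \<open>The induction hypothesis disconnects one of the two graphs on
      \<open>B - {v}\<close>. Dualizing \<open>F\<close> exchanges the graphs, so the same step
      settles both cases.\<close>
    then consider "\<not> conn (diff E F) (B - {v})" | "\<not> conn (diff E F\<^sup>d) (B - {v})"
      using less.hyps[of "B - {v}"] sub v(2) by blast
    then show False
    proof cases
      case 1
      show False by (rule conn_diff_step[OF tE tF same v 1 less.prems(6,7)])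
    next
      case 2
      have tF': "tour B F\<^sup>d" using tF by (simp add: tour_dual)
      have same': "same_cycles B E F\<^sup>d" using same by (simp add: same_cycles_dual)
      show False
        by (rule conn_diff_step[OF tE tF' same' v 2 less.prems(7)]) (simp add: less.prems(6))
    qed
  qed
qed

section \<open>Intervals, and the 3-cycles preserved by hypomorphy\<close>

lemma ivl_dual: "ivl V E\<^sup>d I \<longleftrightarrow> ivl V E I"
  unfolding ivl_def by auto

lemma ivl_trans:
  assumes "ivl V E B" "ivl B E C" shows "ivl V E C"
  unfolding ivl_def
proof (intro conjI ballI)
  show "C \<subseteq> V" using assms unfolding ivl_def by blast
  fix x assume x: "x \<in> V - C"
  have CB: "C \<subseteq> B" using assms(2) unfolding ivl_def by blast
  show "uniform E x C"
  proof (cases "x \<in> B")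
    case True then show ?thesis using assms(2) x unfolding ivl_def by blast
  next
    case False
    then have "uniform E x B" using assms(1) x unfolding ivl_def by blast
    then show ?thesis using CB by blast
  qed
qed

lemma ivl_uniform:
  assumes "tour V E" "ivl V E I" "x \<in> V" "x \<notin> I" "y \<in> I" "z \<in> I"
  shows "E x y \<longleftrightarrow> E x z" and "E y x \<longleftrightarrow> E z x"
proof -
  have sub: "y \<in> V" "z \<in> V" using assms unfolding ivl_def by blast+
  have "uniform E x I" using assms(2-4) unfolding ivl_def by blast
  then show "E x y \<longleftrightarrow> E x z" "E y x \<longleftrightarrow> E z x"
    using assms(5,6) tour_asym[OF assms(1,3) sub(1)] tour_asym[OF assms(1,3) sub(2)] by blast+
qed

lemma ivl_Int:
  assumes "ivl V E I" "K \<subseteq> V" shows "ivl K E (K \<inter> I)"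
  unfolding ivl_def
proof (intro conjI ballI)
  fix x assume "x \<in> K - K \<inter> I"
  then have "uniform E x I" using assms unfolding ivl_def by blast
  then show "uniform E x (K \<inter> I)" by blast
qed simp

lemma ivl_image:
  assumes f: "bij_betw f V W" and FE: "\<forall>x\<in>V. \<forall>y\<in>V. E x y = F (f x) (f y)" and I: "ivl V E I"
  shows "ivl W F (f ` I)"
  unfolding ivl_def
proof (intro conjI ballI)
  have IV: "I \<subseteq> V" using I unfolding ivl_def by blast
  then show "f ` I \<subseteq> W" using bij_betw_imp_surj_on[OF f] by blast
  fix w assume w: "w \<in> W - f ` I"
  then obtain x where x: "x \<in> V" "w = f x" using bij_betw_imp_surj_on[OF f] by blast
  then have "x \<in> V - I" using w by blast
  then have "uniform E x I" using I unfolding ivl_def by blast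
  then show "uniform F w (f ` I)" using FE x IV by (auto simp: subset_iff)
qed

lemma tour_iso_cycle_free:
  assumes "tour_iso V E W F" "cycle_free V E" shows "cycle_free W F"
proof -
  from assms(1) obtain f where f: "bij_betw f V W" and FE: "\<forall>x\<in>V. \<forall>y\<in>V. E x y = F (f x) (f y)"
    by (rule tour_isoE)
  show ?thesis unfolding cycle_free_def
  proof (intro ballI)
    fix a b c assume "a \<in> W" "b \<in> W" "c \<in> W"
    then obtain a' b' c' where "a' \<in> V" "b' \<in> V" "c' \<in> V" "a = f a'" "b = f b'" "c = f c'"
      using bij_betw_imp_surj_on[OF f] by blast
    moreover from this have "cyc F a b c \<longleftrightarrow> cyc E a' b' c'" using FE unfolding cyc_def by metis
    ultimately show "\<not> cyc F a b c" using assms(2) unfolding cycle_free_def by simp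
  qed
qed

lemma triangle_cycle_free:
  assumes "tour V E" "a \<in> V" "b \<in> V" "c \<in> V"
  shows "cycle_free {a, b, c} E \<longleftrightarrow> \<not> (cyc E a b c \<or> cyc E a c b)"
  using tour_irrefl[OF assms(1)] tour_asym[OF assms(1)] assms(2-4)
  unfolding cycle_free_def cyc_def by auto

lemma hypomorphic3_sym: "hypomorphic3 V E E' \<Longrightarrow> hypomorphic3 V E' E"
  unfolding hypomorphic3_def using tour_iso_sym by blast

lemma hypomorphic3_dual: "hypomorphic3 V E E' \<Longrightarrow> hypomorphic3 V E\<^sup>d E'\<^sup>d"
  unfolding hypomorphic3_def tour_iso_dual_iff .

text \<open>Three prescribed vertices determine a 3-vertex copy, so counting detects each single
  3-cycle. The bound is 3 + 3 \<le> n.\<close>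

lemma hypomorphic3_cycle:
  assumes "tour V E" "tour V E'" "hypomorphic3 V E E'" "card V \<ge> 6"
    and abc: "a \<in> V" "b \<in> V" "c \<in> V" "cyc E a b c"
  shows "cyc E' a b c \<or> cyc E' a c b"
proof -
  have fin: "finite V" using assms(1) by (rule tour_finite)
  have "a \<noteq> b" "b \<noteq> c" "c \<noteq> a" using abc tour_irrefl[OF assms(1)] by (auto simp: cyc_def)
  then have "card {a, b, c} = 3" by simp
  then obtain L where L: "{a, b, c} \<subseteq> L" "L \<subseteq> V" "tour_iso L E' {a, b, c} E"
    using hypomorphic3_copy[OF fin assms(3), of "{a, b, c}" "{a, b, c}"] abc assms(4) by auto
  have "L = {a, b, c}"
    using card_subset_eq[OF finite_subset[OF L(2) fin] L(1)] tour_iso_card[OF L(3)] by simp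
  then have "cycle_free {a, b, c} E' \<Longrightarrow> cycle_free {a, b, c} E"
    using tour_iso_cycle_free L(3) by blast
  then show ?thesis
    using triangle_cycle_free[OF assms(1) abc(1-3)] triangle_cycle_free[OF assms(2) abc(1-3)] abc(4) by blast
qed

lemma hypomorphic3_same_cycles:
  assumes "tour V E" "tour V E'" "hypomorphic3 V E E'" "card V \<ge> 6"
  shows "same_cycles V E E'"
  unfolding same_cycles_def
proof (intro ballI iffI)
  fix a b c assume V: "a \<in> V" "b \<in> V" "c \<in> V"
  note E = hypomorphic3_cycle[OF assms]
  note E' = hypomorphic3_cycle[OF assms(2,1) hypomorphic3_sym[OF assms(3)] assms(4)]
  show "cyc E' a b c \<or> cyc E' a c b" if "cyc E a b c \<or> cyc E a c b"
    using that E[OF V] E[OF V(1,3,2)] by argo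
  show "cyc E a b c \<or> cyc E a c b" if "cyc E' a b c \<or> cyc E' a c b"
    using that E'[OF V] E'[OF V(1,3,2)] by argo
qed

text \<open>Compare the copies of a vertex dominating a 3-cycle that contain \<open>x\<close>, \<open>a\<close> and \<open>b\<close>: there is
  none in \<open>E'\<close>.\<close>

lemma interval_arcs_aux:
  assumes tE: "tour V E" and tE': "tour V E'" and hyp: "hypomorphic3 V E E'" and card: "card V \<ge> 7"
    and I: "ivl V E I" "ivl V E' I" and abc: "a \<in> I" "b \<in> I" "c \<in> I" "cyc E a b c"
    and x: "x \<in> V" "x \<notin> I" "E x a" "\<not> E' x a"
  shows False
proof -
  have fin: "finite V" using tE by (rule tour_finite)
  have IV: "I \<subseteq> V" using I(1) unfolding ivl_def by blast
  have V: "a \<in> V" "b \<in> V" "c \<in> V" using abc IV by auto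
  have dist: "a \<noteq> b" "b \<noteq> c" "c \<noteq> a" using abc(4) V tour_irrefl[OF tE] by (auto simp: cyc_def)
  have nx: "x \<noteq> a" "x \<noteq> b" "x \<noteq> c" using abc x by auto
  have Ex: "E x b" "E x c" using ivl_uniform[OF tE I(1) x(1,2) abc(1)] abc x(3) by blast+
  have E'x: "E' i x" if "i \<in> I" for i
  proof -
    have "\<not> E' x i" using ivl_uniform[OF tE' I(2) x(1,2) abc(1) that] x(4) by simp
    then show ?thesis using tour_flip[OF tE' x(1), of i] that IV x(2) by blast
  qed
  have "card {x, a, b} = 3" "card {x, a, b, c} = 4" using dist nx by auto
  then obtain L where L: "{x, a, b} \<subseteq> L" "L \<subseteq> V" "tour_iso L E' {x, a, b, c} E"
    using hypomorphic3_copy[OF fin hyp, of "{x, a, b}" "{x, a, b, c}"] x V card by auto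
  from tour_iso_sym[OF L(3)] obtain f where f: "bij_betw f {x, a, b, c} L"
    and FE: "\<forall>u\<in>{x, a, b, c}. \<forall>v\<in>{x, a, b, c}. E u v = E' (f u) (f v)" by (rule tour_isoE)
  define s p q r where "s = f x" "p = f a" "q = f b" "r = f c"
  note d = this
  have Leq: "L = {s, p, q, r}" using bij_betw_imp_surj_on[OF f] unfolding d by blast
  have arcs: "E' s p" "E' s q" "E' s r" and cy: "cyc E' p q r"
    using FE x(3) Ex abc(4) unfolding d cyc_def by blast+
  have asym: "E' u v \<Longrightarrow> \<not> E' v u" if "u \<in> L" "v \<in> L" for u v
    using tour_asym[OF tE'] that L(2) by blast
  \<comment> \<open>In \<open>E'\<close> all of \<open>I\<close> dominates \<open>x\<close>, so the
    successor \<open>q\<close> of \<open>x\<close> on the cycle is outside \<open>I\<close>. Then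
    \<open>a\<close> and \<open>b\<close> must be \<open>s\<close> and \<open>r\<close>, but
    \<open>q\<close> is dominated by \<open>s\<close> and dominates \<open>r\<close>, against
    uniformity.\<close>
  have key: False if cy: "cyc E' x q r" and s: "E' s x" "E' s q" "E' s r" and Leq: "L = {s, x, q, r}"
    for s q r
  proof -
    have in_L: "s \<in> L" "q \<in> L" "r \<in> L" using Leq by auto
    have "q \<notin> I" using cy E'x[of q] asym[of x q] in_L L(1) unfolding cyc_def by blast
    then have "a \<noteq> q" "b \<noteq> q" using abc by auto
    then have "{a, b} \<subseteq> {s, r}" using L(1) Leq nx by auto
    then have "s \<in> I" "r \<in> I" using dist(1) abc(1,2) by auto
    then have "E' q s \<longleftrightarrow> E' q r"
      using ivl_uniform(1)[OF tE' I(2), of q s r] \<open>q \<notin> I\<close> in_L L(2) by blast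
    then show False using cy s asym[of s q] in_L unfolding cyc_def by blast
  qed
  have "x \<noteq> s"
    using L(1) Leq arcs E'x[OF abc(1)] asym nx by blast
  then consider "x = p" | "x = q" | "x = r" using L(1) Leq by blast
  then show False
  proof cases
    case 1 then show False using key[of q r s] cy arcs Leq by simp
  next
    case 2 then show False using key[of r p s] cyc_rot[OF cy] arcs Leq by auto
  next
    case 3 then show False using key[of p q s] cyc_rot[OF cyc_rot[OF cy]] arcs Leq by auto
  qed
qed

section \<open>Common intervals of a hypomorphic pair\<close>

locale hypo_pair =
  fixes V :: "'a set" and E E' :: "'a \<Rightarrow> 'a \<Rightarrow> bool"
  assumes tE: "tour V E" and tE': "tour V E'" and hyp: "hypomorphic3 V E E'" and card9: "card V \<ge> 9"
begin

lemma fin: "finite V"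
  using tE by (rule tour_finite)

lemma same: "same_cycles V E E'"
  using hypomorphic3_same_cycles[OF tE tE' hyp] card9 by simp

lemma same_cyc: "a \<in> V \<Longrightarrow> b \<in> V \<Longrightarrow> c \<in> V \<Longrightarrow> cyc E a b c \<Longrightarrow> cyc E' a b c \<or> cyc E' a c b"
  using same unfolding same_cycles_def by blast

lemma swap: "hypo_pair V E' E"
  by unfold_locales (use tE tE' hypomorphic3_sym[OF hyp] card9 in auto)

lemma diff_commute: "diff E' E x y \<longleftrightarrow> diff E E' x y"
  unfolding diff_def by blast

lemma diff_symV: "x \<in> V \<Longrightarrow> y \<in> V \<Longrightarrow> diff E E' x y \<Longrightarrow> diff E E' y x"
  using diff_sym[OF tE tE'] .

text \<open>Uniformity moves the reversed arc from \<open>y\<close> to a vertex of a 3-cycle in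
  \<open>I\<close>. If \<open>x\<close> is dominated there instead of dominating, dualizing both
  tournaments restores the case already treated.\<close>

lemma interval_arcs:
  assumes I: "ivl V E I" "ivl V E' I" and ncf: "\<not> cycle_free I E" and x: "x \<in> V" "x \<notin> I" and y: "y \<in> I"
  shows "\<not> diff E E' x y"
proof
  assume diff: "diff E E' x y"
  have IV: "I \<subseteq> V" using I(1) unfolding ivl_def by blast
  from ncf obtain a b c where abc: "a \<in> I" "b \<in> I" "c \<in> I" "cyc E a b c"
    unfolding cycle_free_def by blast
  have "card V \<ge> 7" using card9 by simp
  show False
  proof (cases "E x y")
    case True
    then have "E x a" "\<not> E' x a"
      using diff ivl_uniform(1)[OF tE I(1) x y abc(1)] ivl_uniform(1)[OF tE' I(2) x y abc(1)]
      unfolding diff_def by auto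
    then show False using interval_arcs_aux[OF tE tE' hyp \<open>card V \<ge> 7\<close> I abc x] by blast
  next
    case False
    then have "diff E E' y x" "E y x"
      using diff_symV[OF x(1) _ diff] y IV tour_flip[OF tE x(1), of y] x(2) by blast+
    then have "E a x" "\<not> E' a x"
      using ivl_uniform(2)[OF tE I(1) x y abc(1)] ivl_uniform(2)[OF tE' I(2) x y abc(1)]
      unfolding diff_def by auto
    moreover have "cyc E\<^sup>d a c b" using abc(4) by (simp add: cyc_dual)
    ultimately show False
      using interval_arcs_aux[of V "E\<^sup>d" "E'\<^sup>d" I a c b x] tE tE' hypomorphic3_dual[OF hyp]
        \<open>card V \<ge> 7\<close> I abc x
      by (simp add: tour_dual ivl_dual)
  qed
qed

text \<open>\<open>conn_uniform\<close> gives the interval for \<open>E\<close>, and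
  \<open>E'\<close> has the same arcs between \<open>C\<close> and \<open>W - C\<close>.\<close>

lemma conn_ivl:
  assumes "W \<subseteq> V" "C \<subseteq> W" "conn (diff E E') C"
    and nd: "\<And>x y. x \<in> W - C \<Longrightarrow> y \<in> C \<Longrightarrow> \<not> diff E E' x y"
  shows "ivl W E C" "ivl W E' C"
proof -
  have t: "tour W E" "tour W E'" "same_cycles W E E'"
    using tour_subset[OF tE assms(1)] tour_subset[OF tE' assms(1)] same_cycles_subset[OF same assms(1)]
    by auto
  have uni: "uniform E x C" if "x \<in> W - C" for x
    using conn_uniform[OF t assms(2,3), of x] that nd[OF that] by blast
  then show "ivl W E C" unfolding ivl_def using assms(2) by blast
  have "E' x y = E x y" "E' y x = E y x" if "x \<in> W - C" "y \<in> C" for x y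
    using nd[OF that] diff_symV[of y x] that assms(1,2) unfolding diff_def by blast+
  then show "ivl W E' C" unfolding ivl_def using assms(2) uni by (metis (no_types, lifting))
qed

lemma cycle_at_nonuniform:
  assumes "W \<subseteq> V" "C \<subseteq> W" "conn E C" "x \<in> W" "x \<notin> C" "y \<in> C" "\<not> E x y" "z \<in> C" "\<not> E z x"
  shows "\<exists>p\<in>C. \<exists>q\<in>C. cyc E x p q"
proof -
  define D where "D = {y\<in>C. E x y}"
  have flip: "E w x \<longleftrightarrow> \<not> E x w" if "w \<in> C" for w
    using tour_flip[OF tE, of x w] assms that by blast
  have "D \<subseteq> C" "D \<noteq> C" "D \<noteq> {}" using assms flip unfolding D_def by blast+
  then obtain p q where "p \<in> D" "q \<in> C - D" "E p q" using connD[OF assms(3)] by blast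
  then have "p \<in> C" "q \<in> C" "cyc E x p q" using flip unfolding D_def cyc_def by blast+
  then show ?thesis by blast
qed

end

section \<open>Reversed blocks\<close>

lemma same_cycles_free_imp: "same_cycles W E F \<Longrightarrow> cycle_free W E \<Longrightarrow> cycle_free W F"
  unfolding cycle_free_def same_cycles_def by blast

lemma same_cycles_free: "same_cycles W E F \<Longrightarrow> cycle_free W E \<longleftrightarrow> cycle_free W F"
  using same_cycles_free_imp[of W E F] same_cycles_free_imp[of W F E] same_cycles_sym by blast

text \<open>A block \<open>B\<close> split into chains \<open>c u\<close> such that exactly the arcs between different chains are
  reversed.\<close>

locale reversed_block = hypo_pair +
  fixes B :: "'a set" and c :: "'a \<Rightarrow> 'a set"
  assumes ivl_B: "ivl V E B" "ivl V E' B"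
    and outside: "x \<in> V - B \<Longrightarrow> y \<in> B \<Longrightarrow> \<not> diff E E' x y"
    and conn_B: "conn E B" "conn E' B"
    and cycle_B: "\<not> cycle_free B E"
    and c_self: "u \<in> B \<Longrightarrow> u \<in> c u"
    and c_sub: "u \<in> B \<Longrightarrow> c u \<subseteq> B" "u \<in> B \<Longrightarrow> c u \<noteq> B"
    and c_eq: "u \<in> B \<Longrightarrow> w \<in> c u \<Longrightarrow> c w = c u"
    and c_ivl: "u \<in> B \<Longrightarrow> ivl V E (c u)" "u \<in> B \<Longrightarrow> ivl V E' (c u)"
    and c_chain: "u \<in> B \<Longrightarrow> cycle_free (c u) E"
    and c_diff: "x \<in> B \<Longrightarrow> y \<in> B \<Longrightarrow> c x \<noteq> c y \<Longrightarrow> diff E E' x y"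

context hypo_pair
begin

text \<open>A non-uniform \<open>x\<close> lies on a 3-cycle with two vertices of \<open>C\<close>.
  This 3-cycle survives in \<open>E'\<close>, perhaps reversed, so the same vertex extends
  \<open>C\<close> in both tournaments.\<close>

lemma grow_strong:
  assumes "C \<subseteq> V" "conn E C" "conn E' C" "x \<in> V" "x \<notin> C" and "\<not> (\<forall>y\<in>C. E x y)" "\<not> (\<forall>y\<in>C. E y x)"
  shows "conn E (insert x C) \<and> conn E' (insert x C)"
proof -
  obtain y z where yz: "y \<in> C" "\<not> E x y" "z \<in> C" "\<not> E z x" using assms(6,7) by blast
  obtain p q where pq: "p \<in> C" "q \<in> C" "cyc E x p q"
    using cycle_at_nonuniform[OF order_refl assms(1,2,4,5)] yz by blast
  have ins: "conn F (insert x C)" if "conn F C" "cyc F x p q \<or> cyc F x q p" for F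
    using that conn_insert[of F C p q x] conn_insert[of F C q p x] pq(1,2) unfolding cyc_def by blast
  have "cyc E' x p q \<or> cyc E' x q p" using same_cyc[OF assms(4) _ _ pq(3)] pq assms(1) by blast
  then show ?thesis using ins assms(2,3) pq(3) by blast
qed

text \<open>Let \<open>C\<close> be a largest set that contains a given 3-cycle and is strong in
  both tournaments. The other vertices of \<open>B\<close> see it uniformly, so it is a common
  interval with a 3-cycle and no reversed arc leaves it; connectedness by reversed arcs gives
  \<open>C = B\<close>.\<close>

lemma component_strong:
  assumes BV: "B \<subseteq> V" and conn: "conn (diff E E') B"
    and nd: "\<And>x y. x \<in> V - B \<Longrightarrow> y \<in> B \<Longrightarrow> \<not> diff E E' x y" and cycle: "\<not> cycle_free B E"
  shows "conn E B \<and> conn E' B"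
proof -
  have finB: "finite B" using BV fin finite_subset by blast
  from cycle obtain a b d where abd: "a \<in> B" "b \<in> B" "d \<in> B" "cyc E a b d"
    unfolding cycle_free_def by blast
  then have V: "a \<in> V" "b \<in> V" "d \<in> V" using BV by auto
  have "{a, d, b} = {a, b, d}" by blast
  then have conn3: "conn E {a, b, d}" "conn E' {a, b, d}"
    using same_cyc[OF V abd(4)] conn_triangle[of E a b d] conn_triangle[of E' a b d]
      conn_triangle[of E' a d b] abd(4) by auto
  define P where "P C \<longleftrightarrow> {a, b, d} \<subseteq> C \<and> C \<subseteq> B \<and> conn E C \<and> conn E' C" for C
  have "P {a, b, d}" unfolding P_def using conn3 abd by simp
  moreover have "\<forall>C. P C \<longrightarrow> card C < Suc (card B)"
    unfolding P_def using finB by (simp add: card_mono le_imp_less_Suc)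
  ultimately obtain C where C: "P C" and max: "\<And>C'. P C' \<Longrightarrow> card C' \<le> card C"
    using ex_has_greatest_nat[of P "{a, b, d}" card "Suc (card B)"] by metis
  have C': "{a, b, d} \<subseteq> C" "C \<subseteq> B" "conn E C" "conn E' C" using C unfolding P_def by auto
  have CV: "C \<subseteq> V" using C' BV by blast
  have nogrow: "\<not> (conn E (insert x C) \<and> conn E' (insert x C))" if "x \<in> B - C" for x
  proof
    assume "conn E (insert x C) \<and> conn E' (insert x C)"
    then have "P (insert x C)" unfolding P_def using C' that by blast
    moreover have "card (insert x C) = Suc (card C)"
      using that finite_subset[OF C'(2) finB] by simp
    ultimately show False using max by fastforce
  qed
  have uni: "uniform E x C" if x: "x \<in> B - C" for x
    using grow_strong[OF CV C'(3,4), of x] nogrow[OF x] x BV by blast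
  have uni': "uniform E' x C" if x: "x \<in> B - C" for x
    using hypo_pair.grow_strong[OF swap CV C'(4,3), of x] nogrow[OF x] x BV by blast
  have "ivl B E C" "ivl B E' C" using uni uni' C'(2) unfolding ivl_def by auto
  then have I: "ivl V E C" "ivl V E' C"
    using conn_ivl[OF order_refl BV conn nd] ivl_trans by blast+
  have "\<not> cycle_free C E" using C'(1) abd(4) unfolding cycle_free_def by blast
  then have nodiff: "\<not> diff E E' x y" if "x \<in> V - C" "y \<in> C" for x y
    using interval_arcs[OF I, of x y] that by blast
  have "C = B"
  proof (rule ccontr)
    assume "C \<noteq> B"
    moreover have "C \<noteq> {}" using C'(1) by blast
    ultimately obtain p q where pq: "p \<in> C" "q \<in> B - C" "diff E E' p q"
      using connD[OF conn C'(2)] by blast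
    then have "diff E E' q p" using diff_symV[of p q] BV CV by blast
    moreover have "q \<in> V - C" using pq BV by blast
    ultimately show False using nodiff pq(1) by blast
  qed
  then show ?thesis using C'(3,4) by simp
qed

text \<open>\<open>not_both_connected\<close> disconnects the graph of kept arcs, and its components
  become the chains. They are common intervals by \<open>conn_uniform\<close> applied to the dual of
  \<open>E'\<close>; a 3-cycle inside one would forbid the reversed arcs that leave it.\<close>

lemma component_reversed:
  assumes BV: "B \<subseteq> V" and conn: "conn (diff E E') B"
    and nd: "\<And>x y. x \<in> V - B \<Longrightarrow> y \<in> B \<Longrightarrow> \<not> diff E E' x y" and cycle: "\<not> cycle_free B E"
  shows "reversed_block V E E' B (component (diff E E'\<^sup>d) B)"
proof -
  let ?G = "diff E E'\<^sup>d" and ?c = "component (diff E E'\<^sup>d) B"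
  have finB: "finite B" using BV fin finite_subset by blast
  have strong: "conn E B" "conn E' B" using component_strong[OF assms] by auto
  have tB: "tour B E" "tour B E'" "same_cycles B E E'"
    using tour_subset[OF tE BV] tour_subset[OF tE' BV] same_cycles_subset[OF same BV] by auto
  have tB': "tour B E'\<^sup>d" "same_cycles B E E'\<^sup>d"
    using tB by (simp_all add: tour_dual same_cycles_dual)
  have B_ivl: "ivl V E B" "ivl V E' B" using conn_ivl[OF order_refl BV conn nd] by auto
  have "card B \<ge> 2"
  proof -
    from cycle obtain a b where ab: "a \<in> B" "b \<in> B" "E a b"
      unfolding cycle_free_def cyc_def by blast
    then have "a \<noteq> b" using tour_irrefl[OF tB(1)] by blast
    then show ?thesis using card_mono[OF finB, of "{a, b}"] ab by simp
  qed
  then have notG: "\<not> conn ?G B"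
    using not_both_connected[OF tB strong(1) _ conn] by blast
  have symG: "?G b a" if "a \<in> B" "b \<in> B" "?G a b" for a b
    using diff_sym[OF tB(1) tB'(1) that] .
  have Gconn: "conn ?G (?c u)" if "u \<in> B" for u
    using conn_component[of B ?G u] symG that by blast
  have c_sub: "?c u \<subseteq> B" if "u \<in> B" for u using component_subset[OF that] .
  have c_ne: "?c u \<noteq> B" if "u \<in> B" for u using Gconn[OF that] notG by auto
  have c_eq: "?c w = ?c u" if "u \<in> B" "w \<in> ?c u" for u w
    using component_eq[of B ?G u w] symG that by blast
  have c_self: "u \<in> ?c u" for u by (rule component_self)
  have ndG: "\<not> ?G x y" if "u \<in> B" "x \<in> B - ?c u" "y \<in> ?c u" for u x y
    using component_closed[OF that(1,3), of x] symG[of x y] that c_sub[OF that(1)] by blast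
  have c_diff': "diff E E' x y" if "u \<in> B" "x \<in> B - ?c u" "y \<in> ?c u" for u x y
  proof -
    have "x \<noteq> y" "y \<in> B" using that c_sub[OF that(1)] by auto
    then show ?thesis using ndG[OF that] diff_dual[OF tB(1,2), of x y] that by blast
  qed
  have c_ivlB: "ivl B E (?c u)" "ivl B E' (?c u)" if u: "u \<in> B" for u
  proof -
    have uni: "uniform E x (?c u)" if "x \<in> B - ?c u" for x
      using conn_uniform[OF tB(1) tB' c_sub[OF u] Gconn[OF u], of x] that ndG[OF u that] by blast
    then show "ivl B E (?c u)" unfolding ivl_def using c_sub[OF u] by blast
    have "E' x y \<longleftrightarrow> \<not> E x y" "E' y x \<longleftrightarrow> \<not> E y x" if "x \<in> B - ?c u" "y \<in> ?c u" for x y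
      using c_diff'[OF u that] diff_symV[of x y] that c_sub[OF u] BV unfolding diff_def by blast+
    moreover have "E y x \<longleftrightarrow> \<not> E x y" if "x \<in> B - ?c u" "y \<in> ?c u" for x y
      using tour_flip[OF tB(1), of x y] that c_sub[OF u] by blast
    ultimately show "ivl B E' (?c u)" unfolding ivl_def using c_sub[OF u] uni by (metis (no_types, lifting))
  qed
  have c_ivl: "ivl V E (?c u)" "ivl V E' (?c u)" if "u \<in> B" for u
    using ivl_trans[OF B_ivl(1) c_ivlB(1)[OF that]] ivl_trans[OF B_ivl(2) c_ivlB(2)[OF that]] by auto
  have chain: "cycle_free (?c u) E" if u: "u \<in> B" for u
  proof (rule ccontr)
    assume "\<not> cycle_free (?c u) E"
    then have *: "\<not> diff E E' x y" if "x \<in> V" "x \<notin> ?c u" "y \<in> ?c u" for x y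
      using interval_arcs[OF c_ivl[OF u]] that by blast
    obtain x where x: "x \<in> B - ?c u" using c_sub[OF u] c_ne[OF u] by blast
    show False using *[of x u] c_diff'[OF u x c_self] x BV c_self[of u] by blast
  qed
  show ?thesis
  proof (intro reversed_block.intro reversed_block_axioms.intro)
    show "hypo_pair V E E'" by (rule hypo_pair_axioms)
    show "\<And>x y. x \<in> B \<Longrightarrow> y \<in> B \<Longrightarrow> ?c x \<noteq> ?c y \<Longrightarrow> diff E E' x y"
    proof -
      fix x y assume xy: "x \<in> B" "y \<in> B" "?c x \<noteq> ?c y"
      then have "x \<notin> ?c y" using c_eq[of y x] by blast
      then show "diff E E' x y" using c_diff'[OF xy(2), of x y] xy(1) c_self by blast
    qed
  qed (fact B_ivl nd strong cycle c_sub c_ne c_eq c_ivl chain | rule c_self)+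
qed

end

context reversed_block
begin

lemma BV: "B \<subseteq> V"
  using ivl_B(1) unfolding ivl_def by blast

lemma finB: "finite B"
  using BV fin finite_subset by blast

lemma tB: "tour B E" "tour B E'"
  using tour_subset[OF tE BV] tour_subset[OF tE' BV] by auto

lemma c_chain': "u \<in> B \<Longrightarrow> cycle_free (c u) E'"
  using c_chain[of u] same_cycles_free[OF same_cycles_subset[OF same, of "c u"]] c_sub(1)[of u] BV by blast

lemma rev_swap: "reversed_block V E' E B c"
proof (intro reversed_block.intro reversed_block_axioms.intro)
  show "hypo_pair V E' E" by (rule swap)
  show "\<not> cycle_free B E'"
    using cycle_B same_cycles_free[OF same_cycles_subset[OF same BV]] by simp
  show "\<And>x y. x \<in> V - B \<Longrightarrow> y \<in> B \<Longrightarrow> \<not> diff E' E x y"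
    unfolding diff_commute by (rule outside)
  show "\<And>x y. x \<in> B \<Longrightarrow> y \<in> B \<Longrightarrow> c x \<noteq> c y \<Longrightarrow> diff E' E x y"
    unfolding diff_commute by (rule c_diff)
qed (fact ivl_B conn_B c_self c_sub c_eq c_ivl c_chain')+

lemma c_uniform:
  assumes "u \<in> B" "w \<in> B" "c u \<noteq> c w" "x \<in> c u" "y \<in> c w"
  shows "E u w \<longleftrightarrow> E x y"
proof -
  have x: "x \<in> B" "c x = c u" and y: "y \<in> B" "c y = c w"
    using assms c_sub(1) c_eq by blast+
  have "u \<notin> c w" using c_eq[OF assms(2), of u] assms(3) by blast
  then have "E u w \<longleftrightarrow> E u y"
    using ivl_uniform(1)[OF tE c_ivl(1)[OF assms(2)], of u w y] assms c_self BV by blast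
  moreover have "y \<notin> c u" using c_eq[OF assms(1), of y] assms(3) y by auto
  then have "E u y \<longleftrightarrow> E x y"
    using ivl_uniform(2)[OF tE c_ivl(1)[OF assms(1)], of y u x] assms c_self y BV by blast
  ultimately show ?thesis by blast
qed

text \<open>Between chains \<open>E'\<close> is the dual of \<open>E\<close>, and inside a chain any
  two linear orders are isomorphic. This is what converts hypomorphy into self-duality of
  subtournaments.\<close>

lemma iso_dual_subset:
  assumes "J \<subseteq> B" shows "tour_iso J E' J E\<^sup>d"
proof (rule tour_iso_glue[where c = c and d = c])
  have JV: "J \<subseteq> V" using assms BV by blast
  fix k assume "k \<in> c ` J"
  then obtain u where u: "u \<in> J" "k = c u" by blast
  let ?F = "{v \<in> J. c v = k}"
  have "?F \<subseteq> c u" using u assms c_self by auto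
  then have "cycle_free ?F E" "cycle_free ?F E'"
    using cycle_free_subset[OF c_chain[of u]] cycle_free_subset[OF c_chain'[of u]] u assms by blast+
  moreover have "tour ?F E" "tour ?F E'"
    using tour_subset[OF tE, of ?F] tour_subset[OF tE', of ?F] JV by auto
  ultimately show "tour_iso ?F E' ?F E\<^sup>d"
    by (intro chain_iso) (simp_all add: tour_dual cycle_free_dual)
next
  fix v v' w w' assume *: "v \<in> J" "v' \<in> J" "w \<in> J" "w' \<in> J" "c v \<noteq> c v'" "c w = c v" "c w' = c v'"
  then have inB: "v \<in> B" "v' \<in> B" "w \<in> B" "w' \<in> B" using assms by auto
  have "v \<noteq> v'" using *(5) by blast
  have "diff E E' v v'" using c_diff inB *(5) by blast
  then have "E' v v' \<longleftrightarrow> E v' v"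
    using tour_flip[OF tB(1) inB(1,2) \<open>v \<noteq> v'\<close>] unfolding diff_def by simp
  moreover have "w \<in> c v" "w' \<in> c v'" using c_self[OF inB(3)] c_self[OF inB(4)] *(6,7) by auto
  then have "E v' v \<longleftrightarrow> E w' w" using c_uniform[OF inB(2,1)] *(5) by blast
  ultimately show "E' v v' = E\<^sup>d w w'" by simp
qed simp

text \<open>Saturating \<open>I\<close> to a union \<open>I'\<close> of chains gives a common
  interval whose boundary arcs are all reversed; as it contains a 3-cycle, it must be
  \<open>B\<close>. So \<open>I\<close> meets every chain, and a vertex outside \<open>I\<close>,
  being uniform towards it, would have a chain that cuts the strong tournament on
  \<open>B\<close>.\<close>

lemma interval_with_cycle:
  assumes I: "ivl B E I" and cyc: "\<not> cycle_free I E" shows "I = B"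
proof -
  have IB: "I \<subseteq> B" using I unfolding ivl_def by blast
  define I' where "I' = (\<Union>u\<in>I. c u)"
  have I'B: "I' \<subseteq> B" unfolding I'_def using IB c_sub(1) by blast
  have II': "I \<subseteq> I'" unfolding I'_def using IB c_self by blast
  have cne: "c x \<noteq> c y" if h: "x \<in> B - I'" "y \<in> I'" for x y
  proof
    assume eq: "c x = c y"
    obtain u where u: "u \<in> I" "y \<in> c u" using h(2) unfolding I'_def by blast
    then have "c y = c u" using c_eq[of u y] IB by blast
    then have "x \<in> c u" using c_self[of x] h(1) eq by simp
    then show False using h(1) u(1) unfolding I'_def by blast
  qed
  have diffI': "diff E E' x y" if h: "x \<in> B - I'" "y \<in> I'" for x y
    using c_diff[of x y] cne[OF h] h I'B by blast
  have uni: "uniform E x I'" if x: "x \<in> B - I'" for x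
  proof -
    have xy: "E x u \<longleftrightarrow> E x y" "E u x \<longleftrightarrow> E y x" if h: "u \<in> I" "y \<in> c u" for u y
    proof -
      have ne: "c x \<noteq> c u" using cne[OF x, of u] h(1) II' by blast
      have in_B: "x \<in> B" "u \<in> B" using x h(1) IB by auto
      show "E x u \<longleftrightarrow> E x y"
        by (rule c_uniform[OF in_B ne c_self[OF in_B(1)] h(2)])
      show "E u x \<longleftrightarrow> E y x"
        by (rule c_uniform[OF in_B(2,1) ne[symmetric] h(2) c_self[OF in_B(1)]])
    qed
    have "x \<in> B - I" using x II' by blast
    then have "uniform E x I" using I unfolding ivl_def by blast
    then show ?thesis unfolding I'_def using xy by blast
  qed
  have B1: "ivl B E I'" unfolding ivl_def using uni I'B by blast
  have "E' x y \<longleftrightarrow> E y x" "E' y x \<longleftrightarrow> E x y" if "x \<in> B - I'" "y \<in> I'" for x y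
  proof -
    have "x \<in> B" "y \<in> B" "x \<noteq> y" "diff E E' x y" "diff E E' y x"
      using that I'B diffI'[OF that] diff_symV[of x y] BV by blast+
    then show "E' x y \<longleftrightarrow> E y x" "E' y x \<longleftrightarrow> E x y"
      using tour_flip[OF tB(1), of x y] unfolding diff_def by auto
  qed
  then have B2: "ivl B E' I'" unfolding ivl_def using uni I'B by (metis (no_types, lifting))
  have "\<not> cycle_free I' E" using cyc II' cycle_free_subset by blast
  then have "\<not> diff E E' x y" if "x \<in> B - I'" "y \<in> I'" for x y
    using interval_arcs[OF ivl_trans[OF ivl_B(1) B1] ivl_trans[OF ivl_B(2) B2], of x y] that BV by blast
  moreover have "I' \<noteq> {}" using cyc II' unfolding cycle_free_def by blast
  ultimately have I'eq: "I' = B" using diffI' I'B by blast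
  show ?thesis
  proof (rule ccontr)
    assume "I \<noteq> B"
    then obtain x where x: "x \<in> B" "x \<notin> I" using IB by blast
    have cx: "c x \<subseteq> B" "c x \<noteq> B" "c x \<noteq> {}" "B - c x \<noteq> {}" "B - c x \<noteq> B"
      using c_sub[OF x(1)] c_self[OF x(1)] by auto
    have arcs: "E x' y \<longleftrightarrow> E x w" "E y x' \<longleftrightarrow> E w x"
      if "x' \<in> c x" "y \<in> B - c x" "y \<in> c w" "w \<in> I" for x' y w
    proof -
      have "w \<in> B" using that IB by blast
      moreover have "c x \<noteq> c w" using that(2,3) by auto
      ultimately show "E x' y \<longleftrightarrow> E x w" "E y x' \<longleftrightarrow> E w x"
        using c_uniform[of x w x' y] c_uniform[of w x y x'] x(1) that by auto
    qed
    have Iuni: "uniform E x I" using I x unfolding ivl_def by blast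
    have ex: "\<exists>w\<in>I. y \<in> c w" if "y \<in> B" for y using that I'eq unfolding I'_def by blast
    from Iuni show False
    proof
      assume all: "\<forall>w\<in>I. E x w"
      obtain y x' where yx: "y \<in> B - c x" "x' \<in> c x" "E y x'"
        using connD[OF conn_B(1), of "B - c x"] cx by blast
      obtain w where w: "w \<in> I" "y \<in> c w" using ex yx(1) by blast
      then have "E w x" "E x w" using arcs(2)[OF yx(2,1) w(2,1)] yx(3) all by blast+
      then show False using tour_asym[OF tB(1) x(1), of w] w IB by blast
    next
      assume all: "\<forall>w\<in>I. E w x"
      obtain x' y where yx: "y \<in> B - c x" "x' \<in> c x" "E x' y"
        using connD[OF conn_B(1), of "c x"] cx by blast
      obtain w where w: "w \<in> I" "y \<in> c w" using ex yx(1) by blast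
      then have "E w x" "E x w" using arcs(1)[OF yx(2,1) w(2,1)] yx(3) all by blast+
      then show False using tour_asym[OF tB(1) x(1), of w] w IB by blast
    qed
  qed
qed

text \<open>A copy \<open>L\<close> in \<open>E'\<close> through a 3-cycle of \<open>B\<close> meets
  \<open>B\<close> in an interval of \<open>L\<close>. Carried over to \<open>B\<close>, this
  interval contains a 3-cycle, hence is all of \<open>B\<close>, and \<open>L = B\<close> follows by
  cardinality.\<close>

lemma small_block_iso:
  assumes "card B + 3 \<le> card V" shows "tour_iso B E B E'"
proof -
  from cycle_B obtain a b d where abd: "a \<in> B" "b \<in> B" "d \<in> B" "cyc E a b d"
    unfolding cycle_free_def by blast
  then have V: "a \<in> V" "b \<in> V" "d \<in> V" using BV by auto
  have "card {a, b, d} \<le> 3" by (simp add: card_insert_if)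
  then obtain L where L: "{a, b, d} \<subseteq> L" "L \<subseteq> V" "tour_iso L E' B E"
    using hypomorphic3_copy[OF fin hyp, of "{a, b, d}" B] abd BV assms by auto
  then obtain f where f: "bij_betw f L B" and FE: "\<forall>x\<in>L. \<forall>y\<in>L. E' x y = E (f x) (f y)"
    by (rule_tac tour_isoE)
  have img: "ivl B E (f ` (L \<inter> B))"
    by (rule ivl_image[OF f FE ivl_Int[OF ivl_B(2) L(2)]])
  have "cyc E' a b d \<or> cyc E' a d b" using same_cyc[OF V abd(4)] .
  moreover have "cyc E' a b d = cyc E (f a) (f b) (f d)" "cyc E' a d b = cyc E (f a) (f d) (f b)"
    using FE L(1) unfolding cyc_def by simp_all
  moreover have "f a \<in> f ` (L \<inter> B)" "f b \<in> f ` (L \<inter> B)" "f d \<in> f ` (L \<inter> B)" using L(1) abd by auto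
  ultimately have "\<not> cycle_free (f ` (L \<inter> B)) E" unfolding cycle_free_def by blast
  then have "f ` (L \<inter> B) = B" using interval_with_cycle[OF img] by blast
  then have "card (L \<inter> B) = card B"
    using card_image[of f "L \<inter> B"] inj_on_subset[OF bij_betw_imp_inj_on[OF f]] by (metis Int_lower1)
  then have "L \<inter> B = B" using card_subset_eq[OF finB] by blast
  then have "B \<subseteq> L" by blast
  then have "L = B"
    using card_subset_eq[OF finite_subset[OF L(2) fin], of B] tour_iso_card[OF L(3)] by simp
  then show ?thesis using tour_iso_sym[OF L(3)] by simp
qed

end

section \<open>Blocks with twins contain no diamond\<close>

definition diamond :: "('a \<Rightarrow> 'a \<Rightarrow> bool) \<Rightarrow> 'a \<Rightarrow> 'a \<Rightarrow> 'a \<Rightarrow> 'a \<Rightarrow> bool" where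
  "diamond E a b c d \<longleftrightarrow> cyc E b c d \<and> (E a b \<and> E a c \<and> E a d \<or> E b a \<and> E c a \<and> E d a)"

definition diamond_free :: "'a set \<Rightarrow> ('a \<Rightarrow> 'a \<Rightarrow> bool) \<Rightarrow> bool" where
  "diamond_free V E \<longleftrightarrow> (\<forall>a\<in>V. \<forall>b\<in>V. \<forall>c\<in>V. \<forall>d\<in>V. \<not> diamond E a b c d)"

lemma diamond_dual: "diamond E\<^sup>d a b c d \<longleftrightarrow> diamond E a b d c"
  unfolding diamond_def cyc_dual by auto

lemma diamond_rot: "diamond E a b c d \<Longrightarrow> diamond E a c d b"
  unfolding diamond_def cyc_def by auto

lemma diamond_free_subset: "diamond_free V E \<Longrightarrow> W \<subseteq> V \<Longrightarrow> diamond_free W E"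
  unfolding diamond_free_def by (simp add: subset_iff)

text \<open>First \<open>x\<close> must dominate \<open>a\<close>. Then either
  \<open>x, a, c\<close> is a 3-cycle dominating \<open>d\<close>, or \<open>x, a, d\<close> is one
  dominating \<open>b\<close>, depending on the arc between \<open>x\<close> and
  \<open>d\<close>.\<close>

lemma diamond_spread_aux:
  assumes t: "tour B E" and V: "a \<in> B" "b \<in> B" "c \<in> B" "d \<in> B" "x \<in> B"
    and cy: "cyc E b c d" and out: "E a b" "E a c" "E a d" and ne: "x \<noteq> a" "x \<noteq> b" "x \<noteq> c" "x \<noteq> d"
    and xbc: "E x b" "E c x"
    and no: "\<And>p q r s. \<lbrakk>p \<in> B; q \<in> B; r \<in> B; s \<in> B; x \<in> {p, q, r, s}\<rbrakk> \<Longrightarrow> \<not> diamond E p q r s"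
  shows False
proof -
  have flip: "E v u \<longleftrightarrow> \<not> E u v" if "u \<in> B" "v \<in> B" "u \<noteq> v" for u v using tour_flip[OF t that] .
  have cy': "E b c" "E c d" "E d b" using cy by (auto simp: cyc_def)
  have "\<not> diamond E a x b c" using no V by blast
  then have "E x a" using flip[of x a] V ne xbc cy' out unfolding diamond_def cyc_def by blast
  show False
  proof (cases "E x d")
    case True
    have "diamond E d x a c" unfolding diamond_def cyc_def using True \<open>E x a\<close> out xbc cy' by blast
    then show False using no[of d x a c] V by blast
  next
    case False
    then have "E d x" using flip[of x d] V ne by blast
    then have "diamond E b x a d" unfolding diamond_def cyc_def using \<open>E x a\<close> out xbc cy' by blast
    then show False using no[of b x a d] V by blast
  qed
qed

lemma diamond_spread_out:
  assumes t: "tour B E" and V: "a \<in> B" "b \<in> B" "c \<in> B" "d \<in> B" "x \<in> B"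
    and cy: "cyc E b c d" and out: "E a b" "E a c" "E a d"
    and no: "\<And>p q r s. \<lbrakk>p \<in> B; q \<in> B; r \<in> B; s \<in> B; x \<in> {p, q, r, s}\<rbrakk> \<Longrightarrow> \<not> diamond E p q r s"
  shows False
proof -
  have "diamond E a b c d" using cy out unfolding diamond_def by blast
  then have ne: "x \<noteq> a" "x \<noteq> b" "x \<noteq> c" "x \<noteq> d" using no[of a b c d] V by blast+
  have flip: "E v u \<longleftrightarrow> \<not> E u v" if "u \<in> B" "v \<in> B" "u \<noteq> v" for u v using tour_flip[OF t that] .
  have "\<not> diamond E x b c d" using no V by blast
  \<comment> \<open>Since \<open>x\<close> is no apex over or under the cycle, it forms a 3-cycle
    with two consecutive vertices of it; rotation leaves one case.\<close>
  then consider "E x b" "E c x" | "E x c" "E d x" | "E x d" "E b x"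
    using cy flip[of x b] flip[of x c] flip[of x d] V ne unfolding diamond_def by blast
  then show False
  proof cases
    case 1 show False by (rule diamond_spread_aux[OF t V cy out ne 1 no])
  next
    case 2 show False
      by (rule diamond_spread_aux[OF t V(1,3,4,2,5) cyc_rot[OF cy] out(2,3,1) ne(1,3,4,2) 2 no])
  next
    case 3 show False
      by (rule diamond_spread_aux[OF t V(1,4,2,3,5) cyc_rot[OF cyc_rot[OF cy]] out(3,1,2) ne(1,4,2,3) 3 no])
  qed
qed

text \<open>A diamond anywhere forces one through every vertex, so excluding diamonds at a single
  twin will be enough.\<close>

lemma diamond_spread:
  assumes t: "tour B E" and x: "x \<in> B"
    and no: "\<And>p q r s. \<lbrakk>p \<in> B; q \<in> B; r \<in> B; s \<in> B; x \<in> {p, q, r, s}\<rbrakk> \<Longrightarrow> \<not> diamond E p q r s"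
  shows "diamond_free B E"
  unfolding diamond_free_def
proof (intro ballI notI)
  fix a b c d assume V: "a \<in> B" "b \<in> B" "c \<in> B" "d \<in> B" and d: "diamond E a b c d"
  from d have cy: "cyc E b c d" and "E a b \<and> E a c \<and> E a d \<or> E b a \<and> E c a \<and> E d a"
    unfolding diamond_def by auto
  then consider "E a b" "E a c" "E a d" | "E b a" "E c a" "E d a" by blast
  then show False
  proof cases
    case 1 show False by (rule diamond_spread_out[OF t V x cy 1 no])
  next
    case 2
    have no': "\<not> diamond E\<^sup>d p q r s" if "p \<in> B" "q \<in> B" "r \<in> B" "s \<in> B" "x \<in> {p, q, r, s}" for p q r s
      unfolding diamond_dual using that by (intro no) auto
    have t': "tour B E\<^sup>d" using t by (simp add: tour_dual)
    have cy': "cyc E\<^sup>d b d c" using cy by (simp add: cyc_dual)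
    show False
      by (rule diamond_spread_out[OF t' V(1,2,4,3) x cy' _ _ _ no']) (use 2 in auto)
  qed
qed

text \<open>The tournament on five vertices in which \<open>s\<close> dominates a 3-cycle with one vertex doubled.\<close>

definition quint :: "('a \<Rightarrow> 'a \<Rightarrow> bool) \<Rightarrow> 'a \<Rightarrow> 'a \<Rightarrow> 'a \<Rightarrow> 'a \<Rightarrow> 'a \<Rightarrow> bool" where
  "quint G s p p' q r \<longleftrightarrow> G s p \<and> G s p' \<and> G s q \<and> G s r \<and> G p q \<and> G p' q \<and> G q r \<and> G r p \<and> G r p'"

text \<open>The vertices \<open>s, p, p', q, r\<close> are numbered 0 to 4. The arc between the
  doubled vertices, left open by \<open>quint\<close>, is fixed here; exchanging the two gives the
  other choice.\<close>

definition quint_arcs :: "nat \<Rightarrow> nat \<Rightarrow> bool" where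
  "quint_arcs m n \<longleftrightarrow>
     (m, n) \<in> {(0,1), (0,2), (0,3), (0,4), (1,2), (1,3), (2,3), (3,4), (4,1), (4,2)}"

lemma quintE:
  assumes "tour_iso K G {0,1,2,3,4} quint_arcs"
  obtains s p p' q r where "K = {s, p, p', q, r}" "quint G s p p' q r"
proof -
  from tour_iso_sym[OF assms] obtain g where g: "bij_betw g {0,1,2,3,4} K"
    and gG: "\<forall>x\<in>{0,1,2,3,4}. \<forall>y\<in>{0,1,2,3,4}. quint_arcs x y = G (g x) (g y)" by (rule tour_isoE)
  have "quint G (g 0) (g 1) (g 2) (g 3) (g 4)"
    using gG unfolding quint_def quint_arcs_def by simp
  moreover have "K = {g 0, g 1, g 2, g 3, g 4}" using bij_betw_imp_surj_on[OF g] by simp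
  ultimately show ?thesis using that by blast
qed

lemma quint_iso_aux:
  assumes t: "tour K G" and K: "K = {s, p, p', q, r}" and pp: "G p p'" and Q: "quint G s p p' q r"
  shows "tour_iso K G {0,1,2,3,4} quint_arcs"
proof (rule tour_iso_sym)
  define g where "g n = [s, p, p', q, r] ! n" for n :: nat
  have g: "g 0 = s" "g (Suc 0) = p" "g 2 = p'" "g 3 = q" "g 4 = r" by (simp_all add: g_def)
  have irr: "\<not> G u u" if "u \<in> K" for u using tour_irrefl[OF t that] .
  have asym: "G u v \<Longrightarrow> \<not> G v u" if "u \<in> K" "v \<in> K" for u v using tour_asym[OF t that] .
  have inK: "s \<in> K" "p \<in> K" "p' \<in> K" "q \<in> K" "r \<in> K" using K by auto
  have neg: "\<not> G s s" "\<not> G p p" "\<not> G p' p'" "\<not> G q q" "\<not> G r r" using irr inK by auto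
  have neg': "\<not> G p s" "\<not> G p' s" "\<not> G q s" "\<not> G r s" "\<not> G p' p" "\<not> G q p" "\<not> G q p'" "\<not> G r q"
    "\<not> G p r" "\<not> G p' r"
    using asym inK pp Q unfolding quint_def by blast+
  have pos: "G s p" "G s p'" "G s q" "G s r" "G p q" "G p' q" "G q r" "G r p" "G r p'"
    using Q unfolding quint_def by auto
  have "s \<noteq> p" "s \<noteq> p'" "s \<noteq> q" "s \<noteq> r" "p \<noteq> p'" "p \<noteq> q" "p \<noteq> r" "p' \<noteq> q" "p' \<noteq> r" "q \<noteq> r"
    using pos pp neg by auto
  then have "bij_betw g {0,1,2,3,4} K"
    unfolding bij_betw_def inj_on_def K by (simp add: g)
  then show "tour_iso {0,1,2,3,4} quint_arcs K G"
  proof (rule tour_isoI)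
    fix x y :: nat assume "x \<in> {0,1,2,3,4}" "y \<in> {0,1,2,3,4}"
    then show "quint_arcs x y = G (g x) (g y)"
      by (elim insertE emptyE) (simp_all add: quint_arcs_def g pos neg neg' pp)
  qed
qed

lemma quint_sym: "quint G s p p' q r \<Longrightarrow> quint G s p' p q r"
  unfolding quint_def by blast

lemma quint_iso:
  assumes t: "tour K G" and K: "K = {s, p, p', q, r}" and pp: "p \<noteq> p'" and Q: "quint G s p p' q r"
  shows "tour_iso K G {0,1,2,3,4} quint_arcs"
proof (cases "G p p'")
  case True
  then show ?thesis by (rule quint_iso_aux[OF t K _ Q])
next
  case False
  then have "G p' p" using tour_flip[OF t, of p p'] K pp by simp
  moreover have "K = {s, p', p, q, r}" using K by blast
  ultimately show ?thesis using quint_iso_aux[OF t _ _ quint_sym[OF Q]] by blast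
qed

text \<open>Covers two origins of twins at once: a chain \<open>c u\<close> with at least two
  vertices or, if all chains are singletons, a nontrivial interval of the block.\<close>

locale twin_block = reversed_block +
  fixes C :: "'a set" and x x' :: 'a
  assumes C: "C \<subseteq> B" "ivl V E C" "ivl V E' C" "cycle_free C E"
    and xx: "x \<in> C" "x' \<in> C" "x \<noteq> x'"
    and C_diff: "y \<in> B - C \<Longrightarrow> z \<in> C \<Longrightarrow> diff E E' y z"
begin

lemma CV: "C \<subseteq> V"
  using C(1) BV by blast

lemma C_chain': "cycle_free C E'"
  using C(4) same_cycles_free[OF same_cycles_subset[OF same CV]] by simp

lemma twin_swap: "twin_block V E' E B c C x x'"
proof (intro twin_block.intro twin_block_axioms.intro rev_swap C(1,2,3) C_chain' xx)
  show "\<And>y z. y \<in> B - C \<Longrightarrow> z \<in> C \<Longrightarrow> diff E' E y z"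
    unfolding diff_commute by (rule C_diff)
qed

text \<open>If one further vertex of the cycle were in \<open>C\<close>, uniformity would force the
  third one in as well, but \<open>C\<close> is acyclic.\<close>

lemma C_cycle:
  assumes "p \<in> C" "q \<in> V" "r \<in> V" "cyc E p q r" shows "q \<notin> C" "r \<notin> C"
proof -
  have p: "p \<in> V" using assms(1) CV by blast
  have arcs: "E p q" "E q r" "E r p" using assms(4) by (auto simp: cyc_def)
  have "q \<in> C \<longleftrightarrow> r \<in> C"
  proof
    assume "q \<in> C" then show "r \<in> C"
      using ivl_uniform(2)[OF tE C(2) assms(3), of q p] arcs tour_asym[OF tE assms(3) p] assms(1) by blast
  next
    assume "r \<in> C" then show "q \<in> C"
      using ivl_uniform(2)[OF tE C(2) assms(2), of p r] arcs tour_asym[OF tE assms(2,3)] assms(1) by blast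
  qed
  then show "q \<notin> C" "r \<notin> C" using C(4) assms(1,4) unfolding cycle_free_def by blast+
qed

lemma C_uniform:
  assumes "y \<in> V" "y \<notin> C" "p \<in> C" "q \<in> C"
  shows "E y p \<longleftrightarrow> E y q" "E p y \<longleftrightarrow> E q y"
  using ivl_uniform[OF tE C(2) assms] by auto

lemma C_flip:
  assumes "y \<in> B - C" "p \<in> C" shows "E' p y \<longleftrightarrow> E y p" "E' y p \<longleftrightarrow> E p y"
proof -
  have *: "y \<in> V" "p \<in> V" "y \<noteq> p" "diff E E' y p" "diff E E' p y"
    using assms C_diff[OF assms] diff_symV[of y p] BV C(1) by auto
  then show "E' p y \<longleftrightarrow> E y p" "E' y p \<longleftrightarrow> E p y"
    using tour_flip[OF tE *(1-3)] unfolding diff_def by auto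
qed

text \<open>If \<open>q\<close> were in \<open>C\<close>, no other vertex of the 3-cycle would be;
  and \<open>s\<close> dominates \<open>q\<close> but not \<open>p\<close> or \<open>p'\<close>, so
  these would be outside too. A single vertex cannot be both twins.\<close>

lemma doubled_apex:
  assumes V: "p \<in> V" "p' \<in> V" "q \<in> V" "r \<in> V" "s \<in> V"
    and arcs: "E p q" "E p r" "E p s" "E p' q" "E p' r" "E p' s" and cy: "cyc E q r s"
    and x: "x \<in> {p, p', q, r, s}" "x' \<in> {p, p', q, r, s}"
  shows "q \<notin> C"
proof
  assume q: "q \<in> C"
  have rs: "r \<notin> C" "s \<notin> C" using C_cycle[OF q V(4,5) cy] by auto
  have "E s q" using cy by (simp add: cyc_def)
  then have "p \<notin> C" "p' \<notin> C"
    using C_uniform(1)[OF V(5) rs(2) q] arcs tour_asym[OF tE V(5)] V by blast+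
  then have "x = q" "x' = q" using x rs xx by auto
  then show False using xx(3) by simp
qed

text \<open>A copy in \<open>E'\<close> through both twins and \<open>y\<close> must have the twins
  as its two apexes by \<open>doubled_apex\<close>. There \<open>x\<close> dominates
  \<open>y\<close>, although this arc is reversed.\<close>

lemma out_acyclic:
  assumes y: "y \<in> B - C" "z \<in> B - C" "t \<in> B - C" "E x y" "E x z" "E x t" "cyc E y z t"
  shows False
proof -
  interpret S: twin_block V E' E B c C x x' by (rule twin_swap)
  have V: "x \<in> V" "x' \<in> V" "y \<in> V" "z \<in> V" "t \<in> V" using y xx CV BV by auto
  have dist: "y \<noteq> z" "z \<noteq> t" "t \<noteq> y" using y(7) V tour_irrefl[OF tE] by (auto simp: cyc_def)
  have dist': "x \<noteq> y" "x \<noteq> z" "x \<noteq> t" "x' \<noteq> y" "x' \<noteq> z" "x' \<noteq> t" using y xx by auto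
  have Ex': "E x' y" "E x' z" "E x' t" using C_uniform(2)[OF _ _ xx(1,2)] y V by blast+
  have "card {x, x', y} = 3" "card {x, x', y, z, t} = 5" using dist dist' xx(3) by auto
  then obtain L where L: "{x, x', y} \<subseteq> L" "L \<subseteq> V" "tour_iso L E' {x, x', y, z, t} E"
    using hypomorphic3_copy[OF fin hyp, of "{x, x', y}" "{x, x', y, z, t}"] V card9 by auto
  from tour_iso_sym[OF L(3)] obtain f where f: "bij_betw f {x, x', y, z, t} L"
    and FE: "\<forall>u\<in>{x, x', y, z, t}. \<forall>v\<in>{x, x', y, z, t}. E u v = E' (f u) (f v)" by (rule tour_isoE)
  define p p' q r s where "p = f x" "p' = f x'" "q = f y" "r = f z" "s = f t"
  note d = this
  have Leq: "L = {p, p', q, r, s}" using bij_betw_imp_surj_on[OF f] unfolding d by blast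
  have inV: "p \<in> V" "p' \<in> V" "q \<in> V" "r \<in> V" "s \<in> V" using L(2) Leq by auto
  have arcs: "E' p q" "E' p r" "E' p s" "E' p' q" "E' p' r" "E' p' s" and cy: "cyc E' q r s"
    using FE y Ex' unfolding d cyc_def by blast+
  have xL: "x \<in> {p, p', q, r, s}" "x' \<in> {p, p', q, r, s}" "y \<in> {p, p', q, r, s}" using L(1) Leq by auto
  have "q \<notin> C" by (rule S.doubled_apex[OF inV arcs cy xL(1,2)])
  moreover have "r \<notin> C"
    by (rule S.doubled_apex[OF inV(1,2,4,5,3) arcs(2,3,1,5,6,4) cyc_rot[OF cy]]) (use xL in auto)
  moreover have "s \<notin> C"
    by (rule S.doubled_apex[OF inV(1,2,5,3,4) arcs(3,1,2,6,4,5) cyc_rot[OF cyc_rot[OF cy]]]) (use xL in auto)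
  ultimately have "x \<in> {p, p'}" "x' \<in> {p, p'}" using xL xx by auto
  moreover from this have "y \<in> {q, r, s}" using xL(3) xx(3) y(1) dist' by auto
  ultimately have "E' x y" using arcs by auto
  then show False using C_flip(1)[OF y(1) xx(1)] y(4) tour_asym[OF tE V(1,3)] by blast
qed

lemma quint_twins:
  assumes K: "K \<subseteq> V" "x \<in> K" "x' \<in> K" and iso: "tour_iso K E {0,1,2,3,4} quint_arcs"
  shows "\<exists>s q r. K = {s, x, x', q, r} \<and> quint E s x x' q r"
proof -
  from iso obtain s p p' q r where Keq: "K = {s, p, p', q, r}" and Q: "quint E s p p' q r"
    by (rule quintE)
  have V: "s \<in> V" "p \<in> V" "p' \<in> V" "q \<in> V" "r \<in> V" using K Keq by auto
  have arcs: "E s p" "E s p'" "E s q" "E s r" "E p q" "E p' q" "E q r" "E r p" "E r p'"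
    using Q unfolding quint_def by auto
  have cy: "cyc E q r p" "cyc E q r p'" using arcs by (auto simp: cyc_def)
  have q: "q \<notin> C"
  proof
    assume qC: "q \<in> C"
    have n: "r \<notin> C" "p \<notin> C" "p' \<notin> C" using C_cycle[OF qC V(5) _ cy(1)] C_cycle[OF qC V(5) _ cy(2)] V by auto
    then have "s \<in> C" using K(2,3) Keq xx by auto
    then show False
      using C_uniform(2)[OF V(2) n(2) _ qC, of s] arcs tour_asym[OF tE V(4,2)] by blast
  qed
  have r: "r \<notin> C"
  proof
    assume rC: "r \<in> C"
    have n: "p \<notin> C" "p' \<notin> C"
      using C_cycle[OF rC _ V(4) cyc_rot[OF cy(1)]] C_cycle[OF rC _ V(4) cyc_rot[OF cy(2)]] V by auto
    then have "s \<in> C" using K(2,3) Keq xx q by auto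
    then show False
      using C_uniform(2)[OF V(4) q _ rC, of s] arcs tour_asym[OF tE V(4,5)] by blast
  qed
  have "s \<notin> C"
  proof
    assume sC: "s \<in> C"
    have "E s r \<longleftrightarrow> E u r" if "u \<in> C" for u using C_uniform(2)[OF V(5) r sC that] .
    then have "p \<notin> C" "p' \<notin> C" using arcs tour_asym[OF tE V(5)] V by blast+
    then have "x = s" "x' = s" using K(2,3) Keq xx q r by auto
    then show False using xx(3) by simp
  qed
  then have "x \<in> {p, p'}" "x' \<in> {p, p'}" using K Keq xx q r by auto
  then consider "x = p" "x' = p'" | "x = p'" "x' = p" using xx(3) by auto
  then show ?thesis
  proof cases
    case 1 then show ?thesis using Keq Q by blast
  next
    case 2
    moreover have "K = {s, p', p, q, r}" using Keq by blast
    ultimately show ?thesis using quint_sym[OF Q] by blast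
  qed
qed

lemma quint_notin_C:
  assumes V: "s \<in> V" "q \<in> V" "r \<in> V" and Q: "quint E s x x' q r"
  shows "s \<notin> C" "q \<notin> C" "r \<notin> C"
proof -
  have arcs: "E s r" "E r x" and cy: "cyc E x q r" using Q unfolding quint_def cyc_def by auto
  show "q \<notin> C" and r: "r \<notin> C" using C_cycle[OF xx(1) V(2,3) cy] by auto
  show "s \<notin> C"
  proof
    assume "s \<in> C"
    then have "E x r" using C_uniform(2)[OF V(3) r _ xx(1)] arcs(1) by blast
    then show False using arcs(2) tour_asym[OF tE V(3)] xx(1) CV by blast
  qed
qed

text \<open>Only copies inside \<open>B\<close> are collected, since those that leave
  \<open>B\<close> cancel by \<open>quint_outside\<close>.\<close>

definition quints :: "('a \<Rightarrow> 'a \<Rightarrow> bool) \<Rightarrow> 'a set set" where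
  "quints G = {K. K \<subseteq> B \<and> (\<exists>s q r. K = {s, x, x', q, r} \<and> quint G s x x' q r)}"

lemma finite_quints: "finite (quints G)"
  unfolding quints_def by (rule finite_subset[of _ "Pow B"]) (use finB in auto)

text \<open>Only \<open>s\<close> can lie outside \<open>B\<close>, so its arcs are kept, while
  those between the twins and \<open>q, r\<close> are reversed. The 3-cycles turn round,
  \<open>q\<close> and \<open>r\<close> exchange roles, and the same set is a copy in
  \<open>E'\<close>.\<close>

lemma quint_outside:
  assumes y: "y \<in> B - C" and K: "{x, x', y} \<subseteq> K" "K \<subseteq> V" "\<not> K \<subseteq> B"
    and iso: "tour_iso K E {0,1,2,3,4} quint_arcs"
  shows "tour_iso K E' {0,1,2,3,4} quint_arcs"
proof -
  obtain s q r where Keq: "K = {s, x, x', q, r}" and Q: "quint E s x x' q r"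
    using quint_twins[OF K(2) _ _ iso] K(1) by auto
  have V: "s \<in> V" "q \<in> V" "r \<in> V" "x \<in> V" "x' \<in> V" using K(2) Keq by auto
  have notC: "s \<notin> C" "q \<notin> C" "r \<notin> C" using quint_notin_C[OF V(1-3) Q] by auto
  have xB: "x \<in> B" "x' \<in> B" using xx C(1) by auto
  have arcs: "E s x" "E s x'" "E s q" "E s r" "E x q" "E x' q" "E q r" "E r x" "E r x'"
    using Q unfolding quint_def by auto
  have asym: "E u v \<Longrightarrow> \<not> E v u" if "u \<in> V" "v \<in> V" for u v using tour_asym[OF tE that] .
  have uni: "E u v \<longleftrightarrow> E u w" "E v u \<longleftrightarrow> E w u" if "u \<in> V" "u \<notin> B" "v \<in> B" "w \<in> B" for u v w
    using ivl_uniform[OF tE ivl_B(1) that] by auto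
  have yK: "y \<in> {s, q, r}" using K(1) Keq y xx by auto
  have q: "q \<in> B"
  proof (rule ccontr)
    assume nq: "q \<notin> B"
    have to_q: "E u q" if "u \<in> B" for u using uni(2)[OF V(2) nq xB(1) that] arcs(5) by blast
    have nr: "r \<notin> B" using to_q[of r] asym[OF V(3,2)] arcs(7) by blast
    then have "s \<in> B" using yK y nq by blast
    then have "E r s" using uni(1)[OF V(3) nr xB(1)] arcs(8) by blast
    then show False using asym[OF V(3,1)] arcs(4) by blast
  qed
  have r: "r \<in> B"
  proof (rule ccontr)
    assume nr: "r \<notin> B"
    have "E r q" using uni(1)[OF V(3) nr xB(1) q] arcs(8) by blast
    then show False using asym[OF V(3,2)] arcs(7) by blast
  qed
  have s: "s \<in> V - B" using K(3) Keq q r xB V by auto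
  have "E' s x" "E' s x'" "E' s q" "E' s r"
    using arcs outside[OF s xB(1)] outside[OF s xB(2)] outside[OF s q] outside[OF s r]
    unfolding diff_def by auto
  moreover have "E' q x" "E' q x'" "E' x r" "E' x' r"
    using C_flip[of q] C_flip[of r] q r notC xx arcs by blast+
  moreover have "cyc E' x q r \<or> cyc E' x r q"
    using same_cyc[OF V(4,2,3)] arcs unfolding cyc_def by blast
  then have "E' r q" using \<open>E' q x\<close> tour_asym[OF tE' V(2,4)] unfolding cyc_def by blast
  ultimately have "quint E' s x x' r q" unfolding quint_def by blast
  moreover have "K = {s, x, x', r, q}" using Keq by blast
  ultimately show ?thesis using quint_iso[OF tour_subset[OF tE' K(2)] _ xx(3)] by blast
qed

lemma copies_split:
  assumes "y \<in> B - C"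
  shows "{K. {x, x', y} \<subseteq> K \<and> K \<subseteq> V \<and> tour_iso K E {0,1,2,3,4} quint_arcs} =
    {K\<in>quints E. y \<in> K} \<union>
    {K. {x, x', y} \<subseteq> K \<and> K \<subseteq> V \<and> \<not> K \<subseteq> B \<and> tour_iso K E {0,1,2,3,4} quint_arcs}"
    (is "?L = ?R1 \<union> ?R2")
proof (intro equalityI subsetI)
  fix K assume K: "K \<in> ?L"
  show "K \<in> ?R1 \<union> ?R2"
  proof (cases "K \<subseteq> B")
    case True
    then have "K \<in> quints E" unfolding quints_def using quint_twins[of K] K by blast
    then show ?thesis using K by blast
  next
    case False then show ?thesis using K by blast
  qed
next
  fix K assume "K \<in> ?R1 \<union> ?R2"
  then show "K \<in> ?L"
  proof
    assume K: "K \<in> ?R1"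
    then obtain s q r where Keq: "K = {s, x, x', q, r}" and Q: "quint E s x x' q r" and KB: "K \<subseteq> B"
      unfolding quints_def by blast
    have "tour_iso K E {0,1,2,3,4} quint_arcs"
      by (rule quint_iso[OF tour_subset[OF tB(1) KB] Keq xx(3) Q])
    then show "K \<in> ?L" using K Keq KB BV by auto
  qed blast
qed

text \<open>The twins and \<open>y\<close> are the three prescribed vertices. Copies leaving
  \<open>B\<close> are the same sets for \<open>E\<close> and \<open>E'\<close>, so equality remains
  for those inside.\<close>

lemma count_quints:
  assumes y: "y \<in> B - C"
  shows "card {K\<in>quints E. y \<in> K} = card {K\<in>quints E'. y \<in> K}"
proof -
  interpret S: twin_block V E' E B c C x x' by (rule twin_swap)
  let ?iso = "\<lambda>K G. tour_iso K G {0,1,2,3,4} quint_arcs"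
  define A where "A G = {K. {x, x', y} \<subseteq> K \<and> K \<subseteq> V \<and> ?iso K G}" for G
  define Z where "Z G = {K. {x, x', y} \<subseteq> K \<and> K \<subseteq> V \<and> \<not> K \<subseteq> B \<and> ?iso K G}" for G
  have "card {0::nat,1,2,3,4} = 5" by simp
  moreover have "card {x, x', y} \<le> 3" by (simp add: card_insert_if)
  ultimately have AA: "card (A E) = card (A E')"
    unfolding A_def using xx CV y BV card9 by (intro hypomorphic3_count[OF fin hyp]) auto
  have ZZ: "Z E = Z E'"
    unfolding Z_def using quint_outside[OF y] S.quint_outside[OF y] by blast
  have finZ: "finite (Z G)" for G
    unfolding Z_def by (rule finite_subset[of _ "Pow V"]) (use fin in auto)
  have split: "card (A G) = card {K\<in>quints G. y \<in> K} + card (Z G)"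
    if "A G = {K\<in>quints G. y \<in> K} \<union> Z G" for G
    unfolding that
  proof (rule card_Un_disjoint)
    show "finite {K\<in>quints G. y \<in> K}" using finite_quints[of G] by simp
    show "{K\<in>quints G. y \<in> K} \<inter> Z G = {}" unfolding quints_def Z_def by blast
  qed (rule finZ)
  have "A E = {K\<in>quints E. y \<in> K} \<union> Z E" unfolding A_def Z_def by (rule copies_split[OF y])
  moreover have "A E' = {K\<in>quints E'. y \<in> K} \<union> Z E'"
    unfolding A_def Z_def quints_def using S.copies_split[OF y] unfolding S.quints_def .
  ultimately show ?thesis using split[of E] split[of E'] AA ZZ by simp
qed

lemma sum_quints:
  assumes P: "P \<subseteq> B - C" and k: "\<And>K. K \<in> quints G \<Longrightarrow> card (K \<inter> P) = k"
  shows "(\<Sum>y\<in>P. card {K\<in>quints G. y \<in> K}) = k * card (quints G)"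
proof -
  have finP: "finite P" using P finB finite_subset by blast
  have "(\<Sum>y\<in>P. card {K\<in>quints G. y \<in> K}) = (\<Sum>y\<in>P. \<Sum>K\<in>{K. K \<in> quints G \<and> y \<in> K}. 1)" by simp
  also have "\<dots> = (\<Sum>K\<in>quints G. \<Sum>y\<in>{y. y \<in> P \<and> y \<in> K}. 1)"
    by (rule sum.swap_restrict[OF finP finite_quints])
  also have "\<dots> = (\<Sum>K\<in>quints G. k)"
  proof (rule sum.cong)
    fix K assume "K \<in> quints G"
    moreover have "{y. y \<in> P \<and> y \<in> K} = K \<inter> P" by blast
    ultimately show "(\<Sum>y\<in>{y. y \<in> P \<and> y \<in> K}. 1) = k" using k by simp
  qed simp
  finally show ?thesis by simp
qed

lemma quints_Int:
  assumes "K \<in> quints E"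
  shows "card (K \<inter> {y\<in>B - C. E x y}) = 1" "card (K \<inter> {y\<in>B - C. E y x}) = 2"
proof -
  obtain s q r where Keq: "K = {s, x, x', q, r}" and Q: "quint E s x x' q r" and KB: "K \<subseteq> B"
    using assms unfolding quints_def by blast
  have B: "s \<in> B" "q \<in> B" "r \<in> B" "x \<in> B" "x' \<in> B" using Keq KB by auto
  have notC: "s \<notin> C" "q \<notin> C" "r \<notin> C" using quint_notin_C[OF _ _ _ Q] B BV by auto
  have arcs: "E s x" "E x q" "E r x" "E s r" using Q unfolding quint_def by auto
  then have neg: "\<not> E x s" "\<not> E q x" "\<not> E x r" "s \<noteq> r"
    using tour_asym[OF tB(1)] tour_irrefl[OF tB(1)] B by blast+
  have "K \<inter> {y\<in>B - C. E x y} = {q}" "K \<inter> {y\<in>B - C. E y x} = {s, r}"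
    using Keq B notC arcs neg xx by auto
  then show "card (K \<inter> {y\<in>B - C. E x y}) = 1" "card (K \<inter> {y\<in>B - C. E y x}) = 2"
    using neg by simp_all
qed

text \<open>Outside \<open>C\<close> a copy has one out-neighbour and two in-neighbours of \<open>x\<close>, and reversing the block
  exchanges these. Summing \<open>count_quints\<close> over the out- and over the in-neighbours gives
  \<open>m = 2 m'\<close> and \<open>2 m = m'\<close> for the numbers of copies.\<close>

lemma no_quints: "quints E = {}" "quints E' = {}"
proof -
  interpret S: twin_block V E' E B c C x x' by (rule twin_swap)
  let ?O = "{y\<in>B - C. E x y}" and ?I = "{y\<in>B - C. E y x}"
  have eq: "{y\<in>B - C. E' x y} = ?I" "{y\<in>B - C. E' y x} = ?O" using C_flip xx(1) by blast+
  have E': "card (K \<inter> ?I) = 1" "card (K \<inter> ?O) = 2" if "K \<in> quints E'" for K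
    using S.quints_Int[OF that] unfolding eq by auto
  have "(\<Sum>y\<in>P. card {K\<in>quints E. y \<in> K}) = (\<Sum>y\<in>P. card {K\<in>quints E'. y \<in> K})" if "P \<subseteq> B - C" for P
    by (rule sum.cong) (use that count_quints in auto)
  from this[of ?O] this[of ?I]
  have eqs: "(\<Sum>y\<in>?O. card {K\<in>quints E. y \<in> K}) = (\<Sum>y\<in>?O. card {K\<in>quints E'. y \<in> K})"
    "(\<Sum>y\<in>?I. card {K\<in>quints E. y \<in> K}) = (\<Sum>y\<in>?I. card {K\<in>quints E'. y \<in> K})" by auto
  have sub: "?O \<subseteq> B - C" "?I \<subseteq> B - C" by auto
  have "1 * card (quints E) = 2 * card (quints E')"
    using eqs(1) sum_quints[OF sub(1), of E 1, OF quints_Int(1)] sum_quints[OF sub(1), of E' 2, OF E'(2)]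
    by (simp only:)
  moreover have "2 * card (quints E) = 1 * card (quints E')"
    using eqs(2) sum_quints[OF sub(2), of E 2, OF quints_Int(2)] sum_quints[OF sub(2), of E' 1, OF E'(1)]
    by (simp only:)
  ultimately have "card (quints E) = 0" "card (quints E') = 0" by linarith+
  then show "quints E = {}" "quints E' = {}" using finite_quints card_0_eq by blast+
qed

text \<open>A vertex of the 3-cycle lying in \<open>C\<close> would, like \<open>x\<close>, dominate
  its own predecessor. So the cycle avoids \<open>C\<close> and \<open>out_acyclic\<close>
  applies.\<close>

lemma diamond_apex:
  assumes V: "a \<in> B" "b \<in> B" "d \<in> B" and cy: "cyc E a b d" and out: "E x a" "E x b" "E x d"
  shows False
proof -
  have *: "p \<notin> C" if "p \<in> B" "q \<in> B" "r \<in> B" "cyc E p q r" "E x r" for p q r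
  proof
    assume p: "p \<in> C"
    have "r \<notin> C" using C_cycle[OF p _ _ that(4)] that BV by blast
    then have "E p r" using C_uniform(2)[of r x p] p xx(1) that BV by blast
    then show False using that(4) tour_asym[OF tB(1) that(1,3)] by (simp add: cyc_def)
  qed
  have "a \<notin> C" "b \<notin> C" "d \<notin> C"
    using *[OF V cy out(3)] *[OF V(2,3,1) cyc_rot[OF cy] out(1)]
      *[OF V(3,1,2) cyc_rot[OF cyc_rot[OF cy]] out(2)] by auto
  then show False using out_acyclic[of a b d] V cy out by blast
qed

text \<open>Adding the twin \<open>x'\<close> would turn this diamond into a copy of the five-vertex
  tournament, excluded by \<open>no_quints\<close>.\<close>

lemma diamond_rim:
  assumes V: "a \<in> B" "b \<in> B" "d \<in> B" and cy: "cyc E x b d" and out: "E a x" "E a b" "E a d"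
  shows False
proof -
  have xB: "x \<in> B" "x' \<in> B" using xx C(1) by auto
  have V': "a \<in> V" "b \<in> V" "d \<in> V" using V BV by auto
  have arcs: "E x b" "E b d" "E d x" using cy by (auto simp: cyc_def)
  have bd: "b \<notin> C" "d \<notin> C" using C_cycle[OF xx(1) V'(2,3) cy] by auto
  have a: "a \<notin> C"
  proof
    assume "a \<in> C"
    then have "E x d" using C_uniform(2)[OF V'(3) bd(2) _ xx(1)] out(3) by blast
    then show False using arcs(3) tour_asym[OF tB(1) xB(1) V(3)] by blast
  qed
  have "E a x'" "E x' b" "E d x'"
    using C_uniform[OF V'(1) a xx(1,2)] C_uniform[OF V'(2) bd(1) xx(1,2)]
      C_uniform[OF V'(3) bd(2) xx(1,2)] arcs out by auto
  then have "quint E a x x' b d" unfolding quint_def using arcs out by blast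
  then have "{a, x, x', b, d} \<in> quints E" unfolding quints_def using V xB by blast
  then show False using no_quints(1) by simp
qed

lemma no_diamond_at:
  assumes V: "p \<in> B" "q \<in> B" "r \<in> B" "s \<in> B" and x: "x \<in> {p, q, r, s}"
  shows "\<not> diamond E p q r s"
proof
  interpret S: twin_block V E' E B c C x x' by (rule twin_swap)
  assume d: "diamond E p q r s"
  have xB: "x \<in> B" using xx C(1) by auto
  have cy: "cyc E q r s" using d by (simp add: diamond_def)
  have cyc': "cyc E' a b e \<or> cyc E' a e b" if "a \<in> B" "b \<in> B" "e \<in> B" "cyc E a b e" for a b e
    using same_cyc[OF _ _ _ that(4)] that(1-3) BV by blast
  have rim: False if V: "a \<in> B" "b \<in> B" "e \<in> B" and dd: "diamond E a x b e" for a b e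
  proof -
    have cy: "cyc E x b e" using dd by (simp add: diamond_def)
    from dd consider "E a x" "E a b" "E a e" | "E x a" "E b a" "E e a" unfolding diamond_def by blast
    then show False
    proof cases
      case 1 then show False using diamond_rim[OF V cy] by blast
    next
      case 2
      have V': "a \<in> V" "b \<in> V" "e \<in> V" "x \<in> V" using V xB BV by auto
      have arcs: "E x b" "E b e" "E e x" using cy by (auto simp: cyc_def)
      have be: "b \<notin> C" "e \<notin> C" using C_cycle[OF xx(1) V'(2,3) cy] by auto
      have a: "a \<notin> C"
      proof
        assume "a \<in> C"
        then have "E a b" using C_uniform(2)[OF V'(2) be(1) xx(1)] arcs(1) by blast
        then show False using 2(2) tour_asym[OF tB(1) V(1,2)] by blast
      qed
      have "E' a x" "E' b x" "E' x e" using C_flip xx(1) V a be 2 arcs by blast+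
      \<comment> \<open>In \<open>E\<close> the vertex \<open>a\<close> is dominated by the whole
        cycle, so no 3-cycle passes through it here, and none does in \<open>E'\<close>. This forces
        \<open>a\<close> to dominate the reversed cycle in \<open>E'\<close>, where
        \<open>S.diamond_rim\<close> applies.\<close>
      have noE: "\<not> (cyc E u v w \<or> cyc E u w v) \<Longrightarrow> \<not> cyc E' u v w" if "u \<in> V" "v \<in> V" "w \<in> V" for u v w
        using same that unfolding same_cycles_def by blast
      have asym: "E u v \<Longrightarrow> \<not> E v u" if "u \<in> V" "v \<in> V" for u v using tour_asym[OF tE that] .
      have cy': "cyc E' x e b"
        using cyc'[OF xB V(2,3) cy] \<open>E' b x\<close> tour_asym[OF tE' V'(2,4)] unfolding cyc_def by blast
      have na: "\<not> E a x" "\<not> E a b" "\<not> E a e" using asym V' 2 by blast+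
      have "\<not> cyc E' a x e"
        by (rule noE) (use V' na in \<open>simp_all add: cyc_def\<close>)
      moreover have "a \<noteq> e" "a \<noteq> b" using 2 V' tour_irrefl[OF tE] by auto
      ultimately have ae: "E' a e"
        using \<open>E' a x\<close> \<open>E' x e\<close> tour_flip[OF tE' V'(1,3)] unfolding cyc_def by blast
      have "\<not> cyc E' a e b"
        by (rule noE) (use V' na in \<open>simp_all add: cyc_def\<close>)
      moreover have "E' e b" using cy' by (simp add: cyc_def)
      ultimately have "E' a b"
        using ae tour_flip[OF tE' V'(1,2) \<open>a \<noteq> b\<close>] unfolding cyc_def by blast
      then show False using S.diamond_rim[OF V(1,3,2) cy' \<open>E' a x\<close> ae] by blast
    qed
  qed
  consider "x = p" | "x = q" | "x = r" | "x = s" using x by blast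
  then show False
  proof cases
    case 1
    from d consider "E x q" "E x r" "E x s" | "E q x" "E r x" "E s x" unfolding diamond_def 1 by blast
    then show False
    proof cases
      case 1 then show False using diamond_apex[OF V(2-4) cy] by blast
    next
      case 2
      have n: "q \<notin> C" if "q \<in> B" "r \<in> B" "s \<in> B" "cyc E q r s" "E r x" for q r s
      proof
        assume q: "q \<in> C"
        have "r \<notin> C" using C_cycle[OF q _ _ that(4)] that BV by blast
        then have "E x r" using C_uniform(2)[of r x q] q xx(1) that BV unfolding cyc_def by blast
        then show False using that(5) tour_asym[OF tB(1) xB that(2)] by blast
      qed
      have "q \<notin> C" "r \<notin> C" "s \<notin> C"
        using n[OF V(2,3,4) cy 2(2)] n[OF V(3,4,2) cyc_rot[OF cy] 2(3)]
          n[OF V(4,2,3) cyc_rot[OF cyc_rot[OF cy]] 2(1)] by auto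
      then have "E' x q" "E' x r" "E' x s" using C_flip xx(1) V 2 by blast+
      then show False
        using cyc'[OF V(2-4) cy] S.diamond_apex[OF V(2,3,4)] S.diamond_apex[OF V(2,4,3)] by blast
    qed
  next
    case 2 then show False using rim[OF V(1,3,4)] d by blast
  next
    case 3 then show False using rim[OF V(1,4,2)] diamond_rot[OF d] by blast
  next
    case 4 then show False using rim[OF V(1,2,3)] diamond_rot[OF diamond_rot[OF d]] by blast
  qed
qed

lemma block_diamond_free: "diamond_free B E"
  by (rule diamond_spread[OF tB(1), of x]) (use xx C(1) no_diamond_at in blast)+

end

section \<open>Cyclic sequences with palindromic deletions\<close>

lemma not_dvd_small: "- L < m \<Longrightarrow> m < L \<Longrightarrow> m \<noteq> 0 \<Longrightarrow> \<not> L dvd m" for L m :: int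
  using dvd_imp_le_int[of m L] by auto

text \<open>The induction that arises from two reflections with centres at distance 2, whose
  composition is a shift by 4.\<close>

lemma odd_upto:
  fixes k L :: int
  assumes step: "\<And>k. 1 \<le> k \<Longrightarrow> k \<le> L - 6 \<Longrightarrow> P k \<Longrightarrow> P (k + 4)" and "P 1" "P 3"
    and k: "odd k" "1 \<le> k" "k \<le> L - 2"
  shows "P k"
  using k
proof (induction "nat k" arbitrary: k rule: less_induct)
  case less
  show ?case
  proof (cases "k < 5")
    case True
    then have "k = 1 \<or> k = 2 \<or> k = 3 \<or> k = 4" using less.prems by auto
    then show ?thesis using less.prems assms(2,3) by auto
  next
    case False
    then have "k = 5 \<or> k \<ge> 6" by auto
    then have "P (k - 4)" using less.prems assms(2) by (auto intro!: less.hyps)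
    then show ?thesis using step[of "k - 4"] less.prems False by simp
  qed
qed

lemma step2_upto:
  fixes a b k :: int
  assumes step: "\<And>k. a \<le> k \<Longrightarrow> k + 2 \<le> b \<Longrightarrow> P k \<Longrightarrow> P (k + 2)" and "P a" "P (a + 1)"
    and k: "a \<le> k" "k \<le> b"
  shows "P k"
  using k
proof (induction "nat (k - a)" arbitrary: k rule: less_induct)
  case less
  show ?case
  proof (cases "k < a + 2")
    case True
    then have "k = a \<or> k = a + 1" using less.prems by auto
    then show ?thesis using assms(2,3) by auto
  next
    case False
    then have "P (k - 2)" using less.prems by (intro less.hyps) auto
    then show ?thesis using step[of "k - 2"] less.prems False by simp
  qed
qed

text \<open>Fibre sizes around the cycle \<open>\<int>/L\<close>.\<close>

locale cyclic_sizes =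
  fixes u :: "int \<Rightarrow> nat" and L :: int
  assumes odd_L: "odd L" and L3: "L \<ge> 3" and per: "u (t + L) = u t" and pos: "u t \<ge> 1"
begin

definition palindromic :: bool where
  "palindromic \<longleftrightarrow> (\<exists>c. \<forall>t. u (c - t) = u t)"

text \<open>Decreasing the size at \<open>x\<close> by one makes the sizes symmetric about \<open>c/2\<close>.\<close>

definition defect :: "int \<Rightarrow> int \<Rightarrow> bool" where
  "defect x c \<longleftrightarrow> u (c - x) + 1 = u x \<and> (\<forall>t. \<not> L dvd t - x \<longrightarrow> \<not> L dvd c - t - x \<longrightarrow> u (c - t) = u t)"

lemma per_mult: "u (t + L * k) = u t"
proof (induction k rule: int_induct[where k = 0])
  case (step1 i)
  have "u (t + L * (i + 1)) = u ((t + L * i) + L)" by (simp add: algebra_simps)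
  then show ?case using step1(2) by (simp add: per)
next
  case (step2 i)
  have "u (t + L * i) = u ((t + L * (i - 1)) + L)" by (simp add: algebra_simps)
  then show ?case using step2(2) by (simp add: per)
qed simp

lemma u_cong: "L dvd a - b \<Longrightarrow> u a = u b"
  using per_mult[of b] by (auto elim!: dvdE simp: algebra_simps)

lemma dvd_double: "L dvd 2 * m \<Longrightarrow> L dvd m"
  using odd_L coprime_dvd_mult_right_iff[of L 2 m] by simp

lemma dvd_diff_trans: "L dvd a - b \<Longrightarrow> L dvd b - c \<Longrightarrow> L dvd a - c"
  using dvd_add[of L "a - b" "b - c"] by simp

lemma dvd_diff_sym: "L dvd a - b \<Longrightarrow> L dvd b - a"
  using dvd_minus_iff[of L "a - b"] by simp

lemma dvd_common: "L dvd a - c \<Longrightarrow> L dvd b - c \<Longrightarrow> L dvd a - b"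
  using dvd_diff[of L "a - c" "b - c"] by simp

text \<open>If the reflection fixed \<open>x\<close> modulo \<open>L\<close>, the decrement would
  itself be symmetric and the sequence a palindrome. Truncated subtraction is harmless because all
  sizes are positive.\<close>

lemma defect_exists:
  assumes np: "\<not> palindromic" and
    c: "\<forall>t. u (c - t) - of_bool (L dvd c - t - x) = u t - of_bool (L dvd t - x)"
  shows "defect x c"
proof -
  have eq: "L dvd c - t - x \<longleftrightarrow> L dvd t - x" if "L dvd c - x - x" for t
  proof -
    have "c - t - x = (c - x - x) - (t - x)" by simp
    then show ?thesis using that by (metis dvd_diff_right_iff)
  qed
  have ndvd: "\<not> L dvd c - x - x"
  proof
    assume d: "L dvd c - x - x"
    have "u (c - t) = u t" for t
    proof (cases "L dvd t - x")
      case True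
      have "c - t - t = (c - x - x) - 2 * (t - x)" by simp
      then have "L dvd (c - t) - t" using d True by (metis dvd_diff dvd_mult)
      then show ?thesis by (rule u_cong)
    next
      case False
      then show ?thesis using spec[OF c, of t] eq[OF d, of t] by simp
    qed
    then show False using np unfolding palindromic_def by blast
  qed
  have "u (c - x) + 1 = u x" using spec[OF c, of x] ndvd pos[of x] by simp
  moreover have "u (c - t) = u t" if "\<not> L dvd t - x" "\<not> L dvd c - t - x" for t
    using spec[OF c, of t] that by simp
  ultimately show ?thesis unfolding defect_def by blast
qed

text \<open>The axis determines the position: \<open>x\<close> is the only one, modulo
  \<open>L\<close>, whose mirror image has a smaller size.\<close>

lemma defect_distinct:
  assumes R: "defect x c" "defect x' c'" and ne: "\<not> L dvd x - x'"
  shows "\<not> L dvd c - c'"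
proof
  assume d: "L dvd c - c'"
  have ux: "u (c - x) + 1 = u x" and ux': "u (c' - x') + 1 = u x'" using R unfolding defect_def by auto
  have e: "u (c - x') = u (c' - x')" by (rule u_cong) (use d in simp)
  have "\<not> L dvd x' - x" using ne dvd_diff_sym by blast
  show False
  proof (cases "L dvd c - x' - x")
    case True
    have "u (c - x') = u x" by (rule u_cong) (rule True)
    moreover have "u (c - x) = u x'" by (rule u_cong) (use True in \<open>simp add: algebra_simps\<close>)
    ultimately show False using ux ux' e by simp
  next
    case False
    then have "u (c - x') = u x'" using R(1) \<open>\<not> L dvd x' - x\<close> unfolding defect_def by blast
    then show False using e ux' by simp
  qed
qed

text \<open>Two defects at sizes at least 3 would make the set of positions of size 1 periodic, which
  the defect at a position of size 2 does not allow.\<close>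

lemma large_unique:
  assumes R: "defect x c" "defect x' c'" "defect y d" and big: "u x \<ge> 3" "u x' \<ge> 3" and y: "u y = 2"
  shows "L dvd x - x'"
proof (rule ccontr)
  assume ne: "\<not> L dvd x - x'"
  have inv: "u (c - t) = 1 \<longleftrightarrow> u t = 1" if "defect x c" "u x \<ge> 3" for x c t
  proof -
    consider "L dvd t - x" | "L dvd c - t - x" | "\<not> L dvd t - x" "\<not> L dvd c - t - x" by blast
    then show ?thesis
    proof cases
      case 1
      have "u t = u x" by (rule u_cong[OF 1])
      moreover have "u (c - t) = u (c - x)"
        by (rule u_cong) (use dvd_diff_sym[OF 1] in \<open>simp add: algebra_simps\<close>)
      ultimately show ?thesis using that unfolding defect_def by auto
    next
      case 2
      have "u (c - t) = u x" by (rule u_cong[OF 2])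
      moreover have "u t = u (c - x)"
        by (rule u_cong) (use dvd_diff_sym[OF 2] in \<open>simp add: algebra_simps\<close>)
      ultimately show ?thesis using that unfolding defect_def by auto
    next
      case 3
      then show ?thesis using that(1) unfolding defect_def by auto
    qed
  qed
  have shift: "u (t + (c - c')) = 1 \<longleftrightarrow> u t = 1" for t
    using inv[OF R(1) big(1), of "c' - t"] inv[OF R(2) big(2), of t] by (simp add: algebra_simps)
  define e where "e = c - c'"
  have e: "\<not> L dvd e" using defect_distinct[OF R(1,2) ne] unfolding e_def .
  have dy: "u (d - y) = 1" using R(3) y unfolding defect_def by auto
  have 1: "u (y + e) \<noteq> 1" using shift[of y] y unfolding e_def by simp
  have "u (d - (y + e)) = 1"
    using shift[of "d - (y + e)"] dy unfolding e_def by (simp add: algebra_simps)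
  then have "L dvd (y + e) - y \<or> L dvd d - (y + e) - y"
    using R(3) 1 unfolding defect_def by metis
  moreover have "\<not> L dvd (y + e) - y" using e by simp
  ultimately have "L dvd (d - y) - (y + e)" by (simp add: algebra_simps)
  then have "u (d - y) = u (y + e)" by (rule u_cong)
  then show False using 1 dy by simp
qed

text \<open>\<open>merge\<close> reflects the deletion of a fibre of size 1: its neighbours fuse
  into the strictly largest fibre, which any reflection must fix, so sizes are symmetric about
  \<open>z\<close> except perhaps at \<open>z - 1\<close> and \<open>z + 1\<close>. If
  \<open>x, x + 1\<close> have sizes 2, 1, the next size must be 1, and composing two such
  reflections leaves only 2, 1, ..., 1 and 1, 1, 2, ..., 2, both palindromes.\<close>

lemma sizes_le_2_palindromic:
  assumes le2: "\<And>t. u t \<le> 2"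
    and merge: "\<And>z s. \<lbrakk>L \<ge> 5; u z = 1; \<And>t. u t < u (z - 1) + u (z + 1); \<not> L dvd s - 1; \<not> L dvd s + 1\<rbrakk>
      \<Longrightarrow> u (z + s) = u (z - s)"
  shows palindromic
proof (rule ccontr)
  assume np: "\<not> palindromic"
  have u12: "u t = 1 \<or> u t = 2" for t using pos[of t] le2[of t] by linarith
  have npal: "\<exists>t. u (c - t) \<noteq> u t" for c using np unfolding palindromic_def by blast
  have "\<exists>x. u x = 2 \<and> u (x + 1) = 1"
  proof (rule ccontr)
    assume neg: "\<not> ?thesis"
    have step: "u (x + int n) = 2" if "u x = 2" for x n
    proof (induction n)
      case (Suc n)
      have "u ((x + int n) + 1) \<noteq> 1" using neg Suc by blast
      then show ?case using u12[of "x + int n + 1"] by (simp add: algebra_simps)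
    qed (use that in simp)
    have "u t = u s" for s t
    proof -
      have all: "u t = 2" if "u s = 2" for s t
      proof -
        have "u (s + (t - s) mod L) = 2"
          using step[OF that, of "nat ((t - s) mod L)"] L3 by simp
        moreover have "L dvd t - (s + (t - s) mod L)"
          using dvd_minus_mod[of L "t - s"] by (simp add: algebra_simps)
        ultimately show ?thesis using u_cong by metis
      qed
      show ?thesis using all[of s t] all[of t s] u12[of s] u12[of t] by metis
    qed
    then show False using npal by blast
  qed
  then obtain x where x: "u x = 2" "u (x + 1) = 1" by blast
  show False
  proof (cases "L = 3")
    case True
    have um: "u t = u (t mod 3)" for t by (rule u_cong) (simp add: True)
    have "u 0 = u 1 \<or> u 1 = u 2 \<or> u 0 = u 2" using u12[of 0] u12[of 1] u12[of 2] by auto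
    then obtain c :: int where c: "c = 1 \<and> u 0 = u 1 \<or> c = 3 \<and> u 1 = u 2 \<or> c = 2 \<and> u 0 = u 2" by blast
    have "u (c - t) = u t" for t
    proof -
      have "t mod 3 = 0 \<or> t mod 3 = 1 \<or> t mod 3 = 2" by presburger
      moreover have "(c - t) mod 3 = (c - t mod 3) mod 3" by (simp add: mod_diff_right_eq)
      ultimately show ?thesis using um[of t] um[of "c - t"] c by auto
    qed
    then show False using npal by blast
  next
    case False
    then have L5: "L \<ge> 5" using L3 odd_L by presburger
    have merge2: "u (z + s) = u (z - s)"
      if "u z = 1" "u (z - 1) = 2 \<or> u (z + 1) = 2" "\<not> L dvd s - 1" "\<not> L dvd s + 1" for z s
    proof (rule merge[OF L5 that(1) _ that(3,4)])
      fix t show "u t < u (z - 1) + u (z + 1)"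
        using le2[of t] pos[of "z - 1"] pos[of "z + 1"] that(2) by auto
    qed
    have swap: "\<exists>s. (L dvd s - 1 \<or> L dvd s + 1) \<and> u (z + s) \<noteq> u (z - s)"
      if "u z = 1" "u (z - 1) = 2 \<or> u (z + 1) = 2" for z
    proof -
      obtain t where t: "u (2 * z - t) \<noteq> u t" using npal by blast
      have "u (z + (z - t)) \<noteq> u (z - (z - t))" using t by (simp add: algebra_simps)
      then show ?thesis using merge2[OF that] by blast
    qed
    have other: "u (z - 1) \<noteq> u (z + 1)" if z: "u z = 1" "u (z - 1) = 2 \<or> u (z + 1) = 2" for z
    proof
      assume eq: "u (z - 1) = u (z + 1)"
      obtain s where s: "L dvd s - 1 \<or> L dvd s + 1" "u (z + s) \<noteq> u (z - s)" using swap[OF z] by blast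
      from s(1) show False
      proof
        assume d: "L dvd s - 1"
        have "u (z + s) = u (z + 1)" by (rule u_cong) (use d in simp)
        moreover have "u (z - s) = u (z - 1)"
          by (rule u_cong) (use dvd_diff_sym[OF d] in simp)
        ultimately show False using eq s(2) by simp
      next
        assume d: "L dvd s + 1"
        have "- s - 1 = - (s + 1)" by simp
        then have d': "L dvd - s - 1" using d dvd_minus_iff by metis
        have "u (z + s) = u (z - 1)" by (rule u_cong) (use d in simp)
        moreover have "u (z - s) = u (z + 1)" by (rule u_cong) (use d' in simp)
        ultimately show False using eq s(2) by simp
      qed
    qed
    have x2: "u (x + 2) = 1" using other[of "x + 1"] x u12[of "x + 2"] by (auto simp: algebra_simps)
    have M1: "u (x + k) = u (x + 2 - k)" if "\<not> L dvd k - 2" "\<not> L dvd k" for k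
      using merge2[of "x + 1" "k - 1"] x that by (simp add: algebra_simps)
    show False
    proof (cases "u (x - 1) = 1")
      case True
      \<comment> \<open>Composed with the reflection about \<open>x + 1\<close> this gives a shift
        by 4. Odd offsets on both sides of \<open>x\<close> cover all nonzero residues, as
        \<open>L\<close> is odd.\<close>
      have M2: "u (x + k) = u (x - 2 - k)" if "\<not> L dvd k" "\<not> L dvd k + 2" for k
        using merge2[of "x - 1" "k + 1"] x True that by (simp add: algebra_simps)
      have odd1: "u (x + k) = 1" if "odd k" "1 \<le> k" "k \<le> L - 2" for k
      proof (rule odd_upto[where P = "\<lambda>k. u (x + k) = 1", OF _ _ _ that])
        fix k assume k: "1 \<le> k" "k \<le> L - 6" "u (x + k) = 1"
        have "u (x + k) = u (x - 2 - k)" by (rule M2; rule not_dvd_small) (use k in simp_all)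
        moreover have "\<not> L dvd (- 2 - k) - 2"
          by (rule not_dvd_small) (use k in simp_all)
        moreover have "\<not> L dvd - 2 - k"
          by (rule not_dvd_small) (use k in simp_all)
        ultimately show "u (x + (k + 4)) = 1"
          using M1[of "- 2 - k"] k(3) by (simp add: algebra_simps)
      next
        show "u (x + 1) = 1" by (rule x(2))
        have "\<not> L dvd (3::int)" "\<not> L dvd (1::int)" using not_dvd_small[of L] L5 by auto
        then show "u (x + 3) = 1" using M1[of 3] L5 True x by (simp add: algebra_simps)
      qed
      have odd2: "u (x - k) = 1" if "odd k" "1 \<le> k" "k \<le> L - 2" for k
      proof (rule odd_upto[where P = "\<lambda>k. u (x - k) = 1", OF _ _ _ that])
        fix k assume k: "1 \<le> k" "k \<le> L - 6" "u (x - k) = 1"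
        have "\<not> L dvd - k - 2" "\<not> L dvd - k"
          by (rule not_dvd_small; use k in simp)+
        then have "u (x - k) = u (x + 2 + k)" using M1[of "- k"] by simp
        moreover have "\<not> L dvd 2 + k" "\<not> L dvd 2 + k + 2" by (rule not_dvd_small; use k in simp)+
        ultimately show "u (x - (k + 4)) = 1"
          using M2[of "2 + k"] k(3) by (simp add: algebra_simps)
      next
        show "u (x - 1) = 1" by (rule True)
        have "\<not> L dvd (3::int)" "\<not> L dvd (1::int)" using not_dvd_small[of L] L5 by auto
        then show "u (x - 3) = 1" using M2[of 1] x by simp
      qed
      have one: "u (x + k) = 1" if nd: "\<not> L dvd k" for k
      proof -
        define m where "m = k mod L"
        have "m \<noteq> 0" using nd unfolding m_def by (simp add: dvd_eq_mod_eq_0)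
        then have m: "1 \<le> m" "m \<le> L - 1"
          using pos_mod_bound[of L k] pos_mod_sign[of L k] L3 unfolding m_def by linarith+
        have um: "u (x + k) = u (x + m)" by (rule u_cong) (simp add: m_def)
        show ?thesis
        proof (cases "odd m")
          case True
          then have "m \<noteq> L - 1" using odd_L by auto
          then show ?thesis using odd1[of m] True m um by simp
        next
          case False
          then have "u (x - (L - m)) = 1" using m odd_L by (intro odd2) auto
          moreover have "u (x + m) = u (x - (L - m))" by (rule u_cong) simp
          ultimately show ?thesis using um by simp
        qed
      qed
      have "u (2 * x - t) = u t" for t
      proof (cases "L dvd t - x")
        case True
        have "2 * x - t - t = (t - x) * (- 2)" by simp
        then have "L dvd 2 * x - t - t" using dvd_mult2[OF True, of "- 2"] by metis
        then show ?thesis by (rule u_cong)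
      next
        case False
        then have "\<not> L dvd x - t" using dvd_diff_sym by blast
        then show ?thesis using one[of "t - x"] one[of "x - t"] False by (simp add: algebra_simps)
      qed
      then show False using npal by blast
    next
      case False
      then have xm1: "u (x - 1) = 2" using u12[of "x - 1"] by auto
      have "\<not> L dvd (3::int)" "\<not> L dvd (1::int)" using not_dvd_small[of L] L5 by auto
      then have x3: "u (x + 3) = 2" using M1[of 3] xm1 by simp
      \<comment> \<open>Here the centres are \<open>x + 1\<close> and \<open>x + 2\<close>, so the
        composition is a shift by 2.\<close>
      have M3: "u (x + k) = u (x + 4 - k)" if "\<not> L dvd k - 3" "\<not> L dvd k - 1" for k
        using merge2[of "x + 2" "k - 2"] x2 x3 that by (simp add: algebra_simps)
      have two: "u (x + k) = 2" if "3 \<le> k" "k \<le> L" for k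
      proof (rule step2_upto[where P = "\<lambda>k. u (x + k) = 2", OF _ _ _ that])
        fix k assume k: "3 \<le> k" "k + 2 \<le> L" "u (x + k) = 2"
        have "\<not> L dvd k - 2" "\<not> L dvd k" by (rule not_dvd_small; use k in simp)+
        then have "u (x + k) = u (x + 2 - k)" by (rule M1)
        moreover have "\<not> L dvd (2 - k) - 3" "\<not> L dvd (2 - k) - 1"
          by (rule not_dvd_small; use k in simp)+
        ultimately show "u (x + (k + 2)) = 2"
          using M3[of "2 - k"] k(3) by (simp add: algebra_simps)
      next
        show "u (x + 3) = 2" by (rule x3)
        show "u (x + (3 + 1)) = 2"
          using M3[of 0] x(1) \<open>\<not> L dvd 3\<close> \<open>\<not> L dvd 1\<close> by simp
      qed
      \<comment> \<open>The axis lies midway between the two ones, at \<open>x + 1\<close> and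
        \<open>x + 2\<close>.\<close>
      have "u (2 * x + 3 - t) = u t" for t
      proof -
        define m where "m = (t - x) mod L"
        have m: "0 \<le> m" "m < L" using L3 unfolding m_def by auto
        have dm: "L dvd (t - x) - m" unfolding m_def by simp
        have ut: "u t = u (x + m)" by (rule u_cong) (use dm in \<open>simp add: algebra_simps\<close>)
        have uc: "u (2 * x + 3 - t) = u (x + 3 - m)"
          by (rule u_cong) (use dvd_diff_sym[OF dm] in \<open>simp add: algebra_simps\<close>)
        consider "m = 0" | "m = 1" | "m = 2" | "m = 3" | "m \<ge> 4" using m by linarith
        then show ?thesis
        proof cases
          case 5
          have "u (x + 3 - m) = u (x + (L + 3 - m))" by (rule u_cong) simp
          then show ?thesis using two[of m] two[of "L + 3 - m"] m 5 ut uc by simp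
        qed (use ut uc x x2 x3 in \<open>simp_all add: add.commute\<close>)
      qed
      then show False using npal by blast
    qed
  qed
qed

text \<open>A counterexample would have one 3, at \<open>a\<close>, one 2, at \<open>b\<close>, and
  ones elsewhere. The sum excludes \<open>L = 3\<close>, where it would be 6. For
  \<open>L \<ge> 5\<close>, a size-1 neighbour of \<open>a\<close> forces \<open>b\<close> to lie at
  distance 2 from \<open>a\<close> on that side; whether or not \<open>b\<close> is a neighbour of
  \<open>a\<close>, this is impossible.\<close>

lemma palindromicI:
  assumes sum: "(\<Sum>t\<in>{0..<L}. u t) \<ge> 7"
    and del: "\<And>x. u x \<ge> 2 \<Longrightarrow>
      \<exists>c. \<forall>t. u (c - t) - of_bool (L dvd c - t - x) = u t - of_bool (L dvd t - x)"
    and merge: "\<And>z s. \<lbrakk>L \<ge> 5; u z = 1; \<And>t. u t < u (z - 1) + u (z + 1); \<not> L dvd s - 1; \<not> L dvd s + 1\<rbrakk>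
      \<Longrightarrow> u (z + s) = u (z - s)"
  shows palindromic
proof (rule ccontr)
  assume np: "\<not> palindromic"
  have def: "\<exists>c. defect x c" if "u x \<ge> 2" for x
    using del[OF that] defect_exists[OF np] by blast
  have "\<exists>a. u a \<ge> 3"
  proof (rule ccontr)
    assume neg: "\<not> ?thesis"
    have "u t \<le> 2" for t using neg by (metis not_less_eq_eq numeral_2_eq_2 numeral_3_eq_3)
    then have palindromic by (rule sizes_le_2_palindromic) (rule merge)
    then show False using np by simp
  qed
  then obtain a where a: "u a \<ge> 3" by blast
  have two: "\<exists>y. u y = 2"
  proof -
    \<comment> \<open>The least size that is at least 2 has a defect, and so a position smaller by
      one; it must be 2.\<close>
    define m where "m = (LEAST k. k \<ge> 2 \<and> (\<exists>x. u x = k))"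
    have ex: "u a \<ge> 2 \<and> (\<exists>x. u x = u a)" using a by auto
    have m: "m \<ge> 2" "\<exists>x. u x = m"
      using LeastI[of "\<lambda>k. k \<ge> 2 \<and> (\<exists>x. u x = k)", OF ex] unfolding m_def by auto
    then obtain x where x: "u x = m" by blast
    obtain c where "defect x c" using def m(1) x by blast
    then have "u (c - x) = m - 1" using x unfolding defect_def by auto
    then have "\<not> m - 1 \<ge> 2" using not_less_Least[of "m - 1" "\<lambda>k. k \<ge> 2 \<and> (\<exists>x. u x = k)"] m(1)
      unfolding m_def[symmetric] by auto
    then have "m = 2" using m(1) by linarith
    then show ?thesis using x by blast
  qed
  then obtain y0 d0 where y0: "u y0 = 2" "defect y0 d0" using def by fastforce
  have uniq3: "L dvd x - a" if big: "u x \<ge> 3" for x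
  proof -
    obtain c where "defect x c" using def[of x] big by auto
    moreover obtain c' where "defect a c'" using def[of a] a by auto
    ultimately show ?thesis using large_unique y0 big a by blast
  qed
  obtain ca where ca: "defect a ca" using def a by fastforce
  \<comment> \<open>The mirror image of \<open>a\<close> has size \<open>u a - 1 \<ge> 2\<close>.
    Sizes of at least 3 occur at \<open>a\<close> only, so this pins down 2 and 3.\<close>
  define b where "b = ca - a"
  have ub: "u b + 1 = u a" using ca unfolding defect_def b_def by blast
  have nba: "\<not> L dvd b - a" using u_cong[of b a] ub by auto
  have ub2: "u b = 2" and ua: "u a = 3" using uniq3[of b] nba ub a by linarith+
  have le3: "u t \<le> 3" for t using uniq3[of t] u_cong[of t a] ua by (cases "u t \<ge> 3") auto
  have uniq2: "L dvd x - b" if x: "u x = 2" for x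
  proof (rule ccontr)
    assume ne: "\<not> L dvd x - b"
    \<comment> \<open>The reflection of a defect at a 2 must fix the only 3. Two such positions
      would share this axis, contrary to \<open>defect_distinct\<close>.\<close>
    have centre: "L dvd c - 2 * a" if "defect x c" "u x = 2" for x c
    proof -
      have "\<not> L dvd a - x" using u_cong[of a x] ua that(2) by auto
      moreover have "\<not> L dvd c - a - x"
      proof
        assume "L dvd c - a - x"
        then have "L dvd (c - x) - a" by (simp add: algebra_simps)
        then have "u (c - x) = 3" using u_cong ua by metis
        then show False using that unfolding defect_def by simp
      qed
      ultimately have "u (c - a) = u a" using that(1) unfolding defect_def by blast
      then have "u (c - a) \<ge> 3" using ua by simp
      then have "L dvd (c - a) - a" by (rule uniq3)
      moreover have "c - 2 * a = (c - a) - a" by simp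
      ultimately show ?thesis by (simp only:)
    qed
    obtain c c' where R: "defect x c" "defect b c'" using def x ub2 by fastforce
    have "L dvd c - c'"
      using dvd_diff_trans[OF centre[OF R(1) x] dvd_diff_sym[OF centre[OF R(2) ub2]]] .
    then show False using defect_distinct[OF R ne] by simp
  qed
  have L5: "L \<ge> 5"
  proof (rule ccontr)
    assume "\<not> L \<ge> 5"
    then have L: "L = 3" using L3 odd_L by presburger
    have "{0..<L} = {0, 1, 2}" unfolding L by auto
    then have sum3: "u 0 + (u 1 + u 2) \<ge> 7" using sum by simp
    have nd: "\<not> L dvd 0 - 1" "\<not> L dvd 0 - 2" "\<not> L dvd 1 - 2" unfolding L by auto
    have n3: "\<not> (u s = 3 \<and> u t = 3)" if "\<not> L dvd s - t" for s t
      using dvd_common[OF uniq3[of s] uniq3[of t]] that by auto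
    have n2: "\<not> (u s = 2 \<and> u t = 2)" if "\<not> L dvd s - t" for s t
      using dvd_common[OF uniq2[of s] uniq2[of t]] that by auto
    show False
      using sum3 n3[OF nd(1)] n3[OF nd(2)] n3[OF nd(3)] n2[OF nd(1)] n2[OF nd(2)] n2[OF nd(3)]
        le3[of 0] le3[of 1] le3[of 2] by arith
  qed
  have small: "\<not> L dvd (1::int)" "\<not> L dvd (2::int)" "\<not> L dvd (3::int)" "\<not> L dvd (4::int)"
    using not_dvd_small[of L] L5 by auto
  have u1: "u t = 1" if "\<not> L dvd t - a" "\<not> L dvd t - b" for t
  proof -
    have "u t \<noteq> 3" "u t \<noteq> 2" using uniq3[of t] uniq2[of t] that by auto
    then show ?thesis using le3[of t] pos[of t] by arith
  qed
  \<comment> \<open>Unless \<open>b\<close> is adjacent to \<open>z\<close>, the reflection about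
    \<open>z\<close> preserves the only 2, forcing \<open>b\<close> to be \<open>z\<close> modulo
    \<open>L\<close>. Hence \<open>a\<close> and \<open>b\<close> are the two neighbours of
    \<open>z\<close>.\<close>
  have sym: "L dvd b - (2 * z - a)" if uz: "u z = 1" and za: "L dvd z - 1 - a \<or> L dvd z + 1 - a" for z
  proof -
    have "u (z - 1) = 3 \<or> u (z + 1) = 3" using za u_cong ua by metis
    then have big: "u t < u (z - 1) + u (z + 1)" for t
      using le3[of t] pos[of "z - 1"] pos[of "z + 1"] by auto
    have bz: "\<not> L dvd b - z" using u_cong[of b z] uz ub2 by auto
    have "L dvd (b - z) - 1 \<or> L dvd (b - z) + 1"
    proof (rule ccontr)
      assume neg: "\<not> ?thesis"
      then have "u (z + (b - z)) = u (z - (b - z))" using merge[OF L5 uz big] by blast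
      then have "L dvd (z - (b - z)) - b" using ub2 by (intro uniq2) simp
      then have "L dvd 2 * (z - b)" by (simp add: algebra_simps)
      then show False using dvd_double dvd_diff_sym bz by blast
    qed
    then show ?thesis
    proof
      assume 1: "L dvd (b - z) - 1"
      from za show ?thesis
      proof
        assume 2: "L dvd z - 1 - a"
        have "b - (2 * z - a) = ((b - z) - 1) - (z - 1 - a)" by simp
        then show ?thesis using dvd_diff[OF 1 2] by (simp only:)
      next
        assume 2: "L dvd z + 1 - a"
        have "b - a = ((b - z) - 1) + (z + 1 - a)" by simp
        then show ?thesis using dvd_add[OF 1 2] nba by argo
      qed
    next
      assume 1: "L dvd (b - z) + 1"
      from za show ?thesis
      proof
        assume 2: "L dvd z - 1 - a"
        have "b - a = ((b - z) + 1) + (z - 1 - a)" by simp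
        then show ?thesis using dvd_add[OF 1 2] nba by argo
      next
        assume 2: "L dvd z + 1 - a"
        have "b - (2 * z - a) = ((b - z) + 1) - (z + 1 - a)" by simp
        then show ?thesis using dvd_diff[OF 1 2] by (simp only:)
      qed
    qed
  qed
  have R: "L dvd b - (a + 2)" if "\<not> L dvd a + 1 - b"
    using sym[of "a + 1"] u1[of "a + 1"] that small by (simp add: algebra_simps)
  have "\<not> L dvd (a - 1) - a" using small(1) by simp
  then have Lf: "L dvd b - (a - 2)" if "\<not> L dvd a - 1 - b"
    using sym[of "a - 1"] u1[of "a - 1"] that by (simp add: algebra_simps)
  show False
  proof (cases "L dvd a + 1 - b")
    case True
    have "\<not> L dvd a - 1 - b"
    proof
      assume "L dvd a - 1 - b"
      then have "L dvd (a + 1 - b) - (a - 1 - b)" using True dvd_diff by blast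
      then show False using small by simp
    qed
    then have "L dvd (a + 1 - b) + (b - (a - 2))" using Lf True dvd_add by blast
    then show False using small by simp
  next
    case F1: False
    show False
    proof (cases "L dvd a - 1 - b")
      case True
      have "L dvd (a - 1 - b) + (b - (a + 2))" using R[OF F1] True dvd_add by blast
      then have "L dvd - 3" by simp
      then show False using small dvd_minus_iff by blast
    next
      case False
      have "L dvd (b - (a - 2)) - (b - (a + 2))" using R[OF F1] Lf[OF False] dvd_diff by blast
      then show False using small by simp
    qed
  qed
qed

end

section \<open>Tournaments without diamonds\<close>

text \<open>Blow-ups of the rotational tournament on \<open>\<int>/L\<close>, \<open>L\<close> odd, in which \<open>i\<close> dominates
  \<open>i + 2, i + 4, \<dots>, i + L - 1\<close>, by chains.\<close>

definition model :: "'a set \<Rightarrow> ('a \<Rightarrow> 'a \<Rightarrow> bool) \<Rightarrow> int \<Rightarrow> ('a \<Rightarrow> int) \<Rightarrow> bool" where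
  "model V E L r \<longleftrightarrow> odd L \<and> L \<ge> 3 \<and> r ` V = {0..<L} \<and>
     (\<forall>v\<in>V. \<forall>w\<in>V. r v \<noteq> r w \<longrightarrow> (E v w \<longleftrightarrow> even ((r w - r v) mod L))) \<and>
     (\<forall>k. cycle_free {v\<in>V. r v = k} E)"

lemma mod_diff_cases:
  fixes a b L :: int
  assumes "0 \<le> a" "a < L" "0 \<le> b" "b < L"
  shows "(a - b) mod L = (if b \<le> a then a - b else a - b + L)"
proof (cases "b \<le> a")
  case True then show ?thesis using assms by simp
next
  case False
  have "(a - b) mod L = (a - b + L) mod L" by simp
  also have "\<dots> = a - b + L" by (rule mod_pos_pos_trivial) (use False assms in simp_all)
  finally show ?thesis using False by simp
qed

text \<open>Undoing the switching turns a 3-cycle into a diamond with \<open>x\<close>: its apex is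
  \<open>x\<close> if all three vertices lie on one side of \<open>x\<close>, otherwise
  \<open>x\<close> is on the 3-cycle. Two of three vertices always share a side, so
  \<open>same\<close> is available up to rotation.\<close>

lemma switch_no_cycle_aux:
  assumes t: "tour V E" and df: "diamond_free V E" and V: "x \<in> V" "a \<in> V" "b \<in> V" "c \<in> V"
    and nx: "a \<noteq> x" "b \<noteq> x" "c \<noteq> x" and dist: "a \<noteq> b" "b \<noteq> c" "c \<noteq> a"
    and F: "E a b \<longleftrightarrow> (E x a \<longleftrightarrow> E x b)" "E b c \<longleftrightarrow> (E x b \<longleftrightarrow> E x c)" "E c a \<longleftrightarrow> (E x c \<longleftrightarrow> E x a)"
    and same: "E x a \<longleftrightarrow> E x b"
  shows False
proof -
  have flip: "E a x \<longleftrightarrow> \<not> E x a" "E b x \<longleftrightarrow> \<not> E x b" "E c x \<longleftrightarrow> \<not> E x c" "E c b \<longleftrightarrow> \<not> E b c" "E a c \<longleftrightarrow> \<not> E c a"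
    using tour_flip[OF t V(1)] tour_flip[OF t V(3,4) dist(2)] tour_flip[OF t V(4,2) dist(3)] V nx by blast+
  have df': "\<not> diamond E p q r s" if "p \<in> V" "q \<in> V" "r \<in> V" "s \<in> V" for p q r s
    using df that unfolding diamond_free_def by blast
  show False
  proof (cases "E x c \<longleftrightarrow> E x a")
    case True
    then have "diamond E x a b c" unfolding diamond_def cyc_def using F same flip by blast
    then show False using df' V by blast
  next
    case False
    show False
    proof (cases "E x a")
      case True
      then have "diamond E b x a c" unfolding diamond_def cyc_def using F same flip False by blast
      then show False using df' V by blast
    next
      case nxa: False
      then have "diamond E a x c b" unfolding diamond_def cyc_def using F same flip False by blast
      then show False using df' V by blast
    qed
  qed
qed

text \<open>Tournaments without diamonds are the ones switching equivalent to transitive tournaments.\<close>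

lemma switch_transitive:
  assumes t: "tour V E" and df: "diamond_free V E" and x: "x \<in> V"
  defines "s \<equiv> \<lambda>v. v = x \<or> E x v"
  defines "F \<equiv> \<lambda>v w. E v w \<longleftrightarrow> s v = s w"
  shows "tour V F" "cycle_free V F"
proof -
  have irr: "\<not> E v v" if "v \<in> V" for v using tour_irrefl[OF t that] .
  have flip: "E w v \<longleftrightarrow> \<not> E v w" if "v \<in> V" "w \<in> V" "v \<noteq> w" for v w using tour_flip[OF t that] .
  show "tour V F"
    unfolding tour_def
  proof (intro conjI ballI impI)
    show "finite V" using t by (rule tour_finite)
    show "\<not> F v v" if "v \<in> V" for v using irr[OF that] unfolding F_def by simp
    show "F v w \<noteq> F w v" if "v \<in> V" "w \<in> V" "v \<noteq> w" for v w
      using flip[OF that] unfolding F_def by auto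
  qed
  show "cycle_free V F"
    unfolding cycle_free_def
  proof (intro ballI notI)
    fix a b c assume V: "a \<in> V" "b \<in> V" "c \<in> V" and "cyc F a b c"
    then have F: "F a b" "F b c" "F c a" by (auto simp: cyc_def)
    \<comment> \<open>After switching \<open>x\<close> dominates all other vertices, so no 3-cycle
      passes through it.\<close>
    have xs: "\<not> F v x" if "v \<in> V" for v
      using flip[OF x that] irr[OF x] that unfolding F_def s_def by (cases "v = x") auto
    have nx: "a \<noteq> x" "b \<noteq> x" "c \<noteq> x" using F xs V by blast+
    have dist: "a \<noteq> b" "b \<noteq> c" "c \<noteq> a" using F V \<open>tour V F\<close> tour_irrefl by metis+
    have F': "E a b \<longleftrightarrow> (E x a \<longleftrightarrow> E x b)" "E b c \<longleftrightarrow> (E x b \<longleftrightarrow> E x c)" "E c a \<longleftrightarrow> (E x c \<longleftrightarrow> E x a)"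
      using F nx unfolding F_def s_def by auto
    consider "E x a \<longleftrightarrow> E x b" | "E x b \<longleftrightarrow> E x c" | "E x c \<longleftrightarrow> E x a" by blast
    then show False
    proof cases
      case 1 show False by (rule switch_no_cycle_aux[OF t df x V nx dist F' 1])
    next
      case 2 show False
        by (rule switch_no_cycle_aux[OF t df x V(2,3,1) nx(2,3,1) dist(2,3,1) F'(2,3,1) 2])
    next
      case 3 show False
        by (rule switch_no_cycle_aux[OF t df x V(3,1,2) nx(3,1,2) dist(3,1,2) F'(3,1,2) 3])
    qed
  qed
qed

text \<open>Numbers the maximal constant runs of \<open>l\<close>; the parity of a run recovers its
  value of \<open>l\<close>.\<close>

primrec changes :: "(nat \<Rightarrow> bool) \<Rightarrow> nat \<Rightarrow> nat" where
  "changes l 0 = 0"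
| "changes l (Suc k) = changes l k + (if l k = l (Suc k) then 0 else 1)"

lemma changes_even: "even (changes l k) \<longleftrightarrow> l k = l 0"
  by (induction k) auto

lemma changes_mono: "i \<le> j \<Longrightarrow> changes l i \<le> changes l j"
  by (induction j) (auto simp: le_Suc_eq)

lemma changes_surj: "j \<le> changes l m \<Longrightarrow> \<exists>k\<le>m. changes l k = j"
proof (induction m)
  case (Suc m)
  show ?case
  proof (cases "j \<le> changes l m")
    case True then show ?thesis using Suc.IH by (meson le_SucI)
  next
    case False
    then have "changes l (Suc m) = j" using Suc.prems by (auto split: if_splits)
    then show ?thesis by blast
  qed
qed simp

text \<open>In the linear order obtained by switching, maximal runs of vertices on the same side
  become the fibres. \<open>E\<close> agrees with that order between two runs iff their numbers have
  equal parity: a rotational tournament cut open.\<close>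

lemma model_exists:
  assumes t: "tour V E" and df: "diamond_free V E" and ncf: "\<not> cycle_free V E"
  shows "\<exists>L r. model V E L r"
proof -
  obtain x where x: "x \<in> V" using ncf unfolding cycle_free_def by blast
  define s where "s = (\<lambda>v. v = x \<or> E x v)"
  define F where "F = (\<lambda>v w. E v w \<longleftrightarrow> s v = s w)"
  have tF: "tour V F" "cycle_free V F"
    using switch_transitive[OF t df x] unfolding F_def s_def by auto
  define p where "p = (\<lambda>v. card {w\<in>V. F w v})"
  have pb: "bij_betw p V {..<card V}" and pF: "\<And>v w. v \<in> V \<Longrightarrow> w \<in> V \<Longrightarrow> F v w \<longleftrightarrow> p v < p w"
    using cycle_free_rank[OF tF] unfolding p_def by auto
  define q where "q = inv_into V p"
  have qp: "q (p v) = v" if "v \<in> V" for v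
    unfolding q_def by (rule inv_into_f_f[OF bij_betw_imp_inj_on[OF pb] that])
  have pq: "q k \<in> V" "p (q k) = k" if "k < card V" for k
    using inv_into_into[of k p V] f_inv_into_f[of k p V] bij_betw_imp_surj_on[OF pb] that unfolding q_def by auto
  define l where "l = (\<lambda>k. s (q k))"
  define R where "R = (\<lambda>v. changes l (p v))"
  define m where "m = changes l (card V - 1)"
  have pless: "p v < card V" if "v \<in> V" for v using bij_betw_apply[OF pb that] by simp
  have Rm: "R v \<le> m" if "v \<in> V" for v
    unfolding R_def m_def by (rule changes_mono) (use pless[OF that] in simp)
  have sR: "s v = s w \<longleftrightarrow> even (R v + R w)" if "v \<in> V" "w \<in> V" for v w
    using changes_even[of l "p v"] changes_even[of l "p w"] qp that unfolding R_def l_def by auto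
  have E: "E v w \<longleftrightarrow> (p v < p w \<longleftrightarrow> even (R v + R w))" if "v \<in> V" "w \<in> V" for v w
    using pF[OF that] sR[OF that] unfolding F_def by blast
  have Rmono: "R v < R w \<Longrightarrow> p v < p w" for v w
    using changes_mono[of "p w" "p v" l] unfolding R_def by linarith
  \<comment> \<open>There are \<open>m + 1\<close> runs. If this number is even, the last run
    dominates the first, and reduction modulo \<open>m\<close> merges the two into one chain; thus
    \<open>L\<close> is odd in either case.\<close>
  define L where "L = (if even m then int m + 1 else int m)"
  define r where "r = (\<lambda>v. int (R v) mod L)"
  have Lm: "odd L" "L \<ge> 1" "L \<le> int m + 1" unfolding L_def by (auto elim: oddE)
  have r_eq: "r v = (if odd m \<and> R v = m then 0 else int (R v))" if "v \<in> V" for v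
    using Rm[OF that] unfolding r_def L_def by auto
  have wrap: "E v w" if "v \<in> V" "w \<in> V" "odd m" "R v = m" "R w = 0" for v w
  proof -
    have "m > 0" using that(3) by (cases m) auto
    then have "p w < p v" using Rmono[of w v] that by simp
    then show ?thesis using E[OF that(1,2)] that by simp
  qed
  have chain: "cycle_free {v\<in>V. r v = k} E" for k
    unfolding cycle_free_def
  proof (intro ballI notI)
    fix a b c assume abc: "a \<in> {v\<in>V. r v = k}" "b \<in> {v\<in>V. r v = k}" "c \<in> {v\<in>V. r v = k}"
      and cy: "cyc E a b c"
    then have V: "a \<in> V" "b \<in> V" "c \<in> V" by auto
    have arcs: "E a b" "E b c" "E c a" using cy by (auto simp: cyc_def)
    have asym: "E u v \<Longrightarrow> \<not> E v u" if "u \<in> V" "v \<in> V" for u v using tour_asym[OF t that] .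
    have two: "R u = R v \<or> odd m \<and> R u = m \<and> R v = 0 \<or> odd m \<and> R u = 0 \<and> R v = m"
      if "u \<in> V" "v \<in> V" "r u = r v" for u v
      using r_eq[OF that(1)] r_eq[OF that(2)] that(3) by (auto split: if_splits)
    have le: "R u = R v \<or> odd m \<and> R u = m \<and> R v = 0" if "u \<in> V" "v \<in> V" "r u = r v" "E u v" for u v
      using two[OF that(1-3)] wrap[OF that(2,1)] asym[OF that(1,2)] that(4) by blast
    have "R a = R b" "R b = R c"
      using le[OF V(1,2)] le[OF V(2,3)] le[OF V(3,1)] arcs abc by auto
    then have "F a b" "F b c" "F c a" using pF E V arcs by auto
    then show False using tF(2) V unfolding cycle_free_def cyc_def by blast
  qed
  have L3: "L \<ge> 3"
  proof (rule ccontr)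
    assume "\<not> L \<ge> 3"
    then have "L = 1" using Lm by (auto elim!: oddE)
    then have "{v\<in>V. r v = 0} = V" unfolding r_def by auto
    then show False using chain[of 0] ncf by simp
  qed
  have img: "r ` V = {0..<L}"
  proof (intro equalityI subsetI)
    fix j assume "j \<in> r ` V"
    then show "j \<in> {0..<L}" using L3 unfolding r_def by auto
  next
    fix j assume j: "j \<in> {0..<L}"
    then have "nat j \<le> m" using Lm(3) by auto
    then obtain k where k: "k \<le> card V - 1" "changes l k = nat j"
      using changes_surj[of "nat j" l "card V - 1"] unfolding m_def by blast
    have "card V > 0" using x tour_finite[OF t] by (auto simp: card_gt_0_iff)
    then have "k < card V" using k(1) by linarith
    then have "q k \<in> V" "R (q k) = nat j" using pq k(2) unfolding R_def by auto
    then have "r (q k) = j" using j unfolding r_def by auto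
    then show "j \<in> r ` V" using \<open>q k \<in> V\<close> by blast
  qed
  have arc: "E v w \<longleftrightarrow> even ((r w - r v) mod L)" if V: "v \<in> V" "w \<in> V" and ne: "r v \<noteq> r w" for v w
  proof -
    have rng: "0 \<le> r v" "r v < L" "0 \<le> r w" "r w < L" using img V by auto
    have md: "(r w - r v) mod L = (if r v \<le> r w then r w - r v else r w - r v + L)"
      by (rule mod_diff_cases) (use rng in auto)
    have key: "even ((r w - r v) mod L) \<longleftrightarrow> (r v < r w \<longleftrightarrow> even (r v + r w))"
      using md ne Lm(1) by auto
    have Rne: "R v \<noteq> R w" using ne unfolding r_def by auto
    have pR: "p v < p w \<longleftrightarrow> R v < R w" using Rmono[of v w] Rmono[of w v] Rne by linarith
    have Ev: "E v w \<longleftrightarrow> (R v < R w \<longleftrightarrow> even (R v + R w))" using E[OF V] pR by simp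
    consider "r v = int (R v)" "r w = int (R w)" | "odd m" "R v = m" "r v = 0" "r w = int (R w)" "R w < m"
      | "odd m" "R w = m" "r w = 0" "r v = int (R v)" "R v < m"
      using r_eq[OF V(1)] r_eq[OF V(2)] Rm[OF V(1)] Rm[OF V(2)] Rne by (auto split: if_splits)
    then show ?thesis
    proof cases
      case 1 then show ?thesis using key Ev by auto
    next
      case 2 then show ?thesis using key Ev ne by auto
    next
      case 3 then show ?thesis using key Ev ne by auto
    qed
  qed
  show ?thesis
    by (rule exI[of _ L], rule exI[of _ r]) (use Lm(1) L3 img arc chain in \<open>simp add: model_def\<close>)
qed

text \<open>In a model these say that \<open>w\<close> lies in the fibre of \<open>v\<close>, resp. in the next one, without
  reference to \<open>r\<close>; hence isomorphisms between models act as rotations.\<close>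

definition twin_sim :: "'a set \<Rightarrow> ('a \<Rightarrow> 'a \<Rightarrow> bool) \<Rightarrow> 'a \<Rightarrow> 'a \<Rightarrow> bool" where
  "twin_sim V E v w \<longleftrightarrow> (\<forall>z\<in>V. \<not> cyc E v w z \<and> \<not> cyc E v z w)"

definition next_to :: "'a set \<Rightarrow> ('a \<Rightarrow> 'a \<Rightarrow> bool) \<Rightarrow> 'a \<Rightarrow> 'a \<Rightarrow> bool" where
  "next_to V E v w \<longleftrightarrow> E w v \<and> \<not> twin_sim V E v w \<and>
     (\<forall>z\<in>V. \<not> twin_sim V E z v \<longrightarrow> \<not> twin_sim V E z w \<longrightarrow> E v z \<longrightarrow> \<not> E w z)"

section \<open>Recovering the cyclic order of the fibres from the arcs\<close>

context
  fixes V :: "'a set" and E L r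
  assumes t: "tour V E" and M: "model V E L r"
begin

lemma model_L: "odd L" "L \<ge> 3"
  using M unfolding model_def by auto

lemma model_range: "v \<in> V \<Longrightarrow> 0 \<le> r v" "v \<in> V \<Longrightarrow> r v < L"
  using M unfolding model_def by auto

lemma model_surj: "\<exists>v\<in>V. r v = k mod L"
proof -
  have "k mod L \<in> r ` V" using M unfolding model_def by simp
  then show ?thesis by auto
qed

lemma model_arc: "v \<in> V \<Longrightarrow> w \<in> V \<Longrightarrow> r v \<noteq> r w \<Longrightarrow> E v w \<longleftrightarrow> even ((r w - r v) mod L)"
  using M unfolding model_def by blast

lemma model_chain: "cycle_free {v\<in>V. r v = k} E"
  using M unfolding model_def by blast

lemma model_off:
  assumes "v \<in> V" "w \<in> V" "r v \<noteq> r w"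
  shows "0 < (r w - r v) mod L" "(r w - r v) mod L < L" "(r v - r w) mod L = L - (r w - r v) mod L"
  using mod_diff_cases[of "r w" L "r v"] mod_diff_cases[of "r v" L "r w"]
    model_range[OF assms(1)] model_range[OF assms(2)] assms(3) by auto

lemma model_off_add: "(r z - r w) mod L = ((r z - r v) mod L - (r w - r v) mod L) mod L"
  by (simp add: mod_diff_eq)

lemma model_sim_sym: "twin_sim V E v w \<longleftrightarrow> twin_sim V E w v"
  unfolding twin_sim_def using cyc_rot[of E] by blast

lemma model_sim_aux:
  assumes "v \<in> V" "w \<in> V" "r v \<noteq> r w" "E v w" shows "\<not> twin_sim V E v w"
proof -
  define d where "d = (r w - r v) mod L"
  have d: "even d" "0 < d" "d < L"
    using model_arc[OF assms(1-3)] assms(4) model_off[OF assms(1-3)] unfolding d_def by auto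
  \<comment> \<open>The next fibre dominates \<open>v\<close>, the offset back being the even number
    \<open>L - 1\<close>, and \<open>w\<close> dominates it at the even offset
    \<open>L + 1 - d\<close>.\<close>
  obtain z where z: "z \<in> V" "r z = (r v + 1) mod L" using model_surj by blast
  have zv: "(r z - r v) mod L = 1"
    using model_L z(2) by (simp add: mod_diff_left_eq)
  have zw: "(r z - r w) mod L = L + 1 - d"
  proof -
    have "(r z - r w) mod L = (1 - d) mod L" using model_off_add[of z w v] zv unfolding d_def by simp
    also have "\<dots> = L + 1 - d" using mod_diff_cases[of 1 L d] d model_L by auto
    finally show ?thesis .
  qed
  have ne: "r z \<noteq> r v" "r z \<noteq> r w" using zv zw d model_L by auto
  have "E z v" using model_arc[OF z(1) assms(1) ne(1)] model_off(3)[OF assms(1) z(1)] ne zv model_L by auto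
  moreover have "E w z" using model_arc[OF assms(2) z(1)] ne zw d model_L by auto
  ultimately have "cyc E v w z" using assms(4) by (simp add: cyc_def)
  then show ?thesis using z(1) unfolding twin_sim_def by blast
qed

lemma model_sim:
  assumes v: "v \<in> V" and w: "w \<in> V"
  shows "twin_sim V E v w \<longleftrightarrow> r v = r w"
proof
  assume "twin_sim V E v w"
  then show "r v = r w"
    using model_sim_aux[OF v w] model_sim_aux[OF w v] model_sim_sym tour_flip[OF t v w] by metis
next
  assume eq: "r v = r w"
  have no: False if V: "a \<in> V" "b \<in> V" "z \<in> V" and "r a = r b" "cyc E a b z" for a b z
  proof -
    have arcs: "E b z" "E z a" using that by (auto simp: cyc_def)
    show False
    proof (cases "r z = r a")
      case True
      then show False using model_chain[of "r a"] that unfolding cycle_free_def by auto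
    next
      case False
      then show False
        using arcs model_arc[OF V(2,3)] model_arc[OF V(3,1)] model_off(3)[OF V(3,1)] that(4) model_L by auto
    qed
  qed
  show "twin_sim V E v w"
    unfolding twin_sim_def
    using no[OF v w _ eq] no[OF w v _ eq[symmetric]] cyc_rot[of E] by blast
qed

text \<open>Since \<open>w\<close> dominates \<open>v\<close>, its offset \<open>k\<close> from
  \<open>v\<close> is odd. If \<open>k \<ge> 3\<close>, a vertex at offset 2 from \<open>v\<close>
  is dominated by both; if \<open>k = 1\<close>, even offsets from \<open>v\<close> are odd offsets
  from \<open>w\<close>.\<close>

lemma model_next:
  assumes v: "v \<in> V" and w: "w \<in> V"
  shows "next_to V E v w \<longleftrightarrow> r w = (r v + 1) mod L"
proof
  assume P: "next_to V E v w"
  define k where "k = (r w - r v) mod L"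
  have ne: "r v \<noteq> r w" using P model_sim[OF v w] unfolding next_to_def by blast
  have k: "0 < k" "k < L" using model_off[OF v w ne] unfolding k_def by auto
  have "E w v" using P unfolding next_to_def by blast
  then have "odd k" using model_arc[OF w v] ne model_off(3)[OF v w ne] model_L unfolding k_def by auto
  have "k = 1"
  proof (rule ccontr)
    assume "k \<noteq> 1"
    then have k3: "k \<ge> 3" using \<open>odd k\<close> k by presburger
    obtain z where z: "z \<in> V" "r z = (r v + 2) mod L" using model_surj by blast
    have zv: "(r z - r v) mod L = 2" using model_L z(2) by (simp add: mod_diff_left_eq)
    have zw: "(r z - r w) mod L = L + 2 - k"
      using model_off_add[of z w v] zv mod_diff_cases[of 2 L k] k k3 unfolding k_def by auto
    have nez: "r z \<noteq> r v" "r z \<noteq> r w" using zv zw k k3 by auto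
    have "E v z" using model_arc[OF v z(1)] nez zv by auto
    moreover have "E w z" using model_arc[OF w z(1)] nez zw \<open>odd k\<close> model_L by auto
    ultimately show False
      using P model_sim[OF z(1) v] model_sim[OF z(1) w] nez z(1) unfolding next_to_def by blast
  qed
  moreover have "(r v + (r w - r v) mod L) mod L = r w"
    using model_range[OF w] by (simp add: mod_add_right_eq)
  ultimately show "r w = (r v + 1) mod L" unfolding k_def by simp
next
  assume eq: "r w = (r v + 1) mod L"
  have wv: "(r w - r v) mod L = 1" using model_L eq by (simp add: mod_diff_left_eq)
  then have ne: "r v \<noteq> r w" by auto
  have "E w v" using model_arc[OF w v] ne model_off(3)[OF v w ne] wv model_L by auto
  moreover have "\<not> E w z" if z: "z \<in> V" "\<not> twin_sim V E z v" "\<not> twin_sim V E z w" "E v z" for z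
  proof -
    have nez: "r z \<noteq> r v" "r z \<noteq> r w" using z model_sim[OF z(1) v] model_sim[OF z(1) w] by auto
    define j where "j = (r z - r v) mod L"
    have j: "0 < j" "j < L" "even j"
      using model_off[OF v z(1)] nez model_arc[OF v z(1)] z(4) unfolding j_def by auto
    have "(r z - r w) mod L = j - 1"
      using model_off_add[of z w v] wv mod_diff_cases[of j L 1] j unfolding j_def by auto
    then show ?thesis using model_arc[OF w z(1)] nez j by auto
  qed
  ultimately show "next_to V E v w" unfolding next_to_def using model_sim[OF v w] ne by blast
qed

end

lemma model_dual:
  assumes t: "tour V E" and M: "model V E L r"
  shows "model V E\<^sup>d L (\<lambda>v. (- r v) mod L)"
proof -
  have L: "odd L" "L \<ge> 3" using model_L[OF t M] by auto
  have r: "r v mod L = r v" if "v \<in> V" for v using model_range[OF t M that] by simp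
  have inj: "(- r v) mod L = (- r w) mod L \<longleftrightarrow> r v = r w" if "v \<in> V" "w \<in> V" for v w
    using r[OF that(1)] r[OF that(2)] by (metis minus_minus mod_minus_eq)
  have "(\<lambda>v. (- r v) mod L) ` V = {0..<L}"
  proof (intro equalityI subsetI)
    fix j assume j: "j \<in> {0..<L}"
    obtain v where "v \<in> V" "r v = (- j) mod L" using model_surj[OF t M] by blast
    then have "(- r v) mod L = j" using j by (simp add: mod_minus_eq)
    then show "j \<in> (\<lambda>v. (- r v) mod L) ` V" using \<open>v \<in> V\<close> by blast
  qed (use L in auto)
  moreover have "E\<^sup>d v w \<longleftrightarrow> even (((- r w) mod L - (- r v) mod L) mod L)"
    if "v \<in> V" "w \<in> V" "r v \<noteq> r w" for v w
  proof -
    have "((- r w) mod L - (- r v) mod L) mod L = (r v - r w) mod L" by (simp add: mod_diff_eq)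
    then show ?thesis using model_arc[OF t M that(2,1)] that(3) by simp
  qed
  moreover have "cycle_free {v\<in>V. (- r v) mod L = k} E\<^sup>d" for k
  proof (cases "\<exists>u\<in>V. (- r u) mod L = k")
    case True
    then obtain u where u: "u \<in> V" "(- r u) mod L = k" by blast
    have "{v\<in>V. (- r v) mod L = k} = {v\<in>V. r v = r u}" using inj[OF _ u(1)] u(2) by auto
    then show ?thesis using model_chain[OF t M] by (simp add: cycle_free_dual)
  next
    case False then show ?thesis unfolding cycle_free_def by auto
  qed
  ultimately show ?thesis unfolding model_def using L inj by auto
qed

text \<open>\<open>twin_sim\<close> and \<open>next_to\<close> are invariant under isomorphism, so
  fibres go to fibres and successors to successors; the image of fibre 0 decides the rest.\<close>

lemma model_iso_rotation:
  assumes tV: "tour V E" and MV: "model V E L r" and tW: "tour W F" and MW: "model W F L r'"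
    and f: "bij_betw f V W" and FE: "\<forall>x\<in>V. \<forall>y\<in>V. E x y = F (f x) (f y)"
  shows "\<exists>c. \<forall>v\<in>V. r' (f v) = (c + r v) mod L"
proof -
  have L: "odd L" "L \<ge> 3" using model_L[OF tV MV] by auto
  have fV: "f v \<in> W" if "v \<in> V" for v using bij_betw_apply[OF f that] .
  have cyc: "cyc E a b c = cyc F (f a) (f b) (f c)" if "a \<in> V" "b \<in> V" "c \<in> V" for a b c
    using FE that unfolding cyc_def by simp
  have all: "(\<forall>z\<in>W. Q z) \<longleftrightarrow> (\<forall>z\<in>V. Q (f z))" for Q
    using bij_betw_imp_surj_on[OF f] by blast
  have sim: "twin_sim V E v w \<longleftrightarrow> twin_sim W F (f v) (f w)" if "v \<in> V" "w \<in> V" for v w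
    unfolding twin_sim_def all using cyc that by simp
  have nxt: "next_to V E v w \<longleftrightarrow> next_to W F (f v) (f w)" if "v \<in> V" "w \<in> V" for v w
    unfolding next_to_def all using sim FE that by simp
  obtain v0 where v0: "v0 \<in> V" "r v0 = 0" using model_surj[OF tV MV, of 0] by auto
  have "int k < L \<Longrightarrow> v \<in> V \<Longrightarrow> r v = int k \<Longrightarrow> r' (f v) = (r' (f v0) + int k) mod L" for k v
  proof (induction k arbitrary: v)
    case 0
    then have "twin_sim V E v v0" using model_sim[OF tV MV 0(2) v0(1)] v0(2) by simp
    then have "r' (f v) = r' (f v0)"
      using sim[OF 0(2) v0(1)] model_sim[OF tW MW fV[OF 0(2)] fV[OF v0(1)]] by simp
    then show ?case using model_range[OF tW MW fV[OF v0(1)]] by simp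
  next
    case (Suc k)
    obtain w where w: "w \<in> V" "r w = int k" using model_surj[OF tV MV, of "int k"] Suc.prems(1) by auto
    have "r v = (r w + 1) mod L" using Suc.prems w(2) by simp
    then have "next_to W F (f w) (f v)"
      using model_next[OF tV MV w(1) Suc.prems(2)] nxt[OF w(1) Suc.prems(2)] by simp
    then have "r' (f v) = (r' (f w) + 1) mod L"
      using model_next[OF tW MW fV[OF w(1)] fV[OF Suc.prems(2)]] by simp
    also have "\<dots> = (r' (f v0) + int (Suc k)) mod L"
      using Suc.IH[OF _ w(1,2)] Suc.prems(1) mod_add_left_eq[of "r' (f v0) + int k" L 1]
      by (simp add: add.assoc add.commute[of 1])
    finally show ?case .
  qed
  then have "r' (f v) = (r' (f v0) + r v) mod L" if "v \<in> V" for v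
    using model_range[OF tV MV that] that by (metis int_nat_eq)
  then show ?thesis by blast
qed

section \<open>Fibre sizes: self-duality and vertex deletion\<close>

definition fibre :: "'a set \<Rightarrow> ('a \<Rightarrow> int) \<Rightarrow> int \<Rightarrow> int \<Rightarrow> nat" where
  "fibre V r L t = card {v\<in>V. r v = t mod L}"

text \<open>The dual is a model with \<open>- r\<close> for \<open>r\<close>, so an isomorphism onto
  it, being a rotation there, acts on the original positions as a reflection.\<close>

lemma model_self_dual_palindrome:
  assumes tV: "tour V E" and M: "model V E L r" and sd: "tour_iso V E V E\<^sup>d"
  shows "\<exists>c. \<forall>t. fibre V r L (c - t) = fibre V r L t"
proof -
  have L: "odd L" "L \<ge> 3" using model_L[OF tV M] by auto
  have fin: "finite V" using tV by (rule tour_finite)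
  from sd obtain f where f: "bij_betw f V V" and FE: "\<forall>x\<in>V. \<forall>y\<in>V. E x y = E\<^sup>d (f x) (f y)"
    by (rule tour_isoE)
  have tD: "tour V E\<^sup>d" using tV by (simp add: tour_dual)
  obtain c where c: "\<forall>v\<in>V. (- r (f v)) mod L = (c + r v) mod L"
    using model_iso_rotation[OF tV M tD model_dual[OF tV M] f FE] by blast
  have rf: "r (f v) = (- c - r v) mod L" if "v \<in> V" for v
  proof -
    have "r (f v) = (- ((- r (f v)) mod L)) mod L"
      using model_range[OF tV M bij_betw_apply[OF f that]] by (simp add: mod_minus_eq)
    also have "\<dots> = (- ((c + r v) mod L)) mod L" using c that by simp
    also have "\<dots> = (- c - r v) mod L" by (simp add: mod_minus_eq)
    finally show ?thesis .
  qed
  \<comment> \<open>An inequality for all \<open>t\<close> is enough, because the reflection is an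
    involution.\<close>
  have le: "fibre V r L t \<le> fibre V r L (- c - t)" for t
    unfolding fibre_def
  proof (rule card_inj_on_le)
    show "inj_on f {v \<in> V. r v = t mod L}"
      by (rule inj_on_subset[OF bij_betw_imp_inj_on[OF f]]) blast
    show "f ` {v \<in> V. r v = t mod L} \<subseteq> {v \<in> V. r v = (- c - t) mod L}"
      using rf bij_betw_apply[OF f] by (auto simp: mod_diff_right_eq)
  qed (use fin in simp)
  have "fibre V r L (- c - t) = fibre V r L t" for t
    using le[of t] le[of "- c - t"] by simp
  then show ?thesis by blast
qed

lemma model_palindrome_self_dual:
  assumes tV: "tour V E" and M: "model V E L r" and c: "\<And>t. fibre V r L (c - t) = fibre V r L t"
  shows "tour_iso V E V E\<^sup>d"
proof (rule tour_iso_glue[where c = r and d = "\<lambda>v. (c - r v) mod L"])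
  have L: "odd L" "L \<ge> 3" using model_L[OF tV M] by auto
  have rng: "r v mod L = r v" "r v \<in> {0..<L}" if "v \<in> V" for v using model_range[OF tV M that] by auto
  have inv: "(c - a) mod L = b \<longleftrightarrow> a = (c - b) mod L" if "a \<in> {0..<L}" "b \<in> {0..<L}" for a b
  proof
    assume "(c - a) mod L = b"
    then have "(c - b) mod L = (c - (c - a)) mod L" by (metis mod_diff_right_eq)
    then show "a = (c - b) mod L" using that by simp
  next
    assume "a = (c - b) mod L"
    then have "(c - a) mod L = (c - (c - b)) mod L" by (metis mod_diff_right_eq)
    then show "(c - a) mod L = b" using that by simp
  qed
  have rV: "r ` V = {0..<L}" using M unfolding model_def by blast
  have "(\<lambda>v. (c - r v) mod L) ` V = {0..<L}"
  proof (intro equalityI subsetI)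
    fix j assume j: "j \<in> {0..<L}"
    obtain v where v: "v \<in> V" "r v = (c - j) mod L" using model_surj[OF tV M] by blast
    then have "(c - r v) mod L = j" using inv[OF rng(2)[OF v(1)] j] by simp
    then show "j \<in> (\<lambda>v. (c - r v) mod L) ` V" using v(1) by blast
  qed (use L in auto)
  then show "r ` V = (\<lambda>v. (c - r v) mod L) ` V" using rV by simp
  show "tour_iso {v \<in> V. r v = k} E {w \<in> V. (c - r w) mod L = k} E\<^sup>d" if k: "k \<in> r ` V" for k
  proof -
    have kL: "k \<in> {0..<L}" using k rV by simp
    have eq: "{w \<in> V. (c - r w) mod L = k} = {w\<in>V. r w = (c - k) mod L}"
      using inv[OF rng(2) kL] by blast
    have "card {v \<in> V. r v = k} = card {w\<in>V. r w = (c - k) mod L}"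
      using c[of k] kL unfolding fibre_def by simp
    moreover have "tour {v \<in> V. r v = k} E" "tour {w\<in>V. r w = (c - k) mod L} E\<^sup>d"
      unfolding tour_dual by (rule tour_subset[OF tV]; blast)+
    ultimately show ?thesis
      unfolding eq using model_chain[OF tV M] by (intro chain_iso) (simp_all add: cycle_free_dual)
  qed
  fix v v' w w' assume V: "v \<in> V" "v' \<in> V" "w \<in> V" "w' \<in> V" and ne: "r v \<noteq> r v'"
    and w: "(c - r w) mod L = r v" "(c - r w') mod L = r v'"
  have "(r v' - r v) mod L = ((c - r w') - (c - r w)) mod L" unfolding w[symmetric] by (simp add: mod_diff_eq)
  then have "(r v' - r v) mod L = (r w - r w') mod L" by simp
  moreover have "r w \<noteq> r w'" using w ne by auto
  ultimately show "E v v' = E\<^sup>d w w'"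
    using model_arc[OF tV M V(1,2) ne] model_arc[OF tV M V(4,3)] by auto
qed

lemma fibre_period: "fibre V r L (t + L) = fibre V r L t"
  unfolding fibre_def by simp

lemma fibre_cong: "s mod L = t mod L \<Longrightarrow> fibre V r L s = fibre V r L t"
  unfolding fibre_def by simp

lemma fibre_pos:
  assumes "tour V E" "model V E L r" shows "fibre V r L t \<ge> 1"
proof -
  obtain v where "v \<in> V" "r v = t mod L" using model_surj[OF assms] by blast
  then have "card {v\<in>V. r v = t mod L} > 0" using tour_finite[OF assms(1)] by (auto simp: card_gt_0_iff)
  then show ?thesis unfolding fibre_def by simp
qed

lemma model_delete_large:
  assumes tV: "tour V E" and M: "model V E L r" and v: "v \<in> V" and big: "fibre V r L (r v) \<ge> 2"
  shows "model (V - {v}) E L r"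
proof -
  have "r v \<in> r ` (V - {v})"
  proof -
    have "r v mod L = r v" using model_range[OF tV M v] by simp
    then have "card {w\<in>V. r w = r v} \<ge> 2" using big unfolding fibre_def by simp
    then have "{w\<in>V. r w = r v} \<noteq> {v}" by auto
    then obtain w where "w \<in> V" "r w = r v" "w \<noteq> v" using v by blast
    then have "r w \<in> r ` (V - {v})" by blast
    then show ?thesis using \<open>r w = r v\<close> by simp
  qed
  then have "r ` (V - {v}) = r ` V" by blast
  moreover have "cycle_free {w\<in>V - {v}. r w = k} E" for k
    by (rule cycle_free_subset[OF model_chain[OF tV M, of k]]) blast
  ultimately show ?thesis using M unfolding model_def by auto
qed

lemma fibre_delete:
  assumes "finite V" "v \<in> V" "r v = x mod L"
  shows "fibre (V - {v}) r L t = fibre V r L t - of_bool (L dvd t - x)"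
proof (cases "L dvd t - x")
  case True
  then have "{w\<in>V - {v}. r w = t mod L} = {w\<in>V. r w = t mod L} - {v}" by blast
  moreover have "t mod L = x mod L" using True by (simp add: mod_eq_dvd_iff)
  then have "v \<in> {w\<in>V. r w = t mod L}" using assms by simp
  ultimately show ?thesis using True assms(1) unfolding fibre_def by simp
next
  case False
  then have "r v \<noteq> t mod L" using assms(3) by (metis mod_eq_dvd_iff)
  then have "{w\<in>V - {v}. r w = t mod L} = {w\<in>V. r w = t mod L}" by auto
  then show ?thesis using False unfolding fibre_def by simp
qed

text \<open>Cutting position \<open>L - 1\<close> out of the cycle and identifying the ends 0 and
  \<open>L - 2\<close> closes it up with length \<open>L - 2\<close>. Offsets between distinct new
  positions change by 0 or 2.\<close>

lemma merge_parity:
  fixes a b L :: int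
  assumes L: "odd L" "L \<ge> 5" and ab: "0 \<le> a" "a \<le> L - 2" "0 \<le> b" "b \<le> L - 2"
    and ne: "a mod (L - 2) \<noteq> b mod (L - 2)"
  shows "even ((b - a) mod L) \<longleftrightarrow> even ((b mod (L - 2) - a mod (L - 2)) mod (L - 2))"
proof -
  have m: "c mod (L - 2) = (if c = L - 2 then 0 else c)" if "0 \<le> c" "c \<le> L - 2" for c using that by auto
  have 1: "(b - a) mod L = (if a \<le> b then b - a else b - a + L)"
    by (rule mod_diff_cases) (use ab L in auto)
  have 2: "(b mod (L - 2) - a mod (L - 2)) mod (L - 2) =
      (if a mod (L - 2) \<le> b mod (L - 2) then b mod (L - 2) - a mod (L - 2)
       else b mod (L - 2) - a mod (L - 2) + (L - 2))"
    by (rule mod_diff_cases) (use L in auto)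
  show ?thesis unfolding 1 2 using m[OF ab(1,2)] m[OF ab(3,4)] ne ab L by (auto split: if_splits)
qed

text \<open>The shift in \<open>r'\<close> puts \<open>v\<close> at position \<open>L - 1\<close>.
  Its neighbouring fibres, at 0 and \<open>L - 2\<close>, fuse into fibre 0; their union is a chain
  because the latter dominates the former.\<close>

lemma model_delete_single:
  assumes tV: "tour V E" and M: "model V E L r" and v: "v \<in> V" and L5: "L \<ge> 5"
    and single: "fibre V r L (r v) = 1"
  defines "r' \<equiv> \<lambda>w. ((r w - r v - 1) mod L) mod (L - 2)"
  shows "model (V - {v}) E (L - 2) r'"
    and "\<And>t. 1 \<le> t \<Longrightarrow> t \<le> L - 3 \<Longrightarrow> fibre (V - {v}) r' (L - 2) t = fibre V r L (r v + 1 + t)"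
    and "fibre (V - {v}) r' (L - 2) 0 = fibre V r L (r v + 1) + fibre V r L (r v - 1)"
proof -
  have L: "odd L" "L \<ge> 3" using model_L[OF tV M] by auto
  have fin: "finite V" using tV by (rule tour_finite)
  define r1 where "r1 = (\<lambda>w. (r w - r v - 1) mod L)"
  have r': "r' w = r1 w mod (L - 2)" for w unfolding r'_def r1_def by simp
  have rng: "0 \<le> r w" "r w < L" if "w \<in> V" for w using model_range[OF tV M that] by auto
  have r_r1: "r w = (r v + 1 + r1 w) mod L" if "w \<in> V" for w
  proof -
    have "(r v + 1 + r1 w) mod L = (r v + 1 + (r w - r v - 1)) mod L"
      unfolding r1_def by (rule mod_add_right_eq)
    then show ?thesis using rng[OF that] by simp
  qed
  have r1_iff: "r w = (r v + 1 + t) mod L \<longleftrightarrow> r1 w = t" if "w \<in> V" "0 \<le> t" "t < L" for w t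
  proof
    assume "r w = (r v + 1 + t) mod L"
    then have "r1 w = ((r v + 1 + t) mod L - (r v + 1)) mod L" unfolding r1_def by (simp add: algebra_simps)
    also have "\<dots> = (r v + 1 + t - (r v + 1)) mod L" by (rule mod_diff_left_eq)
    finally show "r1 w = t" using that by simp
  qed (use r_r1[OF that(1)] in simp)
  have only: "w = v" if h: "w \<in> V" "r w = r v" for w
  proof -
    have "card {w\<in>V. r w = r v} = 1" using single rng[OF v] unfolding fibre_def by simp
    then obtain z where "{w\<in>V. r w = r v} = {z}" by (rule card_1_singletonE)
    then have "w \<in> {z}" "v \<in> {z}" using v h by blast+
    then show ?thesis by simp
  qed
  have r1_rng: "0 \<le> r1 w" "r1 w \<le> L - 2" if "w \<in> V - {v}" for w
  proof -
    have "r w \<noteq> r v" using only that by blast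
    then have "r1 w \<noteq> L - 1" using r_r1[of w] that rng[OF v] by auto
    moreover have "0 \<le> r1 w" "r1 w < L" using L unfolding r1_def by auto
    ultimately show "0 \<le> r1 w" "r1 w \<le> L - 2" by auto
  qed
  have r'_cases: "r' w = (if r1 w = L - 2 then 0 else r1 w)" if "w \<in> V - {v}" for w
    using r1_rng[OF that] unfolding r' by auto
  have r1_surj: "\<exists>w\<in>V - {v}. r1 w = t" if "0 \<le> t" "t \<le> L - 2" for t
  proof -
    obtain w where w: "w \<in> V" "r w = (r v + 1 + t) mod L" using model_surj[OF tV M] by blast
    then have r1w: "r1 w = t" using r1_iff[OF w(1)] that by auto
    have "r1 v = L - 1" using r1_iff[OF v, of "L - 1"] rng[OF v] L by simp
    then have "w \<noteq> v" using r1w that by auto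
    then show ?thesis using w(1) r1w by blast
  qed
  have r1_eq: "r w = r z \<longleftrightarrow> r1 w = r1 z" if "w \<in> V" "z \<in> V" for w z
    using r_r1[OF that(1)] r_r1[OF that(2)] unfolding r1_def by auto
  have arc1: "E w z \<longleftrightarrow> even ((r1 z - r1 w) mod L)" if "w \<in> V" "z \<in> V" "r1 w \<noteq> r1 z" for w z
  proof -
    have "(r1 z - r1 w) mod L = (r z - r w) mod L" unfolding r1_def by (simp add: mod_diff_eq)
    then show ?thesis using model_arc[OF tV M that(1,2)] r1_eq that by simp
  qed
  have arc: "E w z \<longleftrightarrow> even ((r' z - r' w) mod (L - 2))"
    if "w \<in> V - {v}" "z \<in> V - {v}" "r' w \<noteq> r' z" for w z
  proof -
    have "r1 w \<noteq> r1 z" using that(3) unfolding r' by auto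
    then show ?thesis
      using merge_parity[OF L(1) L5 r1_rng[OF that(1)] r1_rng[OF that(2)]] that arc1[of w z]
      unfolding r' by auto
  qed
  have wrap: "E w z" if "w \<in> V" "z \<in> V" "r1 w = L - 2" "r1 z = 0" for w z
  proof -
    have "(r1 z - r1 w) mod L = 2"
      using mod_diff_cases[of 0 L "L - 2"] L5 that by simp
    then show ?thesis using arc1[of w z] that L5 by simp
  qed
  have chain: "cycle_free {w\<in>V - {v}. r' w = k} E" for k
    unfolding cycle_free_def
  proof (intro ballI notI)
    fix a b c assume abc: "a \<in> {w\<in>V - {v}. r' w = k}" "b \<in> {w\<in>V - {v}. r' w = k}" "c \<in> {w\<in>V - {v}. r' w = k}"
      and cy: "cyc E a b c"
    then have V: "a \<in> V - {v}" "b \<in> V - {v}" "c \<in> V - {v}" by auto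
    have arcs: "E a b" "E b c" "E c a" using cy by (auto simp: cyc_def)
    have le: "r1 u = r1 w \<or> r1 u = L - 2 \<and> r1 w = 0" if "u \<in> V - {v}" "w \<in> V - {v}" "r' u = r' w" "E u w" for u w
      using r'_cases[OF that(1)] r'_cases[OF that(2)] that wrap[of w u] tour_asym[OF tV, of u w]
      by (auto split: if_splits)
    have "r1 a = r1 b" "r1 b = r1 c"
      using le[OF V(1,2)] le[OF V(2,3)] le[OF V(3,1)] arcs abc L5 by auto
    then have "r b = r a" "r c = r a" using r1_eq V by auto
    then show False using model_chain[OF tV M, of "r a"] V cy unfolding cycle_free_def by auto
  qed
  have img: "r' ` (V - {v}) = {0..<L - 2}"
  proof (intro equalityI subsetI)
    fix j assume "j \<in> r' ` (V - {v})"
    then show "j \<in> {0..<L - 2}" using L5 unfolding r' by auto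
  next
    fix j assume j: "j \<in> {0..<L - 2}"
    then obtain w where w: "w \<in> V - {v}" "r1 w = j" using r1_surj[of j] by auto
    then have "r' w = j" using j unfolding r' by simp
    then show "j \<in> r' ` (V - {v})" using w(1) by blast
  qed
  show "model (V - {v}) E (L - 2) r'"
    unfolding model_def using L L5 img arc chain by auto
  show "fibre (V - {v}) r' (L - 2) t = fibre V r L (r v + 1 + t)" if t: "1 \<le> t" "t \<le> L - 3" for t
  proof -
    have "{w\<in>V - {v}. r' w = t mod (L - 2)} = {w\<in>V. r w = (r v + 1 + t) mod L}"
    proof (intro equalityI subsetI)
      fix w assume w: "w \<in> {w\<in>V - {v}. r' w = t mod (L - 2)}"
      then have "r1 w = t" using r'_cases[of w] t by (auto split: if_splits)
      then show "w \<in> {w\<in>V. r w = (r v + 1 + t) mod L}" using w r1_iff[of w t] t by auto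
    next
      fix w assume w: "w \<in> {w\<in>V. r w = (r v + 1 + t) mod L}"
      then have r1w: "r1 w = t" using r1_iff[of w t] t by auto
      moreover have "r1 v = L - 1" using r1_iff[OF v, of "L - 1"] rng[OF v] L by simp
      ultimately have "w \<noteq> v" using t by auto
      then show "w \<in> {w\<in>V - {v}. r' w = t mod (L - 2)}" using w r1w t unfolding r' by simp
    qed
    then show ?thesis unfolding fibre_def by simp
  qed
  show "fibre (V - {v}) r' (L - 2) 0 = fibre V r L (r v + 1) + fibre V r L (r v - 1)"
  proof -
    have last: "(r v - 1) mod L = (r v + 1 + (L - 2)) mod L"
      using mod_add_self2[of "r v - 1" L] by (simp add: algebra_simps)
    have "{w\<in>V - {v}. r' w = 0 mod (L - 2)} = {w\<in>V. r w = (r v + 1) mod L} \<union> {w\<in>V. r w = (r v - 1) mod L}"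
    proof (intro equalityI subsetI)
      fix w assume w: "w \<in> {w\<in>V - {v}. r' w = 0 mod (L - 2)}"
      then have "r1 w = 0 \<or> r1 w = L - 2" using r'_cases[of w] by (auto split: if_splits)
      then show "w \<in> {w\<in>V. r w = (r v + 1) mod L} \<union> {w\<in>V. r w = (r v - 1) mod L}"
        unfolding last using w r1_iff[of w 0] r1_iff[of w "L - 2"] L5 by auto
    next
      fix w assume "w \<in> {w\<in>V. r w = (r v + 1) mod L} \<union> {w\<in>V. r w = (r v - 1) mod L}"
      then have w: "w \<in> V" "r1 w = 0 \<or> r1 w = L - 2"
        unfolding last using r1_iff[of w 0] r1_iff[of w "L - 2"] L5 by auto
      moreover have "r1 v = L - 1" using r1_iff[OF v, of "L - 1"] rng[OF v] L by simp
      ultimately have "w \<noteq> v" using L5 by auto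
      then show "w \<in> {w\<in>V - {v}. r' w = 0 mod (L - 2)}" using w unfolding r' by auto
    qed
    moreover have "{w\<in>V. r w = (r v + 1) mod L} \<inter> {w\<in>V. r w = (r v - 1) mod L} = {}"
    proof (rule equals0I)
      fix w assume "w \<in> {w\<in>V. r w = (r v + 1) mod L} \<inter> {w\<in>V. r w = (r v - 1) mod L}"
      then have w: "w \<in> V" "r w = (r v + 1 + 0) mod L" "r w = (r v + 1 + (L - 2)) mod L"
        using last by auto
      have "r1 w = 0" using r1_iff[of w 0] w L5 by simp
      moreover have "r1 w = L - 2" using r1_iff[of w "L - 2"] w L5 by simp
      ultimately show False using L5 by simp
    qed
    then have "card ({w\<in>V. r w = (r v + 1) mod L} \<union> {w\<in>V. r w = (r v - 1) mod L}) =
        card {w\<in>V. r w = (r v + 1) mod L} + card {w\<in>V. r w = (r v - 1) mod L}"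
      using fin by (intro card_Un_disjoint) auto
    ultimately show ?thesis unfolding fibre_def by simp
  qed
qed

text \<open>Deleting a vertex from a fibre of size at least 2 provides the decrement condition of
  \<open>palindromicI\<close>, deleting a fibre of size 1 its merging condition.\<close>

theorem self_dual_from_deletions:
  assumes tV: "tour V E" and df: "diamond_free V E" and card: "card V \<ge> 7"
    and del: "\<And>v. v \<in> V \<Longrightarrow> tour_iso (V - {v}) E (V - {v}) E\<^sup>d"
  shows "tour_iso V E V E\<^sup>d"
proof (cases "cycle_free V E")
  case True
  then show ?thesis by (intro chain_iso tV) (simp_all add: tour_dual cycle_free_dual tV)
next
  case False
  then obtain L r where M: "model V E L r" using model_exists[OF tV df] by blast
  have L: "odd L" "L \<ge> 3" using model_L[OF tV M] by auto
  have fin: "finite V" using tV by (rule tour_finite)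
  have tD: "tour (V - {v}) E" for v by (rule tour_subset[OF tV]) blast
  let ?u = "fibre V r L"
  interpret cyclic_sizes ?u L
    by unfold_locales (use L fibre_period fibre_pos[OF tV M] in auto)
  have "palindromic"
  proof (rule palindromicI)
    have "card V = (\<Sum>x\<in>V. 1)" by simp
    also have "\<dots> = (\<Sum>y\<in>r ` V. \<Sum>x\<in>{x\<in>V. r x = y}. 1)" by (rule sum.image_gen[OF fin])
    also have "\<dots> = (\<Sum>y\<in>r ` V. card {x\<in>V. r x = y})" by simp
    also have "\<dots> = (\<Sum>t\<in>{0..<L}. ?u t)"
    proof (rule sum.cong)
      show "r ` V = {0..<L}" using M unfolding model_def by blast
    qed (simp add: fibre_def)
    finally show "(\<Sum>t\<in>{0..<L}. ?u t) \<ge> 7" using card by simp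
  next
    fix x assume x: "?u x \<ge> 2"
    obtain v where v: "v \<in> V" "r v = x mod L" using model_surj[OF tV M] by blast
    have "?u (r v) = ?u x" by (rule fibre_cong) (simp add: v(2))
    then have M': "model (V - {v}) E L r" using model_delete_large[OF tV M v(1)] x by simp
    obtain c where c: "\<forall>t. fibre (V - {v}) r L (c - t) = fibre (V - {v}) r L t"
      using model_self_dual_palindrome[OF tD M' del[OF v(1)]] by blast
    show "\<exists>c. \<forall>t. ?u (c - t) - of_bool (L dvd c - t - x) = ?u t - of_bool (L dvd t - x)"
      using c unfolding fibre_delete[where V = V and v = v and r = r and x = x and L = L, OF fin v] by blast
  next
    fix z s assume L5: "L \<ge> 5" and uz: "?u z = 1" and big: "\<And>t. ?u t < ?u (z - 1) + ?u (z + 1)"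
      and s: "\<not> L dvd s - 1" "\<not> L dvd s + 1"
    obtain v where v: "v \<in> V" "r v = z mod L" using model_surj[OF tV M] by blast
    have u: "?u (r v + k) = ?u (z + k)" for k by (rule fibre_cong) (simp add: v(2) mod_add_left_eq)
    have single: "?u (r v) = 1" using u[of 0] uz by simp
    note D = model_delete_single[OF tV M v(1) L5 single]
    define r' where "r' = (\<lambda>w. ((r w - r v - 1) mod L) mod (L - 2))"
    let ?w = "fibre (V - {v}) r' (L - 2)"
    have M': "model (V - {v}) E (L - 2) r'" using D(1) unfolding r'_def .
    have w: "?w t = ?u (z + 1 + t)" if "1 \<le> t" "t \<le> L - 3" for t
      using D(2)[OF that] u[of "1 + t"] unfolding r'_def by (simp add: add.assoc)
    have w0: "?w 0 = ?u (z + 1) + ?u (z - 1)"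
      using D(3) u[of 1] u[of "- 1"] unfolding r'_def by simp
    obtain c where c: "\<forall>t. ?w (c - t) = ?w t"
      using model_self_dual_palindrome[OF tD M' del[OF v(1)]] by blast
    have wmod: "?w t = ?w (t mod (L - 2))" for t by (rule fibre_cong) simp
    \<comment> \<open>The merged fibre 0 is strictly larger than any other, so the reflection fixes
      it.\<close>
    have c0: "c mod (L - 2) = 0"
    proof (rule ccontr)
      assume ne: "c mod (L - 2) \<noteq> 0"
      have "0 \<le> c mod (L - 2)" "c mod (L - 2) < L - 2" using L5 by auto
      then have "?w (c mod (L - 2)) = ?u (z + 1 + c mod (L - 2))" using ne by (intro w) auto
      then have "?w 0 = ?u (z + 1 + c mod (L - 2))" using c[rule_format, of 0] wmod[of c] by simp
      then show False using w0 big[of "z + 1 + c mod (L - 2)"] by simp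
    qed
    define m where "m = s mod L"
    have m: "0 \<le> m" "m < L" using L5 unfolding m_def by auto
    have "m \<noteq> 1"
    proof
      assume "m = 1"
      then have "s mod L = 1 mod L" unfolding m_def using L5 by simp
      then show False using s(1) by (simp add: mod_eq_dvd_iff)
    qed
    moreover have "m \<noteq> L - 1"
    proof
      assume "m = L - 1"
      then have "(s + 1) mod L = 0" unfolding m_def using mod_add_left_eq[of s L 1] by simp
      then show False using s(2) by (simp add: dvd_eq_mod_eq_0)
    qed
    ultimately consider "m = 0" | "2 \<le> m" "m \<le> L - 2" using m by linarith
    then have key: "?u (z + m) = ?u (z - m)"
    proof cases
      case 2
      have "?w (m - 1) = ?u (z + m)" using w[of "m - 1"] 2 by simp
      moreover have "?w (L - 1 - m) = ?u (z + 1 + (L - 1 - m))" using 2 by (intro w) auto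
      moreover have "?u (z + 1 + (L - 1 - m)) = ?u (z - m)"
        using fibre_period[of V r L "z - m"] by (simp add: algebra_simps)
      moreover have "?w (L - 1 - m) = ?w (c - (m - 1))"
      proof (rule fibre_cong)
        have "(c - (m - 1)) mod (L - 2) = (c mod (L - 2) - (m - 1)) mod (L - 2)" by (rule mod_diff_left_eq[symmetric])
        also have "\<dots> = (- (m - 1)) mod (L - 2)" unfolding c0 by simp
        also have "\<dots> = (- (m - 1) + (L - 2)) mod (L - 2)" by (rule mod_add_self2[symmetric])
        also have "- (m - 1) + (L - 2) = L - 1 - m" by simp
        finally show "(L - 1 - m) mod (L - 2) = (c - (m - 1)) mod (L - 2)" by simp
      qed
      ultimately show ?thesis using c by simp
    qed simp
    have "?u (z + s) = ?u (z + m)" "?u (z - s) = ?u (z - m)"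
      unfolding m_def by (rule fibre_cong; simp add: mod_add_right_eq mod_diff_right_eq)+
    then show "?u (z + s) = ?u (z - s)" using key by simp
  qed
  then obtain c where "\<And>t. ?u (c - t) = ?u t" unfolding palindromic_def by blast
  then show ?thesis by (rule model_palindrome_self_dual[OF tV M])
qed

lemma self_dual_from_subsets:
  assumes tV: "tour V E" and df: "diamond_free V E" and m: "m \<ge> 6"
    and base: "\<And>J. J \<subseteq> V \<Longrightarrow> card J = m \<Longrightarrow> tour_iso J E J E\<^sup>d"
  shows "J \<subseteq> V \<Longrightarrow> card J = m + k \<Longrightarrow> tour_iso J E J E\<^sup>d"
proof (induction k arbitrary: J)
  case (Suc k)
  show ?case
  proof (rule self_dual_from_deletions)
    show "tour J E" by (rule tour_subset[OF tV Suc.prems(1)])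
    show "diamond_free J E" by (rule diamond_free_subset[OF df Suc.prems(1)])
    show "card J \<ge> 7" using Suc.prems(2) m by simp
    fix v assume "v \<in> J"
    then show "tour_iso (J - {v}) E (J - {v}) E\<^sup>d"
      using Suc.prems by (intro Suc.IH) auto
  qed
qed (use base in simp)

section \<open>Reconstruction\<close>

context reversed_block
begin

text \<open>If some chain has two vertices, it serves as \<open>C\<close>. Otherwise
  \<open>E'\<close> is exactly the dual of \<open>E\<close> on \<open>B\<close>, so \<open>I\<close>
  is a common interval, and it is acyclic by \<open>interval_with_cycle\<close>.\<close>

lemma twin_interval:
  assumes I: "ivl B E I" "card I \<ge> 2" "I \<noteq> B"
  shows "\<exists>C x x'. twin_block V E E' B c C x x'"
proof -
  have IB: "I \<subseteq> B" using I(1) unfolding ivl_def by blast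
  have pair: "\<exists>x\<in>C. \<exists>x'\<in>C. x \<noteq> x'" if "card C \<ge> 2" for C :: "'a set"
  proof (rule ccontr)
    assume neg: "\<not> ?thesis"
    have "C \<noteq> {}" using that by auto
    then obtain z where "z \<in> C" by blast
    then have "C = {z}" using neg by blast
    then show False using that by simp
  qed
  have make: "\<exists>C x x'. twin_block V E E' B c C x x'"
    if C: "C \<subseteq> B" "ivl V E C" "ivl V E' C" "cycle_free C E" "card C \<ge> 2"
      and cd: "\<And>y z. y \<in> B - C \<Longrightarrow> z \<in> C \<Longrightarrow> diff E E' y z" for C
  proof -
    obtain x x' where xx: "x \<in> C" "x' \<in> C" "x \<noteq> x'" using pair[OF C(5)] by blast
    have "twin_block V E E' B c C x x'"
      by (intro twin_block.intro twin_block_axioms.intro reversed_block_axioms C(1-4) xx cd)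
    then show ?thesis by (intro exI)
  qed
  show ?thesis
  proof (cases "\<exists>u\<in>B. card (c u) \<ge> 2")
    case True
    then obtain u where u: "u \<in> B" "card (c u) \<ge> 2" by blast
    have "diff E E' y z" if "y \<in> B - c u" "z \<in> c u" for y z
    proof -
      have "c z = c u" using c_eq[OF u(1) that(2)] .
      moreover have "y \<in> c y" using c_self that(1) by blast
      ultimately have "c y \<noteq> c z" using that(1) by blast
      then show ?thesis using c_diff[of y z] that c_sub(1)[OF u(1)] by blast
    qed
    then show ?thesis using make[of "c u"] c_sub(1) c_ivl c_chain u by blast
  next
    case False
    have single: "w = u" if u: "u \<in> B" and "w \<in> c u" for u w
    proof (rule ccontr)
      assume "w \<noteq> u"
      then have "card {u, w} = 2" by simp
      moreover have "card {u, w} \<le> card (c u)"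
        using finite_subset[OF c_sub(1)[OF u] finB] c_self[OF u] that by (intro card_mono) auto
      ultimately show False using False u by auto
    qed
    have d: "diff E E' y z" if "y \<in> B" "z \<in> B" "y \<noteq> z" for y z
      using c_diff[of y z] single[of z y] c_self[of y] that by auto
    have rev: "E' y z \<longleftrightarrow> E z y" if "y \<in> B" "z \<in> B" "y \<noteq> z" for y z
      using d[OF that] tour_flip[OF tB(1) that] unfolding diff_def by blast
    have uni: "uniform E x I" if "x \<in> B - I" for x
      using I(1) that unfolding ivl_def by blast
    have "ivl B E' I"
      unfolding ivl_def
    proof (intro conjI ballI IB)
      fix x assume x: "x \<in> B - I"
      have "E' x y \<longleftrightarrow> E y x" "E' y x \<longleftrightarrow> E x y" if "y \<in> I" for y
        using rev[of x y] rev[of y x] x that IB by blast+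
      then show "uniform E' x I" using uni[OF x] by blast
    qed
    then have "ivl V E I" "ivl V E' I"
      using ivl_trans[OF ivl_B(1) I(1)] ivl_trans[OF ivl_B(2)] by auto
    moreover have "cycle_free I E" using interval_with_cycle[OF I(1)] I(3) by blast
    moreover have "diff E E' y z" if "y \<in> B - I" "z \<in> I" for y z
      using d[of y z] that IB by blast
    ultimately show ?thesis using make[of I] I(2) IB by blast
  qed
qed

lemma large_block_iso:
  assumes I: "ivl B E I" "card I \<ge> 2" "I \<noteq> B" and big: "card V \<le> card B + 3"
  shows "tour_iso B E B E'"
proof -
  obtain C x x' where T: "twin_block V E E' B c C x x'" using twin_interval[OF I] by blast
  interpret T: twin_block V E E' B c C x x' by (rule T)
  have df: "diamond_free B E" by (rule T.block_diamond_free)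
  define m where "m = card V - 3"
  have m: "m \<ge> 6" "m + 3 = card V" using card9 unfolding m_def by auto
  \<comment> \<open>Hypomorphy compares \<open>E\<close> with \<open>E'\<close> on \<open>J\<close>,
    and within the block \<open>E'\<close> is isomorphic to the dual of \<open>E\<close>.\<close>
  have base: "tour_iso J E J E\<^sup>d" if "J \<subseteq> B" "card J = m" for J
  proof -
    have "tour_iso J E J E'" using hyp that m(2) BV unfolding hypomorphic3_def by auto
    then show ?thesis using iso_dual_subset[OF that(1)] by (rule tour_iso_trans)
  qed
  have "card B = m + (card B - m)" using big m by simp
  then have "tour_iso B E B E\<^sup>d"
    by (intro self_dual_from_subsets[OF tB(1) df m(1) base order_refl])
  then show ?thesis
    using tour_iso_sym[OF iso_dual_subset[OF order_refl]] by (rule tour_iso_trans)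
qed

end

context hypo_pair
begin

text \<open>Components of reversed arcs are common intervals with only kept arcs between them, so
  isomorphisms of the single components glue. Components missing at most two vertices receive their
  nontrivial interval from \<open>no\<close>.\<close>

theorem hypomorphic_iso:
  assumes no: "\<And>B. ivl V E B \<Longrightarrow> card (V - B) \<le> 2 \<Longrightarrow>
      \<exists>I. ivl B E I \<and> card I \<ge> 2 \<and> I \<noteq> B"
  shows "tour_iso V E V E'"
proof -
  let ?R = "diff E E'" and ?c = "component (diff E E') V"
  have c_sub: "?c u \<subseteq> V" if "u \<in> V" for u by (rule component_subset[OF that])
  have c_self: "u \<in> ?c u" for u by (rule component_self)
  have c_conn: "conn ?R (?c u)" if "u \<in> V" for u
    using conn_component[of V ?R u] diff_symV that by blast
  have c_eq: "?c w = ?c u" if "u \<in> V" "w \<in> ?c u" for u w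
    using component_eq[of V ?R u w] diff_symV that by blast
  have c_nd: "\<not> ?R x y" if "u \<in> V" "x \<in> V - ?c u" "y \<in> ?c u" for u x y
    using component_closed[OF that(1,3), of x] diff_symV[of x y] that c_sub[OF that(1)] by blast
  have c_ivl: "ivl V E (?c u)" "ivl V E' (?c u)" if "u \<in> V" for u
    using conn_ivl[OF order_refl c_sub[OF that] c_conn[OF that] c_nd[OF that]] by auto
  have block: "tour_iso (?c u) E (?c u) E'" if u: "u \<in> V" for u
  proof (cases "cycle_free (?c u) E")
    case True
    moreover have "cycle_free (?c u) E'"
      using True same_cycles_free[OF same_cycles_subset[OF same c_sub[OF u]]] by simp
    ultimately show ?thesis
      using tour_subset[OF tE c_sub[OF u]] tour_subset[OF tE' c_sub[OF u]] by (intro chain_iso) auto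
  next
    case False
    let ?B = "?c u"
    interpret reversed_block V E E' ?B "component (diff E E'\<^sup>d) ?B"
      by (rule component_reversed[OF c_sub[OF u] c_conn[OF u] c_nd[OF u] False])
    show ?thesis
    proof (cases "card ?B + 3 \<le> card V")
      case True
      then show ?thesis by (rule small_block_iso)
    next
      case False
      moreover have "card (V - ?B) = card V - card ?B" using card_Diff_subset[OF finB BV] .
      ultimately have "card (V - ?B) \<le> 2" by simp
      then obtain I where "ivl ?B E I" "card I \<ge> 2" "I \<noteq> ?B" using no[OF ivl_B(1)] by blast
      then show ?thesis by (rule large_block_iso) (use False in simp)
    qed
  qed
  show ?thesis
  proof (rule tour_iso_glue[where c = ?c and d = ?c])
    fix k assume "k \<in> ?c ` V"
    then obtain u where u: "u \<in> V" "k = ?c u" by blast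
    have "{v\<in>V. ?c v = k} = ?c u"
    proof (intro equalityI subsetI)
      fix v assume "v \<in> {v\<in>V. ?c v = k}"
      then have "?c v = ?c u" using u(2) by simp
      then show "v \<in> ?c u" using c_self[of v] by simp
    next
      fix v assume "v \<in> ?c u"
      then show "v \<in> {v\<in>V. ?c v = k}" using c_eq[OF u(1)] c_sub[OF u(1)] u(2) by blast
    qed
    then show "tour_iso {v\<in>V. ?c v = k} E {w\<in>V. ?c w = k} E'" using block[OF u(1)] by simp
  next
    fix v v' w w' assume V: "v \<in> V" "v' \<in> V" "w \<in> V" "w' \<in> V" and ne: "?c v \<noteq> ?c v'"
      and w: "?c w = ?c v" "?c w' = ?c v'"
    have in1: "v \<in> ?c v" "w \<in> ?c v" "v' \<in> ?c v'" "w' \<in> ?c v'" using c_self w by (metis, metis, metis, metis)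
    have out: "v' \<notin> ?c v" "w \<notin> ?c v'"
      using c_eq[OF V(1), of v'] c_eq[OF V(2), of w] ne w(1) by auto
    have "E v v' \<longleftrightarrow> E w v'" by (rule ivl_uniform(2)[OF tE c_ivl(1)[OF V(1)] V(2) out(1) in1(1,2)])
    also have "\<dots> \<longleftrightarrow> E w w'" by (rule ivl_uniform(1)[OF tE c_ivl(1)[OF V(2)] V(3) out(2) in1(3,4)])
    also have "\<dots> \<longleftrightarrow> E' w w'"
      using c_nd[OF V(2) _ in1(4), of w] out(2) V(3) unfolding diff_def by blast
    finally show "E v v' = E' w w'" .
  qed simp
qed

end

section \<open>Passing between digraphs and arc relations\<close>

lemma tournament_tour:
  assumes "tournament T"
  shows "tour (pverts T) (\<lambda>x y. (x, y) \<in> parcs T)"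
proof -
  interpret tournament T by fact
  show ?thesis
    unfolding tour_def
  proof (intro conjI ballI impI)
    show "finite (pverts T)" by (rule pair_finite_verts)
    show "(x, x) \<notin> parcs T" for x using no_loops' by blast
    show "((x, y) \<in> parcs T) \<noteq> ((y, x) \<in> parcs T)" if "x \<in> pverts T" "y \<in> pverts T" "x \<noteq> y" for x y
      using exactly_one_arc[OF that] by blast
  qed
qed

lemma digraph_iso_induce_iff:
  "digraph_iso (with_proj T \<restriction> X) (with_proj T' \<restriction> X) \<longleftrightarrow>
    tour_iso X (\<lambda>x y. (x, y) \<in> parcs T) X (\<lambda>x y. (x, y) \<in> parcs T')"
proof -
  have wf: "pair_wf_digraph \<lparr>pverts = X, parcs = parcs G \<inter> X \<times> X\<rparr>" for G :: "'a pair_pre_digraph"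
    by unfold_locales auto
  have "(\<exists>f. bij_betw f X X \<and> (\<forall>x\<in>X. \<forall>y\<in>X. (x, y) \<in> parcs T \<inter> X \<times> X \<longleftrightarrow> (f x, f y) \<in> parcs T' \<inter> X \<times> X)) \<longleftrightarrow>
      (\<exists>f. bij_betw f X X \<and> (\<forall>x\<in>X. \<forall>y\<in>X. (x, y) \<in> parcs T \<longleftrightarrow> (f x, f y) \<in> parcs T'))"
    by (intro ex_cong1 conj_cong refl ball_cong) (auto dest: bij_betw_apply)
  then show ?thesis
    unfolding with_proj_induce_subgraph digraph_iso_with_proj_iff[OF wf wf] tour_iso_def by simp
qed

lemma interval_iff_ivl: "interval (with_proj T) I \<longleftrightarrow> ivl (pverts T) (\<lambda>x y. (x, y) \<in> parcs T) I"
  unfolding interval_def ivl_def by simp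

lemma decomposable_induce:
  assumes "decomposable (with_proj T \<restriction> B)" and fin: "finite B"
  shows "\<exists>I. ivl B (\<lambda>x y. (x, y) \<in> parcs T) I \<and> card I \<ge> 2 \<and> I \<noteq> B"
proof -
  let ?G = "\<lparr>pverts = B, parcs = parcs T \<inter> B \<times> B\<rparr>"
  obtain I where I: "interval (with_proj ?G) I" "\<not> trivial_interval (with_proj ?G) I"
    using assms(1) unfolding with_proj_induce_subgraph indecomposable_def by blast
  then have ivl: "ivl B (\<lambda>x y. (x, y) \<in> parcs T) I"
    unfolding interval_iff_ivl ivl_def by auto
  then have IB: "I \<subseteq> B" unfolding ivl_def by blast
  have "I \<noteq> {}" "I \<noteq> B" "\<not> (\<exists>x. I = {x})"
    using I(2) IB unfolding trivial_interval_def by auto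
  then have "card I \<noteq> 0" "card I \<noteq> 1"
    using finite_subset[OF IB fin] card_1_singletonE[of I] by auto
  then show ?thesis using ivl \<open>I \<noteq> B\<close> by (intro exI[of _ I]) simp
qed

theorem corollary7:
  fixes T :: "'a pair_pre_digraph"
  assumes "tournament T"
    and "decomposable (with_proj T)"
    and "card (pverts T) \<ge> 9"
    and "\<not> (\<exists>X. interval (with_proj T) X \<and> indecomposable (with_proj T \<restriction> X)
           \<and> card (pverts T - X) \<le> 2)"
  shows "minus3_reconstructible T"
  unfolding minus3_reconstructible_def
proof (intro allI impI, elim conjE)
  fix T' assume T': "tournament T'" and hyp: "minus3_hypomorphic T T'"
  let ?V = "pverts T" and ?E = "\<lambda>x y. (x, y) \<in> parcs T" and ?E' = "\<lambda>x y. (x, y) \<in> parcs T'"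
  have V: "pverts T' = ?V" using hyp unfolding minus3_hypomorphic_def by simp
  have tE: "tour ?V ?E" by (rule tournament_tour[OF assms(1)])
  have tE': "tour ?V ?E'" using tournament_tour[OF T'] unfolding V .
  have fin: "finite ?V" using tE by (rule tour_finite)
  have "hypomorphic3 ?V ?E ?E'"
    unfolding hypomorphic3_def
  proof (intro allI impI)
    fix J assume J: "J \<subseteq> ?V" "card J + 3 = card ?V"
    have "card (?V - J) = 3" using card_Diff_subset[OF finite_subset[OF J(1) fin] J(1)] J(2) by simp
    moreover have "?V - (?V - J) = J" using J(1) by blast
    ultimately have "digraph_iso (with_proj T \<restriction> J) (with_proj T' \<restriction> J)"
      using hyp unfolding minus3_hypomorphic_def by (metis Diff_subset)
    then show "tour_iso J ?E J ?E'" unfolding digraph_iso_induce_iff .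
  qed
  then interpret hypo_pair ?V ?E ?E'
    using tE tE' assms(3) by unfold_locales
  have "tour_iso ?V ?E ?V ?E'"
  proof (rule hypomorphic_iso)
    fix B assume B: "ivl ?V ?E B" "card (?V - B) \<le> 2"
    then have "decomposable (with_proj T \<restriction> B)" using assms(4) interval_iff_ivl by blast
    moreover have "finite B" using B(1) fin finite_subset unfolding ivl_def by blast
    ultimately show "\<exists>I. ivl B ?E I \<and> card I \<ge> 2 \<and> I \<noteq> B" by (rule decomposable_induce)
  qed
  then have iso: "tour_iso ?V ?E' ?V ?E" by (rule tour_iso_sym)
  have wf: "pair_wf_digraph T'" "pair_wf_digraph T"
    using assms(1) T' by (auto simp: tournament_def pair_digraph_def pair_fin_digraph_def)
  show "digraph_iso (with_proj T') (with_proj T)"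
    unfolding digraph_iso_with_proj_iff[OF wf] V using iso unfolding tour_iso_def .
qed

end
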